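(* Let $M$ be a Kähler manifold and $f : M\to\mathbb{R}^n$ an isometric immersion with complex Gauss map $\tau'$, and let $\tau_1 = (\tau',N,\tau'') : M\to Z_1$. Then $f$ has parallel pluri-mean curvature if and only if $\tau_1 : M\to Z_1$ is a (super)horizontal pluriharmonic map.
   Context: A Kähler manifold $M$ is a Riemannian manifold of real dimension $2m$ with a parallel orthogonal almost complex structure $J$. The complexified tangent bundle splits as $T^cM = TM\otimes\mathbb{C} = T'\oplus T''$ with $J=i$ on $T'$, $J=-i$ on $T''$. For an isometric immersion $f$ with second fundamental form $\alpha$, the pluri-mean curvature is $\alpha^{(1,1)}(x,y)=\frac12(\alpha(x,y)+\alpha(Jx,Jy))$; $f$ has parallel pluri-mean curvature if $\alpha^{(1,1)}$ is parallel with respect to the tangent and normal connections. $Z_1$ is the set of $m$-dimensional complex subspaces $E\subset\mathbb{C}^n$ that are isotropic, i.e. $\langle x,y\rangle=\sum_j x_jy_j$ vanishes on $E\times E$. Identify $E\in Z_1$ with the orthogonal decomposition (flag) $(E,(E+\bar E)^\perp,\bar E)$ of $\mathbb{C}^n$, where $\perp$ refers to the Hermitian inner product. Thus $Z_1 = O_n/(U_m\times O_{n-2m})$ is a flag manifold fibering over the real Grassmannian $Gr$ of $2m$-planes in $\mathbb{R}^n$ by $\pi(E)=E+\bar E$ (real subspaces of $\mathbb{R}^n$ are identified with conjugation-invariant complex subspaces of $\mathbb{C}^n$); $Z_1$ carries an $O_n$-invariant Riemannian metric, for which $\pi$ is (up to a scaling factor) a Riemannian submersion. A tangent vector of $Z_1$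 at $E$, viewed as an element of $\mathrm{Hom}(E,E^\perp)$ with $E^\perp = N_E+\bar E$, $N_E=(E+\bar E)^\perp$, is horizontal (for $Z_1$ equivalently superhorizontal) if it maps $E$ into $N_E$; this is the orthogonal complement of the fibre directions of $\pi$. A map into $Z_1$ is (super)horizontal if its differential takes values in horizontal vectors. The complex Gauss map of $f$ is $\tau'(p)=df_p(T'_pM)=\{df(x)-i\,df(Jx): x\in T_pM\}\in Z_1$; $\tau''=\overline{\tau'}$, and $N=(\tau'+\tau'')^\perp$ is the complexified normal bundle of $f$. A smooth map $\phi : M\to Z$ into a Riemannian manifold is pluriharmonic if its Hessian $Dd\phi$ (formed with the Levi-Civita connections) vanishes on $T'\otimes T''$. *)

theory Defs
  imports "HOL-Analysis.Analysis"
begin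

section \<open>Smooth maps between open subsets of normed spaces\<close>

primrec Ck_on :: "nat \<Rightarrow> 'u::real_normed_vector set \<Rightarrow> ('u \<Rightarrow> 'v::real_normed_vector) \<Rightarrow> bool" where
  "Ck_on 0 S F \<longleftrightarrow> continuous_on S F"
| "Ck_on (Suc k) S F \<longleftrightarrow>
     (\<forall>x\<in>S. F differentiable (at x)) \<and> (\<forall>v. Ck_on k S (\<lambda>x. frechet_derivative F (at x) v))"

definition smooth_on :: "'u::real_normed_vector set \<Rightarrow> ('u \<Rightarrow> 'v::real_normed_vector) \<Rightarrow> bool" where
  "smooth_on S F \<longleftrightarrow> (\<forall>k. Ck_on k S F)"

abbreviation FD :: "('u::real_normed_vector \<Rightarrow> 'v::real_normed_vector) \<Rightarrow> 'u \<Rightarrow> 'u \<Rightarrow> 'v" where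
  "FD F x \<equiv> frechet_derivative F (at x)"

definition FD2 :: "('u::real_normed_vector \<Rightarrow> 'v::real_normed_vector) \<Rightarrow> 'u \<Rightarrow> 'u \<Rightarrow> 'u \<Rightarrow> 'v" where
  "FD2 F x u v = FD (\<lambda>y. FD F y v) x u"


section \<open>Riemannian metrics on open sets, Levi-Civita connection\<close>

definition riem_metric_on ::
    "'u::real_normed_vector set \<Rightarrow> ('u \<Rightarrow> 'u \<Rightarrow> 'u \<Rightarrow> real) \<Rightarrow> bool" where
  "riem_metric_on S G \<longleftrightarrow>
     (\<forall>x\<in>S. bilinear (G x) \<and> (\<forall>u v. G x u v = G x v u) \<and> (\<forall>u. u \<noteq> 0 \<longrightarrow> G x u u > 0)) \<and>
     (\<forall>u v. smooth_on S (\<lambda>x. G x u v))"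

text \<open>The Koszul formula for constant vector fields: \<open>koszul G x u v z\<close> is
  \<open>G x (\<nabla>\<^sub>u v) z\<close> for the Levi-Civita connection \<open>\<nabla>\<close> of \<open>G\<close>.\<close>

definition koszul ::
    "('u::real_normed_vector \<Rightarrow> 'u \<Rightarrow> 'u \<Rightarrow> real) \<Rightarrow> 'u \<Rightarrow> 'u \<Rightarrow> 'u \<Rightarrow> 'u \<Rightarrow> real" where
  "koszul G x u v z =
     (FD (\<lambda>y. G y v z) x u + FD (\<lambda>y. G y u z) x v - FD (\<lambda>y. G y u v) x z) / 2"

definition christoffel ::
    "('u::real_normed_vector \<Rightarrow> 'u \<Rightarrow> 'u \<Rightarrow> real) \<Rightarrow> 'u \<Rightarrow> 'u \<Rightarrow> 'u \<Rightarrow> 'u" where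
  "christoffel G x u v = (THE w. \<forall>z. G x w z = koszul G x u v z)"


section \<open>Smooth manifolds\<close>

text \<open>A manifold is a type together with a (not necessarily maximal) smooth atlas; a chart is a
  pair of its domain and its coordinate map.\<close>

type_synonym ('a, 'e) chart = "'a set \<times> ('a \<Rightarrow> 'e)"

definition chart_inv :: "('a, 'e) chart \<Rightarrow> 'e \<Rightarrow> 'a" where
  "chart_inv c = inv_into (fst c) (snd c)"

definition chart_image :: "('a, 'e) chart \<Rightarrow> 'e set" where
  "chart_image c = snd c ` fst c"

definition is_chart :: "('a::topological_space, 'e::euclidean_space) chart \<Rightarrow> bool" where
  "is_chart c \<longleftrightarrow> open (fst c) \<and> open (chart_image c) \<and>
     homeomorphism (fst c) (chart_image c) (snd c) (chart_inv c)"

definition smooth_atlas :: "('a::topological_space, 'e::euclidean_space) chart set \<Rightarrow> bool" where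
  "smooth_atlas A \<longleftrightarrow> (\<forall>c\<in>A. is_chart c) \<and> (\<Union>c\<in>A. fst c) = UNIV \<and>
     (\<forall>c\<in>A. \<forall>d\<in>A. smooth_on (snd c ` (fst c \<inter> fst d)) (snd d \<circ> chart_inv c))"

definition smooth_map ::
    "('a, 'e::euclidean_space) chart set \<Rightarrow> ('a \<Rightarrow> 'v::real_normed_vector) \<Rightarrow> bool" where
  "smooth_map A F \<longleftrightarrow> (\<forall>c\<in>A. smooth_on (chart_image c) (F \<circ> chart_inv c))"

text \<open>A tangent vector at \<open>p\<close> assigns to every chart around \<open>p\<close> a coordinate vector, subject to
  the usual transformation law; on other charts it is 0 by convention.\<close>

type_synonym ('a, 'e) tvec = "('a, 'e) chart \<Rightarrow> 'e"

definition tangent_space ::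
    "('a, 'e::euclidean_space) chart set \<Rightarrow> 'a \<Rightarrow> ('a, 'e) tvec set" where
  "tangent_space A p = {X.
     (\<forall>c. \<not> (c \<in> A \<and> p \<in> fst c) \<longrightarrow> X c = 0) \<and>
     (\<forall>c\<in>A. \<forall>d\<in>A. p \<in> fst c \<inter> fst d \<longrightarrow> X d = FD (snd d \<circ> chart_inv c) (snd c p) (X c))}"

text \<open>The tangent vector at \<open>p\<close> with coordinate vector \<open>u\<close> in the chart \<open>c\<close>.\<close>

definition coord_vec ::
    "('a, 'e::euclidean_space) chart set \<Rightarrow> ('a, 'e) chart \<Rightarrow> 'a \<Rightarrow> 'e \<Rightarrow> ('a, 'e) tvec" where
  "coord_vec A c p u =
     (\<lambda>d. if d \<in> A \<and> p \<in> fst d then FD (snd d \<circ> chart_inv c) (snd c p) u else 0)"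

text \<open>The differential of a map into a vector space; by the transformation law it does not depend
  on the chosen chart.\<close>

definition differential ::
    "('a, 'e::euclidean_space) chart set \<Rightarrow> ('a \<Rightarrow> 'v::real_normed_vector) \<Rightarrow> 'a \<Rightarrow>
     ('a, 'e) tvec \<Rightarrow> 'v" where
  "differential A F p X =
     (let c = (SOME c. c \<in> A \<and> p \<in> fst c) in FD (F \<circ> chart_inv c) (snd c p) (X c))"


section \<open>Kaehler manifolds\<close>

definition metric_in ::
    "('a, 'e::euclidean_space) chart set \<Rightarrow> ('a \<Rightarrow> ('a, 'e) tvec \<Rightarrow> ('a, 'e) tvec \<Rightarrow> real) \<Rightarrow>
     ('a, 'e) chart \<Rightarrow> 'e \<Rightarrow> 'e \<Rightarrow> 'e \<Rightarrow> real" where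
  "metric_in A g c x u v =
     g (chart_inv c x) (coord_vec A c (chart_inv c x) u) (coord_vec A c (chart_inv c x) v)"

definition endo_in ::
    "('a, 'e::euclidean_space) chart set \<Rightarrow> ('a \<Rightarrow> ('a, 'e) tvec \<Rightarrow> ('a, 'e) tvec) \<Rightarrow>
     ('a, 'e) chart \<Rightarrow> 'e \<Rightarrow> 'e \<Rightarrow> 'e" where
  "endo_in A J c x u = J (chart_inv c x) (coord_vec A c (chart_inv c x) u) c"

abbreviation Gam ::
    "('a, 'e::euclidean_space) chart set \<Rightarrow> ('a \<Rightarrow> ('a, 'e) tvec \<Rightarrow> ('a, 'e) tvec \<Rightarrow> real) \<Rightarrow>
     ('a, 'e) chart \<Rightarrow> 'e \<Rightarrow> 'e \<Rightarrow> 'e \<Rightarrow> 'e" where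
  "Gam A g c \<equiv> christoffel (metric_in A g c)"

definition riemannian_manifold ::
    "('a::topological_space, 'e::euclidean_space) chart set \<Rightarrow>
     ('a \<Rightarrow> ('a, 'e) tvec \<Rightarrow> ('a, 'e) tvec \<Rightarrow> real) \<Rightarrow> bool" where
  "riemannian_manifold A g \<longleftrightarrow> smooth_atlas A \<and>
     (\<forall>c\<in>A. riem_metric_on (chart_image c) (metric_in A g c))"

definition almost_complex_structure ::
    "('a, 'e::euclidean_space) chart set \<Rightarrow> ('a \<Rightarrow> ('a, 'e) tvec \<Rightarrow> ('a, 'e) tvec) \<Rightarrow> bool" where
  "almost_complex_structure A J \<longleftrightarrow>
     (\<forall>p. \<forall>X\<in>tangent_space A p. J p X \<in> tangent_space A p \<and> J p (J p X) = (\<lambda>c. - X c)) \<and>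
     (\<forall>c\<in>A. (\<forall>x\<in>chart_image c. linear (endo_in A J c x)) \<and>
             (\<forall>u. smooth_on (chart_image c) (\<lambda>x. endo_in A J c x u)))"

text \<open>In a chart, \<open>(\<nabla>\<^sub>u J) v = \<nabla>\<^sub>u (J v) - J (\<nabla>\<^sub>u v)\<close> for constant fields \<open>u\<close>, \<open>v\<close>.\<close>

definition parallel_endo ::
    "('a, 'e::euclidean_space) chart set \<Rightarrow> ('a \<Rightarrow> ('a, 'e) tvec \<Rightarrow> ('a, 'e) tvec \<Rightarrow> real) \<Rightarrow>
     ('a \<Rightarrow> ('a, 'e) tvec \<Rightarrow> ('a, 'e) tvec) \<Rightarrow> bool" where
  "parallel_endo A g J \<longleftrightarrow> (\<forall>c\<in>A. \<forall>x\<in>chart_image c. \<forall>u v.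
     FD (\<lambda>y. endo_in A J c y v) x u + Gam A g c x u (endo_in A J c x v)
       - endo_in A J c x (Gam A g c x u v) = 0)"

definition kaehler_manifold ::
    "('a::topological_space, 'e::euclidean_space) chart set \<Rightarrow>
     ('a \<Rightarrow> ('a, 'e) tvec \<Rightarrow> ('a, 'e) tvec \<Rightarrow> real) \<Rightarrow>
     ('a \<Rightarrow> ('a, 'e) tvec \<Rightarrow> ('a, 'e) tvec) \<Rightarrow> bool" where
  "kaehler_manifold A g J \<longleftrightarrow> riemannian_manifold A g \<and> almost_complex_structure A J \<and>
     (\<forall>p. \<forall>X\<in>tangent_space A p. \<forall>Y\<in>tangent_space A p. g p (J p X) (J p Y) = g p X Y) \<and>
     parallel_endo A g J"


section \<open>Isometric immersions and their pluri-mean curvature\<close>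

definition isometric_immersion ::
    "('a, 'e::euclidean_space) chart set \<Rightarrow> ('a \<Rightarrow> ('a, 'e) tvec \<Rightarrow> ('a, 'e) tvec \<Rightarrow> real) \<Rightarrow>
     ('a \<Rightarrow> real^'n) \<Rightarrow> bool" where
  "isometric_immersion A g f \<longleftrightarrow> smooth_map A f \<and>
     (\<forall>p. \<forall>X\<in>tangent_space A p. \<forall>Y\<in>tangent_space A p.
        differential A f p X \<bullet> differential A f p Y = g p X Y)"

text \<open>The component of \<open>y\<close> normal to the immersed submanifold parametrized by \<open>F\<close>.\<close>

definition normal_part ::
    "('e::euclidean_space \<Rightarrow> 'v::euclidean_space) \<Rightarrow> 'e \<Rightarrow> 'v \<Rightarrow> 'v" where
  "normal_part F x y = (THE z. (\<exists>u. y - z = FD F x u) \<and> (\<forall>u. z \<bullet> FD F x u = 0))"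

definition second_ff ::
    "('a \<Rightarrow> real^'n) \<Rightarrow> ('a, 'e::euclidean_space) chart \<Rightarrow> 'e \<Rightarrow> 'e \<Rightarrow> 'e \<Rightarrow> real^'n" where
  "second_ff f c x u v =
     normal_part (f \<circ> chart_inv c) x (FD2 (f \<circ> chart_inv c) x u v)"

definition pluri_mean_curvature ::
    "('a, 'e::euclidean_space) chart set \<Rightarrow> ('a \<Rightarrow> ('a, 'e) tvec \<Rightarrow> ('a, 'e) tvec) \<Rightarrow>
     ('a \<Rightarrow> real^'n) \<Rightarrow> ('a, 'e) chart \<Rightarrow> 'e \<Rightarrow> 'e \<Rightarrow> 'e \<Rightarrow> real^'n" where
  "pluri_mean_curvature A J f c x u v =
     (1/2) *\<^sub>R (second_ff f c x u v + second_ff f c x (endo_in A J c x u) (endo_in A J c x v))"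

text \<open>The normal connection is the normal part of the derivative in Euclidean space.\<close>

definition parallel_pluri_mean_curvature ::
    "('a, 'e::euclidean_space) chart set \<Rightarrow> ('a \<Rightarrow> ('a, 'e) tvec \<Rightarrow> ('a, 'e) tvec \<Rightarrow> real) \<Rightarrow>
     ('a \<Rightarrow> ('a, 'e) tvec \<Rightarrow> ('a, 'e) tvec) \<Rightarrow> ('a \<Rightarrow> real^'n) \<Rightarrow> bool" where
  "parallel_pluri_mean_curvature A g J f \<longleftrightarrow> (\<forall>c\<in>A. \<forall>x\<in>chart_image c. \<forall>u v w.
     normal_part (f \<circ> chart_inv c) x (FD (\<lambda>y. pluri_mean_curvature A J f c y v w) x u)
       - pluri_mean_curvature A J f c x (Gam A g c x u v) w
       - pluri_mean_curvature A J f c x v (Gam A g c x u w) = 0)"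


section \<open>Riemannian submanifolds of a Euclidean space and pluriharmonic maps into them\<close>

text \<open>The target manifold is a subset \<open>Z\<close> of a Euclidean space.  Its metric is given as the
  restriction to \<open>Z\<close> of a Riemannian metric \<open>h\<close> of the ambient space; on a closed submanifold every
  Riemannian metric arises in this way.  The notions below depend only on the restriction.\<close>

definition tangent_at :: "'v::real_normed_vector set \<Rightarrow> 'v \<Rightarrow> 'v set" where
  "tangent_at Z P = {W. \<exists>\<gamma> \<epsilon>. \<epsilon> > 0 \<and> smooth_on {-\<epsilon><..<\<epsilon>} \<gamma> \<and> \<gamma> ` {-\<epsilon><..<\<epsilon>} \<subseteq> Z \<and>
     \<gamma> (0::real) = P \<and> (\<gamma> has_vector_derivative W) (at 0)}"

text \<open>The Hessian \<open>(D d\<Phi>)(u,v) = \<nabla>\<^sub>u d\<Phi>(v) - d\<Phi>(\<nabla>\<^sub>u v)\<close> in a chart of the domain.  Since the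
  Levi-Civita connection of \<open>Z\<close> is the \<open>h\<close>-tangential part of that of the ambient metric \<open>h\<close>,
  it is the vector tangent to \<open>Z\<close> representing the functional below.\<close>

definition hessian ::
    "('a, 'e::euclidean_space) chart set \<Rightarrow> ('a \<Rightarrow> ('a, 'e) tvec \<Rightarrow> ('a, 'e) tvec \<Rightarrow> real) \<Rightarrow>
     'v::euclidean_space set \<Rightarrow> ('v \<Rightarrow> 'v \<Rightarrow> 'v \<Rightarrow> real) \<Rightarrow> ('a \<Rightarrow> 'v) \<Rightarrow>
     ('a, 'e) chart \<Rightarrow> 'e \<Rightarrow> 'e \<Rightarrow> 'e \<Rightarrow> 'v" where
  "hessian A g Z h \<Phi> c x u v =
     (let F = \<Phi> \<circ> chart_inv c; T = tangent_at Z (F x) in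
      THE W. W \<in> T \<and> (\<forall>Y\<in>T. h (F x) W Y =
        h (F x) (FD2 F x u v - FD F x (Gam A g c x u v)) Y + koszul h (F x) (FD F x u) (FD F x v) Y))"

text \<open>A pair \<open>(x, y)\<close> stands for \<open>x + i y\<close> in the complexification of a real vector space.\<close>

definition complexified ::
    "('e \<Rightarrow> 'e \<Rightarrow> 'v::real_vector) \<Rightarrow> 'e \<times> 'e \<Rightarrow> 'e \<times> 'e \<Rightarrow> 'v \<times> 'v" where
  "complexified B = (\<lambda>(x, x') (y, y'). (B x y - B x' y', B x y' + B x' y))"

definition T10 :: "('e::real_vector \<Rightarrow> 'e) \<Rightarrow> ('e \<times> 'e) set" where
  "T10 j = {(x, x'). (j x, j x') = (- x', x)}"

definition T01 :: "('e::real_vector \<Rightarrow> 'e) \<Rightarrow> ('e \<times> 'e) set" where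
  "T01 j = {(x, x'). (j x, j x') = (x', - x)}"

definition pluriharmonic ::
    "('a, 'e::euclidean_space) chart set \<Rightarrow> ('a \<Rightarrow> ('a, 'e) tvec \<Rightarrow> ('a, 'e) tvec \<Rightarrow> real) \<Rightarrow>
     ('a \<Rightarrow> ('a, 'e) tvec \<Rightarrow> ('a, 'e) tvec) \<Rightarrow>
     'v::euclidean_space set \<Rightarrow> ('v \<Rightarrow> 'v \<Rightarrow> 'v \<Rightarrow> real) \<Rightarrow> ('a \<Rightarrow> 'v) \<Rightarrow> bool" where
  "pluriharmonic A g J Z h \<Phi> \<longleftrightarrow> smooth_map A \<Phi> \<and> range \<Phi> \<subseteq> Z \<and>
     (\<forall>c\<in>A. \<forall>x\<in>chart_image c. \<forall>X\<in>T10 (endo_in A J c x). \<forall>Y\<in>T01 (endo_in A J c x).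
        complexified (hessian A g Z h \<Phi> c x) X Y = 0)"


section \<open>Isotropic subspaces\<close>

definition hermitian :: "complex^'n \<Rightarrow> complex^'n \<Rightarrow> complex" where
  "hermitian x y = (\<Sum>j\<in>UNIV. x $ j * cnj (y $ j))"

definition cnj_vec :: "complex^'n \<Rightarrow> complex^'n" where
  "cnj_vec x = (\<chi> j. cnj (x $ j))"

definition cnj_mat :: "complex^'n^'m \<Rightarrow> complex^'n^'m" where
  "cnj_mat P = (\<chi> i j. cnj (P $ i $ j))"

definition Z1 :: "nat \<Rightarrow> (complex^'n) set set" where
  "Z1 m = {E. vec.subspace E \<and> vec.dim E = m \<and> (\<forall>x\<in>E. \<forall>y\<in>E. (\<Sum>j\<in>UNIV. x $ j * y $ j) = 0)}"

definition plus_conj :: "(complex^'n) set \<Rightarrow> (complex^'n) set" where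
  "plus_conj E = {x + cnj_vec y | x y. x \<in> E \<and> y \<in> E}"

definition normal_space :: "(complex^'n) set \<Rightarrow> (complex^'n) set" where
  "normal_space E = {x. \<forall>y\<in>plus_conj E. hermitian x y = 0}"

text \<open>Conjugation-invariant complex subspaces of dimension \<open>k\<close>, that is, real \<open>k\<close>-planes.\<close>

definition real_planes :: "nat \<Rightarrow> (complex^'n) set set" where
  "real_planes k = {S. vec.subspace S \<and> vec.dim S = k \<and> cnj_vec ` S = S}"

text \<open>Manifolds of subspaces are regarded as submanifolds of the space of matrices by means of the
  Hermitian orthogonal projections.  The derivative \<open>W\<close> of the projection \<open>P\<close> along a curve through
  \<open>E\<close> maps \<open>E\<close> to its Hermitian complement, and its restriction to \<open>E\<close> is the usual representation
  of the tangent vector as a homomorphism: if \<open>s\<close> is a curve of vectors in the moving subspace, then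
  differentiating \<open>P s = s\<close> shows that \<open>W s\<close> is the component of \<open>s'\<close> orthogonal to \<open>E\<close>.\<close>

definition is_proj :: "(complex^'n) set \<Rightarrow> complex^'n^'n \<Rightarrow> bool" where
  "is_proj E P \<longleftrightarrow> (\<forall>x\<in>E. P *v x = x) \<and> (\<forall>x. (\<forall>y\<in>E. hermitian x y = 0) \<longrightarrow> P *v x = 0)"

definition proj :: "(complex^'n) set \<Rightarrow> complex^'n^'n" where
  "proj E = (THE P. is_proj E P)"

definition horizontal_at :: "(complex^'n) set \<Rightarrow> complex^'n^'n \<Rightarrow> bool" where
  "horizontal_at E W \<longleftrightarrow> (\<forall>x\<in>E. W *v x \<in> normal_space E)"

definition superhorizontal ::
    "('a, 'e::euclidean_space) chart set \<Rightarrow> ('a \<Rightarrow> (complex^'n) set) \<Rightarrow> bool" where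
  "superhorizontal A \<tau> \<longleftrightarrow>
     (\<forall>p. \<forall>X\<in>tangent_space A p. horizontal_at (\<tau> p) (differential A (\<lambda>q. proj (\<tau> q)) p X))"

text \<open>The fibration \<open>E \<mapsto> E + cnj E\<close> over the real Grassmannian in terms of projections; it is the
  restriction of a linear map, which therefore is also its differential.\<close>

definition pi_proj :: "complex^'n^'n \<Rightarrow> complex^'n^'n" where
  "pi_proj P = P + cnj_mat P"

lemma is_proj_plus_conj:
  fixes E :: "(complex^'n) set"
  assumes "E \<in> Z1 m" "is_proj E P"
  shows "is_proj (plus_conj E) (pi_proj P)"
proof -
  have cc: "cnj_vec (cnj_vec x) = x" for x :: "complex^'n"
    by (simp add: cnj_vec_def vec_eq_iff)
  have c0: "cnj_vec 0 = (0 :: complex^'n)"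
    by (simp add: cnj_vec_def vec_eq_iff)
  have mv: "cnj_mat P *v x = cnj_vec (P *v cnj_vec x)" for x
    by (simp add: cnj_mat_def cnj_vec_def vec_eq_iff matrix_vector_mult_def)
  have L: "pi_proj P *v x = P *v x + cnj_vec (P *v cnj_vec x)" for x
    by (simp add: pi_proj_def matrix_vector_mult_add_rdistrib mv)
  have ad: "cnj_vec (x + y) = cnj_vec x + cnj_vec y" for x y :: "complex^'n"
    by (simp add: cnj_vec_def vec_eq_iff)
  have E0: "0 \<in> E"
    using assms(1) by (simp add: Z1_def vec.subspace_0)
  have fixE: "P *v x = x" if "x \<in> E" for x
    using assms(2) that by (simp add: is_proj_def)
  have orth: "P *v x = 0" if "\<And>y. y \<in> E \<Longrightarrow> hermitian x y = 0" for x
    using assms(2) that by (simp add: is_proj_def)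
  have iso: "P *v cnj_vec x = 0" if "x \<in> E" for x
  proof (rule orth)
    fix y assume "y \<in> E"
    then have "(\<Sum>j\<in>UNIV. x $ j * y $ j) = 0"
      using assms(1) that by (simp add: Z1_def)
    then have "cnj (\<Sum>j\<in>UNIV. x $ j * y $ j) = 0" by simp
    then show "hermitian (cnj_vec x) y = 0"
      by (simp add: hermitian_def cnj_vec_def)
  qed
  have "pi_proj P *v z = z" if z: "z \<in> plus_conj E" for z
  proof -
    obtain x y where "z = x + cnj_vec y" "x \<in> E" "y \<in> E"
      using z by (auto simp: plus_conj_def)
    then show ?thesis
      by (simp add: L ad cc c0 fixE iso matrix_vector_right_distrib)
  qed
  moreover have "pi_proj P *v z = 0" if z: "\<forall>y\<in>plus_conj E. hermitian z y = 0" for z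
  proof -
    have "x \<in> plus_conj E" if "x \<in> E" for x
      using that E0 unfolding plus_conj_def by (force simp: c0)
    then have 1: "P *v z = 0"
      using z by (intro orth) auto
    have 2: "cnj_vec x \<in> plus_conj E" if "x \<in> E" for x
      using that E0 unfolding plus_conj_def by force
    have "P *v cnj_vec z = 0"
    proof (rule orth)
      fix y assume "y \<in> E"
      then have "cnj (hermitian z (cnj_vec y)) = 0"
        using z 2 by simp
      then show "hermitian (cnj_vec z) y = 0"
        by (simp add: hermitian_def cnj_vec_def)
    qed
    then show ?thesis
      by (simp add: L 1 c0)
  qed
  ultimately show ?thesis
    by (auto simp: is_proj_def)
qed

text \<open>Invariance under the action \<open>P \<mapsto> Q P Q\<^sup>T\<close> of the real orthogonal group, which is the
  action \<open>E \<mapsto> Q E\<close> on subspaces.\<close>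

definition orth_act :: "real^'n^'n \<Rightarrow> complex^'n^'n \<Rightarrow> complex^'n^'n" where
  "orth_act Q P = (let R = (\<chi> i j. complex_of_real (Q $ i $ j)) in R ** P ** transpose R)"

definition orth_invariant ::
    "(complex^'n^'n) set \<Rightarrow> (complex^'n^'n \<Rightarrow> complex^'n^'n \<Rightarrow> complex^'n^'n \<Rightarrow> real) \<Rightarrow> bool" where
  "orth_invariant Z h \<longleftrightarrow> (\<forall>Q. orthogonal_matrix Q \<longrightarrow>
     (\<forall>P\<in>Z. \<forall>X\<in>tangent_at Z P. \<forall>Y\<in>tangent_at Z P.
        h (orth_act Q P) (orth_act Q X) (orth_act Q Y) = h P X Y))"

text \<open>A linear map \<open>L\<close> inducing a map from \<open>Z\<close> onto \<open>B\<close> which, up to a constant factor, is a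
  Riemannian submersion from the metric \<open>h\<close> to the metric induced on \<open>B\<close> by the inner product.
  For the Grassmannian, embedded by projections, the latter is the usual symmetric space metric.\<close>

definition riem_submersion_upto_scale ::
    "'v::euclidean_space set \<Rightarrow> ('v \<Rightarrow> 'v \<Rightarrow> 'v \<Rightarrow> real) \<Rightarrow> 'w::euclidean_space set \<Rightarrow> ('v \<Rightarrow> 'w) \<Rightarrow> bool"
  where
  "riem_submersion_upto_scale Z h B L \<longleftrightarrow> L ` Z = B \<and>
     (\<forall>P\<in>Z. L ` tangent_at Z P = tangent_at B (L P)) \<and>
     (\<exists>k>0. \<forall>P\<in>Z. \<forall>X\<in>tangent_at Z P. \<forall>Y\<in>tangent_at Z P.
        (\<forall>V\<in>tangent_at Z P. L V = 0 \<longrightarrow> h P X V = 0 \<and> h P Y V = 0) \<longrightarrow>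
        h P X Y = k * (L X \<bullet> L Y))"


section \<open>The complex Gauss map\<close>

text \<open>The isotropic subspace stands for the flag consisting of itself, its normal space and its
  conjugate, so this map is at the same time the flag-valued Gauss map.\<close>

definition complex_gauss_map ::
    "('a, 'e::euclidean_space) chart set \<Rightarrow> ('a \<Rightarrow> ('a, 'e) tvec \<Rightarrow> ('a, 'e) tvec) \<Rightarrow>
     ('a \<Rightarrow> real^'n) \<Rightarrow> 'a \<Rightarrow> (complex^'n) set" where
  "complex_gauss_map A J f p =
     {\<chi> j. Complex (differential A f p X $ j) (- differential A f p (J p X) $ j) | X.
        X \<in> tangent_space A p}"

end

theory Submission
  imports Defs
begin

text \<open>
  In a chart write \<open>F\<close> for the immersion, \<open>D = dF\<close>, \<open>j\<close> for the complex structure, \<open>X\<close> for the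
  orthogonal projection onto the tangent plane and \<open>K\<close> for the complex structure of that plane,
  extended by 0 to the normal space.  The Hermitian projection onto the image of the complex Gauss
  map is \<open>\<Phi> = (X - i K) / 2\<close>, and \<open>X\<close> is its image in the real Grassmannian.

  Differentiating \<open>X (D v) = D v\<close> gives \<open>(\<partial>\<^sub>u X) (D v) = \<alpha>(u, v)\<close>, and as \<open>j\<close> is parallel,
  differentiating \<open>K (D v) = D (j v)\<close> gives \<open>(\<partial>\<^sub>u K) (D v) = \<alpha>(u, j v)\<close>.  Both are normal, so the
  Gauss map of every Kaehler immersion is horizontal (\<open>horizontal_gauss\<close>); it takes values in
  isotropic subspaces because \<open>j\<close> is orthogonal (\<open>gauss_Z1\<close>).  What has to be shown is that it is
  pluriharmonic if and only if the pluri-mean curvature is parallel.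

  The tangent space of \<open>Z\<^sub>1\<close> at \<open>P\<close> consists of the commutators \<open>[A, P]\<close> with skew-symmetric real
  \<open>A\<close> (\<open>tangent_at_Z\<close>), which are values of Killing fields of every invariant metric \<open>h\<close>
  (\<open>inf_act_Killing\<close>).  For a map \<open>\<Phi>\<close> and a Killing field \<open>Y\<close> the number \<open>h (Hess \<Phi> (u, v)) Y\<close> is
  the symmetrized covariant derivative of the one-form \<open>v \<mapsto> h (d\<Phi> v) Y\<close>, because the
  product rule involves only the symmetric part of \<open>\<nabla>Y\<close>, which is 0.  Now \<open>d\<Phi> v\<close> is horizontal,
  and the reflection in the tangent plane shows that horizontal and vertical vectors are
  \<open>h\<close>-orthogonal; so the one-form equals \<open>k\<close> times the Euclidean inner product of \<open>\<partial>\<^sub>v X\<close> and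
  \<open>[A, X]\<close> (\<open>metric_horizontal\<close>).  Whatever \<open>h\<close> does on the fibres, the Hessian therefore pairs
  with \<open>[A, \<Phi>]\<close> to \<open>k\<close> times the inner product of \<open>\<partial>\<^sub>u \<partial>\<^sub>v X - \<partial>\<^bsub>\<nabla>\<^sub>u v\<^esub> X\<close> and \<open>[A, X]\<close>
  (\<open>hessian_pairing\<close>).

  These pairings vanish for all \<open>A\<close> if and only if the symmetric matrix commutes with \<open>X\<close>, that
  is, maps tangent vectors to tangent vectors.  But the normal part of
  \<open>(\<partial>\<^sub>u \<partial>\<^sub>v X - \<partial>\<^bsub>\<nabla>\<^sub>u v\<^esub> X) (D w)\<close> is \<open>(\<nabla>\<^sub>u \<alpha>)(v, w)\<close> (\<open>nabla_\<alpha>_eq\<close>).  So \<open>\<Phi>\<close> is pluriharmonic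
  if and only if \<open>(\<nabla>\<^sub>u \<alpha>)(v, w) + (\<nabla>\<^bsub>j u\<^esub> \<alpha>)(j v, w) = 0\<close> for all \<open>u, v, w\<close>.  By the Codazzi
  equations \<open>\<nabla>\<alpha>\<close> is totally symmetric, and the left hand side is
  \<open>(\<nabla>\<^sub>w \<alpha>)(u, v) + (\<nabla>\<^sub>w \<alpha>)(j u, j v) = 2 (\<nabla>\<^sub>w \<alpha>\<^bsup>(1,1)\<^esup>)(u, v)\<close>, as \<open>j\<close> is parallel.
\<close>

section \<open>Calculus of smooth maps\<close>

lemma FD_eq: "(F has_derivative F') (at x) \<Longrightarrow> FD F x = F'"
  by (metis frechet_derivative_at)

lemma FD_works: "F differentiable (at x) \<Longrightarrow> (F has_derivative FD F x) (at x)"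
  by (simp add: frechet_derivative_works)

lemma FD_cong:
  assumes "open S" "x \<in> S" "\<And>y. y \<in> S \<Longrightarrow> F y = G y"
  shows "FD F x = FD G x"
proof -
  have "(F has_derivative D) (at x) \<longleftrightarrow> (G has_derivative D) (at x)" for D
    using has_derivative_transform_within_open[of F D x UNIV S G]
      has_derivative_transform_within_open[of G D x UNIV S F] assms by auto
  then show ?thesis unfolding frechet_derivative_def by simp
qed

lemma differentiable_cong:
  assumes "open S" "x \<in> S" "\<And>y. y \<in> S \<Longrightarrow> F y = G y" "F differentiable (at x)"
  shows "G differentiable (at x)"
  using assms(4) has_derivative_transform_within_open[of F _ x UNIV S G] assms(1-3)
  unfolding differentiable_def by auto

lemma FD_add:
  assumes "F differentiable (at x)" "G differentiable (at x)"
  shows "FD (\<lambda>y. F y + G y) x v = FD F x v + FD G x v"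
  using FD_eq[OF has_derivative_add[OF FD_works[OF assms(1)] FD_works[OF assms(2)]]] by simp

lemma FD_linear:
  assumes "bounded_linear L" "F differentiable (at x)"
  shows "FD (\<lambda>y. L (F y)) x v = L (FD F x v)"
  using FD_eq[OF bounded_linear.has_derivative[OF assms(1) FD_works[OF assms(2)]]] by simp

lemma FD_bilinear:
  assumes "bounded_bilinear mul" "F differentiable (at x)" "G differentiable (at x)"
  shows "FD (\<lambda>y. mul (F y) (G y)) x v = mul (F x) (FD G x v) + mul (FD F x v) (G x)"
  using FD_eq[OF bounded_bilinear.FDERIV[OF assms(1) FD_works[OF assms(2)] FD_works[OF assms(3)]]]
  by simp

lemma differentiable_bilinear:
  assumes "bounded_bilinear mul" "F differentiable (at x)" "G differentiable (at x)"
  shows "(\<lambda>y. mul (F y) (G y)) differentiable (at x)"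
  using bounded_bilinear.FDERIV[OF assms(1) FD_works[OF assms(2)] FD_works[OF assms(3)]]
  by (auto simp: differentiable_def)

lemma FD_chain:
  assumes "F differentiable (at x)" "G differentiable (at (F x))"
  shows "FD (G \<circ> F) x v = FD G (F x) (FD F x v)"
  using FD_eq[OF diff_chain_at[OF FD_works[OF assms(1)] FD_works[OF assms(2)]]] by simp

lemma linear_FD: "F differentiable (at x) \<Longrightarrow> linear (FD F x)"
  by (rule linear_frechet_derivative)

lemma Ck_on_cong:
  assumes "open S" "\<And>y. y \<in> S \<Longrightarrow> F y = G y" "Ck_on k S F"
  shows "Ck_on k S G"
  using assms(2,3)
proof (induction k arbitrary: F G)
  case 0
  then show ?case by (simp add: continuous_on_eq)
next
  case (Suc k)
  have "Ck_on k S (\<lambda>x. FD G x v)" for v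
    by (rule Suc.IH[of "\<lambda>x. FD F x v"])
      (use Suc.prems FD_cong[OF assms(1) _ Suc.prems(1)] in auto)
  then show ?case using Suc.prems differentiable_cong[OF assms(1) _ Suc.prems(1)] by auto
qed

lemma Ck_on_SucD: "Ck_on (Suc k) S F \<Longrightarrow> Ck_on k S F"
proof (induction k arbitrary: F)
  case 0
  then have "isCont F x" if "x \<in> S" for x
    using that differentiable_imp_continuous_within by auto
  then show ?case by (simp add: continuous_at_imp_continuous_on)
next
  case (Suc k)
  have "Ck_on k S (\<lambda>x. FD F x v)" for v
    by (rule Suc.IH) (use Suc.prems in simp)
  with Suc.prems show ?case by simp
qed

lemma Ck_on_const: "Ck_on k S (\<lambda>x. c)"
  by (induction k arbitrary: c) auto

lemma Ck_on_linear:
  assumes "bounded_linear L" "open S" "Ck_on k S F"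
  shows "Ck_on k S (\<lambda>x. L (F x))"
  using assms(3)
proof (induction k arbitrary: F)
  case 0
  then show ?case using assms(1) by (simp add: bounded_linear.continuous_on)
next
  case (Suc k)
  have d: "F differentiable (at x)" if "x \<in> S" for x using Suc.prems that by simp
  have "Ck_on k S (\<lambda>x. FD (\<lambda>y. L (F y)) x v)" for v
    by (rule Ck_on_cong[OF assms(2) _ Suc.IH[of "\<lambda>x. FD F x v"]])
      (use Suc.prems in \<open>auto simp: FD_linear[OF assms(1) d]\<close>)
  moreover have "(\<lambda>y. L (F y)) differentiable (at x)" if "x \<in> S" for x
    using bounded_linear.has_derivative[OF assms(1) FD_works[OF d[OF that]]] by (auto simp: differentiable_def)
  ultimately show ?case by simp
qed

lemma Ck_on_add:
  assumes "open S" "Ck_on k S F" "Ck_on k S G"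
  shows "Ck_on k S (\<lambda>x. F x + G x)"
  using assms(2,3)
proof (induction k arbitrary: F G)
  case 0
  then show ?case by (simp add: continuous_on_add)
next
  case (Suc k)
  have "Ck_on k S (\<lambda>x. FD (\<lambda>y. F y + G y) x v)" for v
    by (rule Ck_on_cong[OF assms(1) _ Suc.IH[of "\<lambda>x. FD F x v" "\<lambda>x. FD G x v"]])
       (use Suc.prems in \<open>auto simp: FD_add\<close>)
  then show ?case using Suc.prems by auto
qed

lemma Ck_on_bilinear:
  assumes "bounded_bilinear mul" "open S" "Ck_on k S F" "Ck_on k S G"
  shows "Ck_on k S (\<lambda>x. mul (F x) (G x))"
  using assms(3,4)
proof (induction k arbitrary: F G)
  case 0
  then show ?case using assms(1) by (simp add: bounded_bilinear.continuous_on)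
next
  case (Suc k)
  have "Ck_on k S (\<lambda>x. mul (F x) (FD G x v) + mul (FD F x v) (G x))" for v
    using Suc.prems Ck_on_SucD[OF Suc.prems(1)] Ck_on_SucD[OF Suc.prems(2)]
    by (intro Ck_on_add[OF assms(2)] Suc.IH) auto
  then have "Ck_on k S (\<lambda>x. FD (\<lambda>y. mul (F y) (G y)) x v)" for v
    by (rule Ck_on_cong[OF assms(2), rotated]) (use Suc.prems in \<open>auto simp: FD_bilinear[OF assms(1)]\<close>)
  then show ?case using Suc.prems by (auto intro: differentiable_bilinear[OF assms(1)])
qed

text \<open>The derivative of \<open>1/F\<close> is a polynomial in \<open>1/F\<close> and the derivative of \<open>F\<close>, so each
  degree of smoothness of \<open>1/F\<close> gives the next one.\<close>

lemma Ck_on_inverse: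
  fixes F :: "'u::real_normed_vector \<Rightarrow> real"
  assumes "open S" "\<And>x. x \<in> S \<Longrightarrow> F x \<noteq> 0" "Ck_on k S F"
  shows "Ck_on k S (\<lambda>x. inverse (F x))"
  using assms(3)
proof (induction k)
  case 0
  then show ?case using assms(2) by (auto intro!: continuous_on_inverse)
next
  case (Suc k)
  have IH: "Ck_on k S (\<lambda>x. inverse (F x))"
    using Suc Ck_on_SucD by blast
  have der: "((\<lambda>y. inverse (F y)) has_derivative (\<lambda>v. - (inverse (F x) * FD F x v * inverse (F x)))) (at x)"
    if "x \<in> S" for x
    using Suc.prems that assms(2) by (intro Deriv.has_derivative_inverse[OF _ FD_works]) auto
  have *: "Ck_on k S (\<lambda>x. - (inverse (F x) * FD F x v * inverse (F x)))" for v
    using Suc.prems IH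
    by (intro Ck_on_linear[OF bounded_linear_minus[OF bounded_linear_ident] assms(1)] Ck_on_bilinear[OF bounded_bilinear_mult assms(1)]) auto
  have "Ck_on k S (\<lambda>x. FD (\<lambda>y. inverse (F y)) x v)" for v
    by (rule Ck_on_cong[OF assms(1) _ *[of v]]) (simp add: FD_eq[OF der])
  then show ?case using der by (auto simp: differentiable_def)
qed

lemma smooth_on_differentiable: "smooth_on S F \<Longrightarrow> x \<in> S \<Longrightarrow> F differentiable (at x)"
  unfolding smooth_on_def by (drule spec[of _ "Suc 0"]) simp

lemma smooth_on_FD: "smooth_on S F \<Longrightarrow> smooth_on S (\<lambda>x. FD F x v)"
  unfolding smooth_on_def 
proof
  fix k assume "\<forall>k. Ck_on k S F"
  then have "Ck_on (Suc k) S F" ..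
  then show "Ck_on k S (\<lambda>x. FD F x v)" by simp
qed

lemma smooth_on_continuous: "smooth_on S F \<Longrightarrow> continuous_on S F"
  unfolding smooth_on_def by (drule spec[of _ 0]) simp

lemma smooth_on_cong:
  assumes "open S" "\<And>y. y \<in> S \<Longrightarrow> F y = G y" "smooth_on S F"
  shows "smooth_on S G"
  using Ck_on_cong[OF assms(1,2)] assms(3) by (auto simp: smooth_on_def)

lemma smooth_on_subset: 
  assumes "smooth_on S F" "T \<subseteq> S"
  shows "smooth_on T F"
proof -
  have "Ck_on k S F \<Longrightarrow> Ck_on k T F" for k
    using assms(2) by (induction k arbitrary: F) (auto intro: continuous_on_subset)
  then show ?thesis using assms(1) by (auto simp: smooth_on_def)
qed

lemma smooth_on_const: "smooth_on S (\<lambda>x. c)"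
  by (simp add: smooth_on_def Ck_on_const)

lemma smooth_on_linear: "bounded_linear L \<Longrightarrow> open S \<Longrightarrow> smooth_on S F \<Longrightarrow> smooth_on S (\<lambda>x. L (F x))"
  by (simp add: smooth_on_def Ck_on_linear)

lemma smooth_on_id: "open S \<Longrightarrow> smooth_on S (\<lambda>x. x)"
  unfolding smooth_on_def 
proof
  fix k show "Ck_on k S (\<lambda>x. x)" by (cases k) (auto simp: Ck_on_const)
qed

lemma smooth_on_add: "open S \<Longrightarrow> smooth_on S F \<Longrightarrow> smooth_on S G \<Longrightarrow> smooth_on S (\<lambda>x. F x + G x)"
  by (simp add: smooth_on_def Ck_on_add)

lemma smooth_on_minus: "open S \<Longrightarrow> smooth_on S F \<Longrightarrow> smooth_on S (\<lambda>x. - F x)"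
  by (rule smooth_on_linear[OF bounded_linear_minus[OF bounded_linear_ident]])

lemma smooth_on_diff: "open S \<Longrightarrow> smooth_on S F \<Longrightarrow> smooth_on S G \<Longrightarrow> smooth_on S (\<lambda>x. F x - G x)"
  using smooth_on_add[of S F "\<lambda>x. - G x"] by (simp add: smooth_on_minus)

lemma smooth_on_bilinear:
  "bounded_bilinear mul \<Longrightarrow> open S \<Longrightarrow> smooth_on S F \<Longrightarrow> smooth_on S G \<Longrightarrow> smooth_on S (\<lambda>x. mul (F x) (G x))"
  by (simp add: smooth_on_def Ck_on_bilinear)

lemma smooth_on_inverse:
  fixes F :: "'u::real_normed_vector \<Rightarrow> real"
  shows "open S \<Longrightarrow> (\<And>x. x \<in> S \<Longrightarrow> F x \<noteq> 0) \<Longrightarrow> smooth_on S F \<Longrightarrow> smooth_on S (\<lambda>x. inverse (F x))"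
  by (simp add: smooth_on_def Ck_on_inverse)

lemma smooth_on_sum:
  assumes "open S" "\<And>b. b \<in> B \<Longrightarrow> smooth_on S (F b)"
  shows "smooth_on S (\<lambda>x. \<Sum>b\<in>B. F b x)"
  using assms(2)
  by (induction B rule: infinite_finite_induct) (auto simp: smooth_on_const intro!: smooth_on_add[OF assms(1)])

lemmas smooth_on_scaleR = smooth_on_bilinear[OF bounded_bilinear_scaleR]
lemmas smooth_on_inner = smooth_on_bilinear[OF bounded_bilinear_inner]
lemmas smooth_on_mult = smooth_on_bilinear[OF bounded_bilinear_mult]

lemma bounded_linear_axis: "bounded_linear (axis i :: 'b::euclidean_space \<Rightarrow> 'b^'n)"
  unfolding linear_conv_bounded_linear[symmetric]
  by (rule linearI) (auto simp: vec_eq_iff axis_def)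

lemma vec_eq_sum_axis: "(\<chi> i. f i) = (\<Sum>i\<in>UNIV. axis i (f i :: 'b::euclidean_space) :: 'b^'n)"
  by (simp add: vec_eq_iff axis_def sum.delta)

lemma smooth_on_vec:
  fixes f :: "'u::real_normed_vector \<Rightarrow> 'n::finite \<Rightarrow> 'b::euclidean_space"
  assumes "open S" "\<And>i. smooth_on S (\<lambda>x. f x i)"
  shows "smooth_on S (\<lambda>x. (\<chi> i. f x i) :: 'b^'n)"
  unfolding vec_eq_sum_axis
  by (intro smooth_on_sum smooth_on_linear[OF bounded_linear_axis] assms)

text \<open>A family of linear maps applied to a moving argument obeys the product rule, and only the
  partial maps for constant arguments have to be known to be smooth.\<close>

lemma linear_basis_expand:
  fixes L :: "'v::euclidean_space \<Rightarrow> 'w::real_vector"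
  assumes "linear L" 
  shows "L w = (\<Sum>b\<in>Basis. (w \<bullet> b) *\<^sub>R L b)"
  by (metis (no_types, lifting) assms euclidean_representation linear_scale linear_sum sum.cong)

lemma smooth_on_linear_family:
  fixes L :: "'u::real_normed_vector \<Rightarrow> 'v::euclidean_space \<Rightarrow> 'w::real_normed_vector"
  assumes "open S" "\<And>x. x \<in> S \<Longrightarrow> linear (L x)" "\<And>b. smooth_on S (\<lambda>x. L x b)" "smooth_on S w"
  shows "smooth_on S (\<lambda>x. L x (w x))"
proof (rule smooth_on_cong[OF assms(1)])
  show "(\<Sum>b\<in>Basis. (w x \<bullet> b) *\<^sub>R L x b) = L x (w x)" if "x \<in> S" for x
    using linear_basis_expand[OF assms(2)[OF that]] by metis
  show "smooth_on S (\<lambda>x. \<Sum>b\<in>Basis. (w x \<bullet> b) *\<^sub>R L x b)"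
    by (intro smooth_on_sum smooth_on_scaleR smooth_on_inner smooth_on_const assms)
qed

lemma has_derivative_linear_family:
  fixes L :: "'u::real_normed_vector \<Rightarrow> 'v::euclidean_space \<Rightarrow> 'w::real_normed_vector"
  assumes S: "open S" "x \<in> S" and lin: "\<And>x. x \<in> S \<Longrightarrow> linear (L x)"
    and L: "\<And>b. (\<lambda>x. L x b) differentiable (at x)" and w: "w differentiable (at x)"
  shows "((\<lambda>x. L x (w x)) has_derivative (\<lambda>u. FD (\<lambda>y. L y (w x)) x u + L x (FD w x u))) (at x)"
proof (rule has_derivative_transform_within_open[OF _ S])
  show "(\<Sum>b\<in>Basis. (w y \<bullet> b) *\<^sub>R L y b) = L y (w y)" if "y \<in> S" for y
    using linear_basis_expand[OF lin[OF that]] by metis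
  have 1: "FD (\<lambda>y. L y z) x u = (\<Sum>b\<in>Basis. (z \<bullet> b) *\<^sub>R FD (\<lambda>y. L y b) x u)" for z u
  proof -
    have "((\<lambda>y. \<Sum>b\<in>Basis. (z \<bullet> b) *\<^sub>R L y b) has_derivative (\<lambda>u. \<Sum>b\<in>Basis. (z \<bullet> b) *\<^sub>R FD (\<lambda>y. L y b) x u)) (at x)"
      by (rule has_derivative_sum, rule has_derivative_scaleR_right, rule FD_works, rule L)
    then have "((\<lambda>y. L y z) has_derivative (\<lambda>u. \<Sum>b\<in>Basis. (z \<bullet> b) *\<^sub>R FD (\<lambda>y. L y b) x u)) (at x)"
      by (rule has_derivative_transform_within_open[OF _ S])
         (use linear_basis_expand[OF lin] in metis)
    then show ?thesis by (simp add: FD_eq)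
  qed
  have "((\<lambda>y. \<Sum>b\<in>Basis. (w y \<bullet> b) *\<^sub>R L y b) has_derivative 
      (\<lambda>u. \<Sum>b\<in>Basis. (w x \<bullet> b) *\<^sub>R FD (\<lambda>y. L y b) x u + (FD w x u \<bullet> b) *\<^sub>R L x b)) (at x)"
    by (rule has_derivative_sum, rule has_derivative_scaleR[OF has_derivative_inner_left[OF FD_works[OF w]] FD_works[OF L]])
  then show "((\<lambda>y. \<Sum>b\<in>Basis. (w y \<bullet> b) *\<^sub>R L y b) has_derivative 
     (\<lambda>u. FD (\<lambda>y. L y (w x)) x u + L x (FD w x u))) (at x)"
    by (simp add: 1[of "w x"] linear_basis_expand[OF lin[OF S(2)], of "FD w x _"] sum.distrib)
qed

lemma FD_linear_family:
  fixes L :: "'u::real_normed_vector \<Rightarrow> 'v::euclidean_space \<Rightarrow> 'w::real_normed_vector"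
  assumes "open S" "x \<in> S" "\<And>x. x \<in> S \<Longrightarrow> linear (L x)"
    "\<And>b. (\<lambda>x. L x b) differentiable (at x)" "w differentiable (at x)"
  shows "FD (\<lambda>x. L x (w x)) x u = FD (\<lambda>y. L y (w x)) x u + L x (FD w x u)"
  using FD_eq[OF has_derivative_linear_family[OF assms]] by simp

text \<open>Symmetry of second derivatives: both mixed second derivatives are limits of the same second
  difference quotient, by two applications of the mean value theorem.\<close>

lemma second_difference:
  fixes F :: "'u::real_normed_vector \<Rightarrow> real"
  assumes S: "open S" "x \<in> S" and sm: "smooth_on S F"
    and box: "\<And>a b. 0 \<le> a \<Longrightarrow> a \<le> s \<Longrightarrow> 0 \<le> b \<Longrightarrow> b \<le> s \<Longrightarrow> x + a *\<^sub>R u + b *\<^sub>R v \<in> S"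
    and "s > 0"
  shows "\<exists>a b. 0 < a \<and> a < s \<and> 0 < b \<and> b < s \<and>
    F (x + s *\<^sub>R u + s *\<^sub>R v) - F (x + s *\<^sub>R u) - F (x + s *\<^sub>R v) + F x
      = s * (s * FD2 F (x + a *\<^sub>R u + b *\<^sub>R v) v u)"
proof -
  define \<phi> where "\<phi> a = F (x + a *\<^sub>R u + s *\<^sub>R v) - F (x + a *\<^sub>R u)" for a
  have derF: "((\<lambda>a. F (x + a *\<^sub>R u + b *\<^sub>R v)) has_real_derivative FD F (x + a *\<^sub>R u + b *\<^sub>R v) u) (at a)"
    if "x + a *\<^sub>R u + b *\<^sub>R v \<in> S" for a b
  proof -
    have d: "F differentiable (at (x + a *\<^sub>R u + b *\<^sub>R v))" 
      using smooth_on_differentiable[OF sm that] .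
    have "((\<lambda>a. x + a *\<^sub>R u + b *\<^sub>R v) has_derivative (\<lambda>t. t *\<^sub>R u)) (at a)"
      by (auto intro!: derivative_eq_intros)
    from has_derivative_compose[OF this FD_works[OF d]]
    show ?thesis unfolding has_field_derivative_def
      by (simp add: linear_scale[OF linear_FD[OF d]] mult.commute[of _ "FD _ _ _"])
  qed
  have "\<exists>a>0. a < s \<and> \<phi> s - \<phi> 0 = (s - 0) * (FD F (x + a *\<^sub>R u + s *\<^sub>R v) u - FD F (x + a *\<^sub>R u) u)"
  proof (rule MVT2[OF \<open>s > 0\<close>])
    fix a assume "0 \<le> a" "a \<le> s"
    then show "(\<phi> has_real_derivative FD F (x + a *\<^sub>R u + s *\<^sub>R v) u - FD F (x + a *\<^sub>R u) u) (at a)"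
      unfolding \<phi>_def using derF[OF box[of a s]] derF[OF box[of a 0]] \<open>s > 0\<close>
      by (intro DERIV_diff) auto
  qed
  then obtain a where a: "a > 0" "a < s" and 1: "\<phi> s - \<phi> 0 = s * (FD F (x + a *\<^sub>R u + s *\<^sub>R v) u - FD F (x + a *\<^sub>R u) u)"
    by auto
  have "\<exists>b>0. b < s \<and> FD F (x + a *\<^sub>R u + s *\<^sub>R v) u - FD F (x + a *\<^sub>R u + 0 *\<^sub>R v) u = (s - 0) * FD2 F (x + a *\<^sub>R u + b *\<^sub>R v) v u"
  proof (rule MVT2[OF \<open>s > 0\<close>, of "\<lambda>b. FD F (x + a *\<^sub>R u + b *\<^sub>R v) u" "\<lambda>b. FD2 F (x + a *\<^sub>R u + b *\<^sub>R v) v u"])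
    fix b assume "0 \<le> b" "b \<le> s"
    then have "x + a *\<^sub>R u + b *\<^sub>R v \<in> S" using a box by simp
    then have d: "(\<lambda>y. FD F y u) differentiable (at (x + a *\<^sub>R u + b *\<^sub>R v))"
      using smooth_on_differentiable[OF smooth_on_FD[OF sm]] by blast
    have "((\<lambda>b. x + a *\<^sub>R u + b *\<^sub>R v) has_derivative (\<lambda>t. t *\<^sub>R v)) (at b)"
      by (auto intro!: derivative_eq_intros)
    from has_derivative_compose[OF this FD_works[OF d]]
    show "((\<lambda>b. FD F (x + a *\<^sub>R u + b *\<^sub>R v) u) has_real_derivative FD2 F (x + a *\<^sub>R u + b *\<^sub>R v) v u) (at b)"
      unfolding has_field_derivative_def FD2_def
      by (simp add: linear_scale[OF linear_FD[OF d]] mult.commute[of _ "FD _ _ _"])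
  qed
  then obtain b where "b > 0" "b < s"
    "FD F (x + a *\<^sub>R u + s *\<^sub>R v) u - FD F (x + a *\<^sub>R u) u = s * FD2 F (x + a *\<^sub>R u + b *\<^sub>R v) v u"
    by auto
  with a 1 show ?thesis unfolding \<phi>_def by (intro exI[of _ a] exI[of _ b]) (auto simp: algebra_simps)
qed

lemma FD2_commute_real:
  fixes F :: "'u::real_normed_vector \<Rightarrow> real"
  assumes S: "open S" "x \<in> S" and sm: "smooth_on S F"
  shows "FD2 F x u v = FD2 F x v u"
proof (rule ccontr)
  assume ne: "FD2 F x u v \<noteq> FD2 F x v u"
  \<comment> \<open>half the supposed gap: within this distance of its value at \<open>x\<close> neither second derivative
    can meet the other\<close>
  define e where "e = \<bar>FD2 F x u v - FD2 F x v u\<bar> / 2"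
  have e: "e > 0" using ne by (simp add: e_def)
  have cont: "isCont (\<lambda>y. FD2 F y u v) x" for u v
    using smooth_on_continuous[OF smooth_on_FD[OF smooth_on_FD[OF sm, of v], of u]] S
    by (simp add: FD2_def continuous_on_eq_continuous_at)
  obtain d1 where d1: "d1 > 0" "\<And>y. dist y x < d1 \<Longrightarrow> dist (FD2 F y u v) (FD2 F x u v) < e"
    using cont[of u v] e unfolding continuous_at_eps_delta by (auto simp: dist_norm)
  obtain d2 where d2: "d2 > 0" "\<And>y. dist y x < d2 \<Longrightarrow> dist (FD2 F y v u) (FD2 F x v u) < e"
    using cont[of v u] e unfolding continuous_at_eps_delta by (auto simp: dist_norm)
  obtain d3 where d3: "d3 > 0" "ball x d3 \<subseteq> S" using S open_contains_ball by blast
  define d where "d = min d1 (min d2 d3)"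
  define s where "s = d / (2 * (norm u + norm v + 1))"
  have dpos: "d > 0" using d1 d2 d3 by (simp add: d_def)
  have den: "norm u + norm v + 1 > 0" by (smt (verit) norm_ge_zero)
  have s: "s > 0" using dpos den by (simp add: s_def)
  have near: "dist (x + a *\<^sub>R u + b *\<^sub>R v) x < d" if "0 \<le> a" "a \<le> s" "0 \<le> b" "b \<le> s" for a b
  proof -
    have "norm (a *\<^sub>R u + b *\<^sub>R v) \<le> a * norm u + b * norm v"
      using that norm_triangle_ineq[of "a *\<^sub>R u" "b *\<^sub>R v"] by simp
    also have "\<dots> \<le> s * norm u + s * norm v"
      using that by (intro add_mono mult_right_mono) auto
    also have "\<dots> < s * (2 * (norm u + norm v + 1))"
      using s by (simp add: algebra_simps) (smt (verit) norm_ge_zero mult_nonneg_nonneg)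
    also have "\<dots> = d" using den by (simp add: s_def)
    finally show ?thesis by (simp add: dist_norm add.assoc)
  qed
  have box: "x + a *\<^sub>R u + b *\<^sub>R v \<in> S" if "0 \<le> a" "a \<le> s" "0 \<le> b" "b \<le> s" for a b
    using near[OF that] d3 by (auto simp: d_def dist_commute subset_iff)
  have box': "x + a *\<^sub>R v + b *\<^sub>R u \<in> S" if "0 \<le> a" "a \<le> s" "0 \<le> b" "b \<le> s" for a b
    using box[of b a] that by (simp add: add.assoc add.commute[of "a *\<^sub>R v"])
  obtain a b where ab: "0 < a" "a < s" "0 < b" "b < s" and
    1: "F (x + s *\<^sub>R u + s *\<^sub>R v) - F (x + s *\<^sub>R u) - F (x + s *\<^sub>R v) + F x
      = s * (s * FD2 F (x + a *\<^sub>R u + b *\<^sub>R v) v u)"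
    using second_difference[OF S sm box s] by blast
  obtain a' b' where ab': "0 < a'" "a' < s" "0 < b'" "b' < s" and
    2: "F (x + s *\<^sub>R v + s *\<^sub>R u) - F (x + s *\<^sub>R v) - F (x + s *\<^sub>R u) + F x
      = s * (s * FD2 F (x + a' *\<^sub>R v + b' *\<^sub>R u) u v)"
    using second_difference[OF S sm box' s] by blast
  have "s * (s * FD2 F (x + a *\<^sub>R u + b *\<^sub>R v) v u) = s * (s * FD2 F (x + a' *\<^sub>R v + b' *\<^sub>R u) u v)"
    unfolding 1[symmetric] 2[symmetric] by (simp add: add.assoc add.commute[of "s *\<^sub>R v"])
  then have eq: "FD2 F (x + a *\<^sub>R u + b *\<^sub>R v) v u = FD2 F (x + b' *\<^sub>R u + a' *\<^sub>R v) u v"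
    using s by (simp add: add.assoc add.commute[of "a' *\<^sub>R v"])
  have "dist (FD2 F (x + a *\<^sub>R u + b *\<^sub>R v) v u) (FD2 F x v u) < e"
    using near[of a b] ab d2 by (simp add: d_def)
  moreover have "dist (FD2 F (x + b' *\<^sub>R u + a' *\<^sub>R v) u v) (FD2 F x u v) < e"
    using near[of b' a'] ab' d1 by (simp add: d_def)
  ultimately show False unfolding eq e_def dist_real_def by (auto simp: abs_if split: if_splits)
qed

lemma FD2_commute:
  fixes F :: "'u::real_normed_vector \<Rightarrow> 'v::euclidean_space"
  assumes S: "open S" "x \<in> S" and sm: "smooth_on S F"
  shows "FD2 F x u v = FD2 F x v u"
proof (rule euclidean_eqI)
  fix b :: 'v
  have bl: "bounded_linear (\<lambda>z. z \<bullet> b)" by (rule bounded_linear_inner_left)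
  have "FD2 (\<lambda>y. F y \<bullet> b) x u v = FD2 F x u v \<bullet> b" for u v
  proof -
    have "FD2 (\<lambda>y. F y \<bullet> b) x u v = FD (\<lambda>y. FD F y v \<bullet> b) x u"
      unfolding FD2_def using FD_linear[OF bl smooth_on_differentiable[OF sm]]
      by (intro FD_cong[OF S, THEN fun_cong]) simp
    also have "\<dots> = FD2 F x u v \<bullet> b" unfolding FD2_def
      using FD_linear[OF bl smooth_on_differentiable[OF smooth_on_FD[OF sm] S(2)]] by simp
    finally show ?thesis .
  qed
  then show "FD2 F x u v \<bullet> b = FD2 F x v u \<bullet> b"
    using FD2_commute_real[OF S smooth_on_linear[OF bl S(1) sm]] by metis
qed

lemma linear_FD2:
  assumes "open S" "x \<in> S" "smooth_on S F"
  shows "linear (\<lambda>u. FD2 F x u v)"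
  unfolding FD2_def using linear_FD[OF smooth_on_differentiable[OF smooth_on_FD[OF assms(3)] assms(2)]] by simp

text \<open>The Gram-Schmidt process solves a positive definite linear system by field operations
  alone, so that its solution depends smoothly on parameters.  It serves as Riesz representation
  theorem, and as a smooth inverse of families of linear maps.\<close>

lemma smooth_riesz:
  fixes G :: "'u::real_normed_vector \<Rightarrow> 'v::euclidean_space \<Rightarrow> 'v \<Rightarrow> real"
  assumes S: "open S" and bil: "\<And>x. x \<in> S \<Longrightarrow> bilinear (G x)"
    and sym: "\<And>x u v. x \<in> S \<Longrightarrow> G x u v = G x v u"
    and pos: "\<And>x u. x \<in> S \<Longrightarrow> u \<noteq> 0 \<Longrightarrow> G x u u > 0"
    and smG: "\<And>u v. smooth_on S (\<lambda>x. G x u v)"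
    and B: "finite B" "independent B"
    and l: "\<And>b. b \<in> B \<Longrightarrow> smooth_on S (\<lambda>x. l x b)"
  shows "\<exists>R. smooth_on S R \<and> (\<forall>x\<in>S. R x \<in> span B \<and> (\<forall>b\<in>B. G x (R x) b = l x b))"
  using B l
proof (induction B arbitrary: l rule: finite_induct)
  case empty
  then show ?case by (intro exI[of _ "\<lambda>x. 0"]) (simp add: smooth_on_const)
next
  case (insert b B)
  have lin1: "linear (\<lambda>v. G x v z)" and lin2: "linear (G x v)" if "x \<in> S" for x v z
    using bil[OF that] by (auto simp: bilinear_def)
  have iB: "independent B" "b \<notin> span B" using insert by (auto simp: independent_insert split: if_splits)
  have "\<exists>R. smooth_on S R \<and> (\<forall>x\<in>S. R x \<in> span B \<and> (\<forall>b'\<in>B. G x (R x) b' = G x b b'))"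
    by (rule insert.IH[OF iB(1)]) (rule smG)
  then obtain E where E: "smooth_on S E" "\<And>x. x \<in> S \<Longrightarrow> E x \<in> span B"
      "\<And>x b'. x \<in> S \<Longrightarrow> b' \<in> B \<Longrightarrow> G x (E x) b' = G x b b'"
    by blast
  have "\<exists>R. smooth_on S R \<and> (\<forall>x\<in>S. R x \<in> span B \<and> (\<forall>b'\<in>B. G x (R x) b' = l x b'))"
    by (rule insert.IH[OF iB(1)]) (simp add: insert.prems(2))
  then obtain R where R: "smooth_on S R" "\<And>x. x \<in> S \<Longrightarrow> R x \<in> span B"
      "\<And>x b'. x \<in> S \<Longrightarrow> b' \<in> B \<Longrightarrow> G x (R x) b' = l x b'"
    by blast
  \<comment> \<open>the part of \<open>b\<close> that is \<open>G x\<close>-orthogonal to the vectors already treated\<close>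
  define e where "e x = b - E x" for x
  have e0: "e x \<noteq> 0" if "x \<in> S" for x using E(2)[OF that] iB(2) by (auto simp: e_def)
  have sme: "smooth_on S e" unfolding e_def by (intro smooth_on_diff S smooth_on_const E)
  have smGw: "smooth_on S (\<lambda>x. G x (v x) (w x))" if "smooth_on S v" "smooth_on S w" for v w
  proof -
    have "smooth_on S (\<lambda>x. G x (v x) z)" for z
      using smooth_on_linear_family[OF S lin1 smG that(1)] by simp
    from smooth_on_linear_family[OF S lin2 this that(2)] show ?thesis by simp
  qed
  have orth: "G x (e x) b' = 0" if "x \<in> S" "b' \<in> B" for x b'
    using E(3)[OF that] linear_diff[OF lin1[OF that(1)]] by (simp add: e_def)
  have orthE: "G x (e x) z = 0" if "x \<in> S" "z \<in> span B" for x z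
    using linear_eq_0_on_span[OF lin2[OF that(1)] orth[OF that(1)] that(2)] by simp
  have eb: "G x (e x) b = G x (e x) (e x)" if "x \<in> S" for x
    using orthE[OF that E(2)[OF that]] linear_diff[OF lin2[OF that]] by (simp add: e_def)
  define c where "c x = (l x b - G x (R x) b) * inverse (G x (e x) (e x))" for x
  have "G x (e x) (e x) \<noteq> 0" if "x \<in> S" for x
    using pos[OF that e0[OF that]] by simp
  then have "smooth_on S (\<lambda>x. inverse (G x (e x) (e x)))"
    by (intro smooth_on_inverse S smGw sme)
  moreover have "smooth_on S (\<lambda>x. l x b - G x (R x) b)"
    by (intro smooth_on_diff S smGw R smooth_on_const insert.prems(2)) simp
  ultimately have "smooth_on S c" unfolding c_def
    by (intro smooth_on_mult S)
  then have "smooth_on S (\<lambda>x. R x + c x *\<^sub>R e x)"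
    by (intro smooth_on_add S R smooth_on_scaleR sme)
  moreover have "R x + c x *\<^sub>R e x \<in> span (insert b B)" if "x \<in> S" for x
    using R(2)[OF that] E(2)[OF that] span_mono[of B "insert b B"] unfolding e_def
    by (intro span_add span_scale span_diff) (auto intro: span_base)
  moreover have "G x (R x + c x *\<^sub>R e x) b' = l x b'" if "x \<in> S" "b' \<in> insert b B" for x b'
    using that pos[OF that(1) e0[OF that(1)]]
    by (auto simp: linear_add[OF lin1[OF that(1)]] linear_scale[OF lin1[OF that(1)]] R orth eb c_def field_simps)
  ultimately show ?case by blast
qed

text \<open>The special case of constant parameters, with the uniqueness of the representing vector.\<close>

lemma riesz_on_subspace:
  fixes G :: "'v::euclidean_space \<Rightarrow> 'v \<Rightarrow> real"
  assumes bil: "bilinear G" and sym: "\<And>u v. G u v = G v u" and pos: "\<And>u. u \<noteq> 0 \<Longrightarrow> G u u > 0"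
    and T: "subspace T" and l: "linear l"
  shows "\<exists>!W. W \<in> T \<and> (\<forall>Y\<in>T. G W Y = l Y)"
proof -
  obtain B where B: "B \<subseteq> T" "independent B" "span B = T" 
    using T by (metis basis_exists span_minimal subset_antisym)
  have "finite B" using B(2) by (simp add: independent_imp_finite)
  have "\<exists>R. smooth_on (UNIV :: real set) R \<and> (\<forall>x\<in>UNIV. R x \<in> span B \<and> (\<forall>b\<in>B. G (R x) b = l b))"
    using smooth_riesz[where S = "UNIV :: real set" and G = "\<lambda>_. G" and l = "\<lambda>_. l", OF open_UNIV bil sym pos
        smooth_on_const \<open>finite B\<close> B(2) smooth_on_const] by blast
  then obtain R :: "real \<Rightarrow> 'v" where R: "R 0 \<in> span B" "\<And>b. b \<in> B \<Longrightarrow> G (R 0) b = l b"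
    by blast
  have lin1: "linear (\<lambda>v. G v z)" and lin2: "linear (G v)" for v z
    using bil by (auto simp: bilinear_def)
  have eq: "G (R 0) Y = l Y" if "Y \<in> T" for Y
    using linear_eq_on_span[OF lin2 l R(2), of B Y] that B(3) by simp
  show ?thesis
  proof (rule ex1I[of _ "R 0"])
    fix W assume W: "W \<in> T \<and> (\<forall>Y\<in>T. G W Y = l Y)"
    have "W - R 0 \<in> T" using W R(1) B(3) T by (simp add: subspace_diff)
    then have "G (W - R 0) (W - R 0) = 0"
      using W eq linear_diff[OF lin1, of W "R 0"] by simp
    then show "W = R 0" using pos[of "W - R 0"] by force
  next
    show "R 0 \<in> T \<and> (\<forall>Y\<in>T. G (R 0) Y = l Y)"
      using eq R(1) B(3) by simp
  qed
qed

section \<open>Real matrices\<close>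

lemma bounded_bilinear_matrix_mult: "bounded_bilinear ((**) :: real^'n^'m \<Rightarrow> real^'k^'n \<Rightarrow> real^'k^'m)"
  unfolding bilinear_conv_bounded_bilinear[symmetric] bilinear_def
  by (auto intro!: linearI simp: matrix_matrix_mult_def vec_eq_iff algebra_simps sum.distrib sum_distrib_left)

lemma bounded_bilinear_matrix_vector_mult: "bounded_bilinear ((*v) :: real^'n^'m \<Rightarrow> real^'n \<Rightarrow> real^'m)"
  unfolding bilinear_conv_bounded_bilinear[symmetric] bilinear_def
  by (auto intro!: linearI simp: matrix_vector_mult_def vec_eq_iff algebra_simps sum.distrib sum_distrib_left)

interpretation mm: bounded_bilinear "(**) :: real^'n^'n \<Rightarrow> real^'n^'n \<Rightarrow> real^'n^'n"
  by (rule bounded_bilinear_matrix_mult)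

interpretation mv: bounded_bilinear "(*v) :: real^'n^'n \<Rightarrow> real^'n \<Rightarrow> real^'n"
  by (rule bounded_bilinear_matrix_vector_mult)

text \<open>Numerals multiply matrices entrywise, that is, by scalar multiplication; the simplifier
  introduces them when it collects terms.\<close>

lemma numeral_mult_matrix:
  "numeral w * A = (numeral w :: real) *\<^sub>R A" "A * numeral w = (numeral w :: real) *\<^sub>R A" for A :: "real^'n^'m"
proof -
  have "(numeral w :: real^'n^'m) $ i $ j = numeral w" for i j by (metis numeral_index)
  then show "numeral w * A = (numeral w :: real) *\<^sub>R A" "A * numeral w = (numeral w :: real) *\<^sub>R A"
    by (simp_all add: vec_eq_iff times_vec_def)
qed

lemmas mat_distrib = numeral_mult_matrix mm.add_left mm.add_right mm.diff_left mm.diff_right mm.minus_left mm.minus_right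
  mm.scaleR_left mm.scaleR_right mm.zero_left mm.zero_right

lemma mult_assocL: "A ** B ** C = A ** (B ** (C :: real^'n^'n))"
  by (simp add: matrix_mul_assoc)

lemma transpose_add: "transpose (A + B) = transpose A + transpose B"
  and transpose_diff: "transpose (A - B) = transpose A - transpose B"
  and transpose_minus: "transpose (- A) = - transpose A"
  for A B :: "'a::ab_group_add^'n^'m"
  by (simp_all add: transpose_def vec_eq_iff)

lemmas transpose_simps = transpose_add transpose_diff transpose_minus transpose_scalar matrix_transpose_mul

lemma bounded_linear_transpose: "bounded_linear (transpose :: real^'n^'n \<Rightarrow> real^'n^'n)"
  unfolding linear_conv_bounded_linear[symmetric]
  by (rule linearI) (simp_all add: transpose_add transpose_scalar)

lemma inner_matrix_mult_left: "(A ** B) \<bullet> C = B \<bullet> (transpose A ** C)" for A B C :: "real^'n^'n"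
proof -
  have "(A ** B) \<bullet> C = (\<Sum>i\<in>UNIV. \<Sum>j\<in>UNIV. \<Sum>k\<in>UNIV. A$i$k * B$k$j * C$i$j)"
    by (simp add: inner_vec_def matrix_matrix_mult_def sum_distrib_right)
  also have "\<dots> = (\<Sum>i\<in>UNIV. \<Sum>k\<in>UNIV. \<Sum>j\<in>UNIV. A$i$k * B$k$j * C$i$j)"
    by (rule sum.cong[OF refl], rule sum.swap)
  also have "\<dots> = (\<Sum>k\<in>UNIV. \<Sum>i\<in>UNIV. \<Sum>j\<in>UNIV. A$i$k * B$k$j * C$i$j)"
    by (rule sum.swap)
  also have "\<dots> = (\<Sum>k\<in>UNIV. \<Sum>j\<in>UNIV. \<Sum>i\<in>UNIV. A$i$k * B$k$j * C$i$j)"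
    by (rule sum.cong[OF refl], rule sum.swap)
  also have "\<dots> = B \<bullet> (transpose A ** C)"
    by (simp add: inner_vec_def matrix_matrix_mult_def transpose_def sum_distrib_left mult_ac)
  finally show ?thesis .
qed

lemma inner_transpose: "transpose A \<bullet> transpose B = A \<bullet> B" for A B :: "real^'n^'n"
  unfolding inner_vec_def transpose_def by (simp, rule sum.swap)

lemma inner_matrix_mult_right: "(A ** B) \<bullet> C = A \<bullet> (C ** transpose B)" for A B C :: "real^'n^'n"
proof -
  have "(A ** B) \<bullet> C = (transpose B ** transpose A) \<bullet> transpose C"
    by (metis inner_transpose matrix_transpose_mul)
  also have "\<dots> = transpose A \<bullet> (B ** transpose C)" by (simp add: inner_matrix_mult_left)
  also have "\<dots> = A \<bullet> (C ** transpose B)"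
    by (metis inner_transpose matrix_transpose_mul transpose_transpose)
  finally show ?thesis .
qed

definition bracket :: "real^'n^'n \<Rightarrow> real^'n^'n \<Rightarrow> real^'n^'n" where
  "bracket A X = A ** X - X ** A"

definition skew :: "real^'n^'n \<Rightarrow> bool" where
  "skew A \<longleftrightarrow> transpose A = - A"

lemma bracket_linear_right:
  "bracket A (X + Y) = bracket A X + bracket A Y" "bracket A (r *\<^sub>R X) = r *\<^sub>R bracket A X"
  by (simp_all add: bracket_def mat_distrib algebra_simps)

lemma bracket_linear_left:
  "bracket (A + B) X = bracket A X + bracket B X" "bracket (r *\<^sub>R A) X = r *\<^sub>R bracket A X"
  by (simp_all add: bracket_def mat_distrib algebra_simps)

lemma transpose_vector_inner: "(A *v x) \<bullet> y = x \<bullet> (transpose A *v y)" for A :: "real^'n^'n"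
  by (metis dot_lmul_matrix inner_commute transpose_matrix_vector transpose_transpose)

lemma matrix_eq_inner: "A = B" if "\<And>x y. (A *v x) \<bullet> y = (B *v x) \<bullet> y" for A B :: "real^'n^'n"
  unfolding matrix_eq using that by (metis vector_eq_rdot)

section \<open>Complex structures on real planes\<close>

text \<open>An isotropic complex subspace with Hermitian projection \<open>(X - i K) / 2\<close> is the
  \<open>i\<close>-eigenspace of the orthogonal complex structure \<open>K\<close> on the real plane with projection \<open>X\<close>,
  extended by 0 to the normal space.\<close>

definition plane_structure :: "real^'n^'n \<Rightarrow> real^'n^'n \<Rightarrow> bool" where
  "plane_structure X K \<longleftrightarrow> transpose X = X \<and> transpose K = - K \<and> X ** X = X \<and> K ** K = - X \<and>
     X ** K = K \<and> K ** X = K"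

lemma plane_structureD:
  fixes X K M :: "real^'n^'n"
  assumes "plane_structure X K"
  shows "transpose X = X" "transpose K = - K" "X ** X = X" "K ** K = - X" "X ** K = K" "K ** X = K"
    "X ** (X ** M) = X ** M" "K ** (K ** M) = - (X ** M)" "X ** (K ** M) = K ** M" "K ** (X ** M) = K ** M"
proof -
  show *: "transpose X = X" "transpose K = - K" "X ** X = X" "K ** K = - X" "X ** K = K" "K ** X = K"
    using assms by (auto simp: plane_structure_def)
  show "X ** (X ** M) = X ** M" "K ** (K ** M) = - (X ** M)" "X ** (K ** M) = K ** M" "K ** (X ** M) = K ** M"
    unfolding matrix_mul_assoc by (simp_all add: * mm.minus_left)
qed

text \<open>Infinitesimal deformations of \<open>(X, K)\<close> come from infinitesimal rotations. With respect to the
  eigenvalues \<open>a, b \<in> {i, 0, -i}\<close> of \<open>K\<close> the equation \<open>[A, K] = K'\<close> reads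
  \<open>(b - a) A\<^sub>a\<^sub>b = K'\<^sub>a\<^sub>b\<close>, the linearized equations leave only \<open>a \<noteq> b\<close>, and there
  \<open>1 / (b - a) = - (b - a) (1 - 3/4 a b)\<close>, which makes \<open>A\<close> a polynomial expression.\<close>

lemma infinitesimal_rotation:
  assumes PS: "plane_structure X K" and skew': "transpose K' = - K'"
    and X': "X' = - (K' ** K + K ** K')"
    and K': "K' ** K ** K + K ** K' ** K + K ** K ** K' = - K'"
  shows "\<exists>A. skew A \<and> X' = bracket A X \<and> K' = bracket A K"
proof -
  note ps = plane_structureD[OF PS]
  define A where "A = (3/4) *\<^sub>R (K ** K' ** K ** K - K ** K ** K' ** K) - (K' ** K - K ** K')"
  have trA: "skew A"
    unfolding skew_def A_def
    by (simp add: transpose_simps ps skew' mat_distrib mult_assocL algebra_simps)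
  have *: "K ** (K' ** K) = X ** K' + K' ** X - K'"
    using K' by (simp add: mult_assocL ps mat_distrib algebra_simps)
  have "X ** (K ** (K' ** K)) ** X = X ** (X ** K' + K' ** X - K') ** X" by (simp only: *)
  then have XK: "X ** (K' ** X) = K ** (K' ** K)"
    by (simp add: mult_assocL ps mat_distrib)
  have "bracket A K $ i $ j = K' $ i $ j" for i j
    using arg_cong[OF *, of "\<lambda>M. M $ i $ j"] arg_cong[OF XK, of "\<lambda>M. M $ i $ j"]
    by (simp only: bracket_def A_def mult_assocL ps mat_distrib vector_add_component vector_minus_component
        vector_uminus_component vector_scaleR_component) (simp add: field_simps)
  then have "bracket A K = K'" by (simp add: vec_eq_iff)
  moreover have "bracket A X = - (bracket A K ** K + K ** bracket A K)"
    by (simp add: bracket_def mult_assocL ps mat_distrib)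
  ultimately show ?thesis using trA X' by metis
qed

text \<open>The pair \<open>(X, K)\<close> encodes the complex matrix \<open>(X - i K) / 2\<close>; \<open>plane_part\<close> and \<open>rot_part\<close>
  recover \<open>X\<close> as \<open>P + cnj P\<close> and \<open>K\<close> as \<open>i (P - cnj P)\<close>.\<close>

definition to_proj :: "real^'n^'n \<Rightarrow> real^'n^'n \<Rightarrow> complex^'n^'n" where
  "to_proj X K = (\<chi> i j. Complex (X$i$j / 2) (- K$i$j / 2))"

definition plane_part :: "complex^'n^'n \<Rightarrow> real^'n^'n" where
  "plane_part P = (\<chi> i j. 2 * Re (P$i$j))"

definition rot_part :: "complex^'n^'n \<Rightarrow> real^'n^'n" where
  "rot_part P = (\<chi> i j. - 2 * Im (P$i$j))"

lemma to_proj_parts [simp]: "to_proj (plane_part P) (rot_part P) = P"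
  "plane_part (to_proj X K) = X" "rot_part (to_proj X K) = K"
  by (simp_all add: to_proj_def plane_part_def rot_part_def vec_eq_iff)

lemma to_proj_inject [simp]: "to_proj X K = to_proj Y L \<longleftrightarrow> X = Y \<and> K = L"
  by (metis to_proj_parts(2,3))

lemma to_proj_linear:
  "to_proj (X + Y) (K + L) = to_proj X K + to_proj Y L"
  "to_proj (r *\<^sub>R X) (r *\<^sub>R K) = r *\<^sub>R to_proj X K"
  "to_proj (- X) (- K) = - to_proj X K"
  "to_proj (X - Y) (K - L) = to_proj X K - to_proj Y L"
  "to_proj 0 0 = 0"
  by (simp_all add: to_proj_def vec_eq_iff complex_eq_iff add_divide_distrib diff_divide_distrib)

lemma bounded_linear_plane_part: "bounded_linear plane_part"
  unfolding linear_conv_bounded_linear[symmetric]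
  by (rule linearI) (simp_all add: plane_part_def vec_eq_iff algebra_simps)

lemma bounded_linear_rot_part: "bounded_linear rot_part"
  unfolding linear_conv_bounded_linear[symmetric]
  by (rule linearI) (simp_all add: rot_part_def vec_eq_iff algebra_simps)

lemma bounded_linear_to_proj1: "bounded_linear (\<lambda>X. to_proj X 0)"
  and bounded_linear_to_proj2: "bounded_linear (\<lambda>K. to_proj 0 K)"
  unfolding linear_conv_bounded_linear[symmetric]
  by (rule linearI, simp_all add: to_proj_def vec_eq_iff complex_eq_iff add_divide_distrib)+

lemma to_proj_split: "to_proj X K = to_proj X 0 + to_proj 0 K"
  by (simp add: to_proj_linear(1)[symmetric])

lemma to_proj_mult:
  "to_proj X K ** to_proj Y L = to_proj ((1/2) *\<^sub>R (X ** Y - K ** L)) ((1/2) *\<^sub>R (X ** L + K ** Y))"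
  by (simp add: to_proj_def matrix_matrix_mult_def vec_eq_iff complex_eq_iff Re_sum Im_sum
      sum_divide_distrib sum_subtractf[symmetric] sum.distrib[symmetric] sum_negf[symmetric])
     (auto intro!: sum.cong simp: field_simps)

lemma cnj_mat_to_proj: "cnj_mat (to_proj X K) = to_proj X (- K)"
  by (simp add: cnj_mat_def to_proj_def vec_eq_iff complex_eq_iff)

lemma orth_act_to_proj:
  "orth_act Q (to_proj X K) = to_proj (Q ** X ** transpose Q) (Q ** K ** transpose Q)"
  by (simp add: orth_act_def Let_def to_proj_def matrix_matrix_mult_def transpose_def vec_eq_iff complex_eq_iff
      Re_sum Im_sum sum_divide_distrib sum_negf[symmetric])
     (auto intro!: sum.cong simp: sum_divide_distrib[symmetric] sum_negf)

lemma orth_act_parts: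
  "orth_act Q W = to_proj (Q ** plane_part W ** transpose Q) (Q ** rot_part W ** transpose Q)"
  by (metis orth_act_to_proj to_proj_parts(1))

lemma pi_proj_inner: "pi_proj V \<bullet> pi_proj W = plane_part V \<bullet> plane_part W"
  by (simp add: pi_proj_def cnj_mat_def plane_part_def inner_vec_def inner_complex_def)

lemma pi_proj_eq_0: "pi_proj V = 0 \<longleftrightarrow> plane_part V = 0"
  by (simp add: pi_proj_def cnj_mat_def plane_part_def vec_eq_iff complex_eq_iff)

text \<open>The infinitesimal action of the orthogonal group.\<close>

definition inf_act :: "real^'n^'n \<Rightarrow> complex^'n^'n \<Rightarrow> complex^'n^'n" where
  "inf_act A W = to_proj (bracket A (plane_part W)) (bracket A (rot_part W))"

lemma linear_inf_act: "linear (inf_act A)"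
  by (rule linearI)
     (simp_all add: inf_act_def bracket_linear_right to_proj_linear linear_add[OF bounded_linear.linear[OF bounded_linear_plane_part]]
       linear_add[OF bounded_linear.linear[OF bounded_linear_rot_part]] linear_scale[OF bounded_linear.linear[OF bounded_linear_plane_part]]
       linear_scale[OF bounded_linear.linear[OF bounded_linear_rot_part]])

lemma inf_act_linear_left:
  "inf_act (A + B) W = inf_act A W + inf_act B W" "inf_act (r *\<^sub>R A) W = r *\<^sub>R inf_act A W"
  by (simp_all add: inf_act_def bracket_linear_left to_proj_linear)

section \<open>Projections onto isotropic subspaces\<close>

lemma hermitian_simps:
  "hermitian (x + y) z = hermitian x z + hermitian y z"
  "hermitian (x - y) z = hermitian x z - hermitian y z"
  "hermitian (c *s x) z = c * hermitian x z"
  "hermitian z (c *s x) = cnj c * hermitian z x"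
  "hermitian z (x + y) = hermitian z x + hermitian z y"
  "hermitian 0 z = 0" "hermitian z 0 = 0"
  by (simp_all add: hermitian_def algebra_simps sum.distrib sum_subtractf sum_distrib_left)

lemma hermitian_cnj: "hermitian y x = cnj (hermitian x y)"
  by (simp add: hermitian_def mult.commute)

lemma inner_hermitian: "x \<bullet> y = Re (hermitian x y)"
  by (simp add: inner_vec_def hermitian_def inner_complex_def)

lemma hermitian_self_eq_0: "hermitian x x = 0 \<Longrightarrow> x = 0"
  by (metis inner_hermitian inner_eq_zero_iff zero_complex.simps(1))

lemma scaleR_vector_complex: "r *\<^sub>R x = complex_of_real r *s (x :: complex^'n)"
  by (simp add: vec_eq_iff complex_eq_iff)

lemma complex_subspace_real: "vec.subspace E \<Longrightarrow> subspace (E :: (complex^'n) set)"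
  by (auto simp: vec.subspace_def subspace_def scaleR_vector_complex)

text \<open>A complex subspace is closed under multiplication by \<open>i\<close>, so its real orthogonal complement
  is also its Hermitian one, and the real orthogonal decomposition can be used.\<close>

lemma hermitian_decomp:
  assumes E: "vec.subspace (E :: (complex^'n) set)"
  shows "\<exists>!y. y \<in> E \<and> (\<forall>w\<in>E. hermitian (x - y) w = 0)"
proof -
  have span: "span E = E" using complex_subspace_real[OF E] by (simp add: span_eq_iff)
  obtain y z where yz: "y \<in> E" "\<And>w. w \<in> E \<Longrightarrow> orthogonal z w" "x = y + z"
    using orthogonal_subspace_decomp_exists[of E x] unfolding span by metis
  have "hermitian z w = 0" if "w \<in> E" for w
  proof -
    have "\<i> *s w \<in> E" using E that by (simp add: vec.subspace_def)
    then have "Re (hermitian z w) = 0" "Re (hermitian z (\<i> *s w)) = 0"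
      using yz(2) that unfolding orthogonal_def inner_hermitian by auto
    then show ?thesis by (simp add: hermitian_simps complex_eq_iff)
  qed
  then have "y \<in> E \<and> (\<forall>w\<in>E. hermitian (x - y) w = 0)" using yz by simp
  moreover have "y' = y" if "y' \<in> E \<and> (\<forall>w\<in>E. hermitian (x - y') w = 0)" for y'
  proof -
    have "y' - y \<in> E" using that yz(1) E by (simp add: vec.subspace_diff)
    then have "hermitian (x - y) (y' - y) - hermitian (x - y') (y' - y) = 0"
      using that calculation by simp
    then show ?thesis
      by (auto simp: hermitian_simps(2)[symmetric] dest: hermitian_self_eq_0)
  qed
  ultimately show ?thesis by blast
qed

lemma ex_proj:
  assumes E: "vec.subspace (E :: (complex^'n) set)"
  shows "\<exists>P. is_proj E P"
proof -
  define p where "p x = (THE y. y \<in> E \<and> (\<forall>w\<in>E. hermitian (x - y) w = 0))" for x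
  have p: "p x \<in> E" "w \<in> E \<Longrightarrow> hermitian (x - p x) w = 0" for x w
    using theI'[OF hermitian_decomp[OF E, of x]] by (auto simp: p_def)
  have pI: "p x = y" if "y \<in> E" "\<And>w. w \<in> E \<Longrightarrow> hermitian (x - y) w = 0" for x y
    using hermitian_decomp[OF E, of x] p(2)[of _ x] p(1)[of x] that by blast
  have "Vector_Spaces.linear (*s) (*s) p"
  proof unfold_locales
    fix x y show "p (x + y) = p x + p y"
    proof (rule pI)
      show "p x + p y \<in> E" using p E by (simp add: vec.subspace_def)
      fix w assume "w \<in> E"
      then have "hermitian (x - p x) w + hermitian (y - p y) w = 0" using p by simp
      then show "hermitian (x + y - (p x + p y)) w = 0"
        by (simp add: hermitian_simps algebra_simps)
    qed
  next
    fix c x show "p (c *s x) = c *s p x"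
    proof (rule pI)
      show "c *s p x \<in> E" using p E by (simp add: vec.subspace_def)
      fix w assume "w \<in> E"
      then have "c * hermitian (x - p x) w = 0" using p by simp
      then show "hermitian (c *s x - c *s p x) w = 0"
        by (simp only: hermitian_simps vector_ssub_ldistrib[symmetric])
    qed
  qed
  then have "matrix p *v x = p x" for x by (rule matrix_works)
  moreover have "p x = x" if "x \<in> E" for x by (rule pI) (use that in \<open>auto simp: hermitian_simps\<close>)
  moreover have "p x = 0" if "\<forall>y\<in>E. hermitian x y = 0" for x
    by (rule pI) (use that E in \<open>auto simp: vec.subspace_0\<close>)
  ultimately show ?thesis unfolding is_proj_def by metis
qed

lemma is_proj_decomp:
  assumes E: "vec.subspace (E :: (complex^'n) set)" and P: "is_proj E P"
  shows "P *v x \<in> E" "w \<in> E \<Longrightarrow> hermitian (x - P *v x) w = 0"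
proof -
  obtain y where y: "y \<in> E" "\<forall>w\<in>E. hermitian (x - y) w = 0" using hermitian_decomp[OF E] by blast
  have "P *v y = y" "P *v (x - y) = 0" using P y by (auto simp: is_proj_def)
  then have "P *v x = y" by (simp add: matrix_vector_mult_diff_distrib)
  then show "P *v x \<in> E" "w \<in> E \<Longrightarrow> hermitian (x - P *v x) w = 0" using y by auto
qed

lemma is_proj_unique:
  assumes E: "vec.subspace (E :: (complex^'n) set)" and "is_proj E P" "is_proj E P'"
  shows "P = P'"
  unfolding matrix_eq
  using hermitian_decomp[OF E] is_proj_decomp[OF E assms(2)] is_proj_decomp[OF E assms(3)] by metis

lemma proj_eq: "vec.subspace E \<Longrightarrow> is_proj E P \<Longrightarrow> proj E = P"
  unfolding proj_def by (rule the_equality) (auto intro: is_proj_unique)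

lemma is_proj_proj: "vec.subspace E \<Longrightarrow> is_proj E (proj E)"
  using ex_proj proj_eq by metis

lemma is_proj_adjoint:
  assumes E: "vec.subspace (E :: (complex^'n) set)" and P: "is_proj E P"
  shows "hermitian (P *v x) y = hermitian x (P *v y)"
proof -
  note d = is_proj_decomp[OF E P]
  have "hermitian (P *v x) y = hermitian (P *v x) (P *v y) + cnj (hermitian (y - P *v y) (P *v x))"
    unfolding hermitian_cnj[symmetric] hermitian_simps(5)[symmetric] by simp
  also have "\<dots> = hermitian (P *v x) (P *v y) + hermitian (x - P *v x) (P *v y)"
    using d by simp
  also have "\<dots> = hermitian x (P *v y)"
    unfolding hermitian_simps(1)[symmetric] by simp
  finally show ?thesis .
qed

lemma hermitian_axis: "hermitian x (axis i 1) = x $ i"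
  by (simp add: hermitian_def axis_def if_distrib[of cnj] if_distrib[of "(*) _"] sum.delta cong: if_cong)

lemma matrix_vector_axis: "(P *v axis j 1) $ i = P $ i $ (j::'n::finite)"  for P :: "complex^'n^'n"
  by (simp add: matrix_vector_mult_def axis_def if_distrib[of "(*) _"] sum.delta cong: if_cong)

text \<open>The equations of a plane structure are the real and imaginary parts of \<open>P P = P\<close> and
  \<open>P (cnj P) = 0\<close>; the latter holds because an isotropic space is Hermitian orthogonal to its
  conjugate.\<close>

lemma plane_structure_of_isotropic:
  assumes E: "E \<in> Z1 m"
  shows "plane_structure (plane_part (proj E)) (rot_part (proj E))"
proof -
  define P where "P = proj E"
  have sub: "vec.subspace E" and iso: "\<And>x y. x \<in> E \<Longrightarrow> y \<in> E \<Longrightarrow> (\<Sum>j\<in>UNIV. x $ j * y $ j) = 0"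
    using E by (auto simp: Z1_def)
  have P: "is_proj E P" unfolding P_def by (rule is_proj_proj[OF sub])
  note d = is_proj_decomp[OF sub P]
  define X where "X = plane_part P"
  define K where "K = rot_part P"
  have PXK: "P = to_proj X K" by (simp add: X_def K_def)
  have herm: "P $ i $ j = cnj (P $ j $ i)" for i j
    using is_proj_adjoint[OF sub P, of "axis j 1" "axis i 1"] hermitian_cnj[of "axis j 1" "P *v axis i 1"]
    by (simp add: hermitian_axis matrix_vector_axis)
  have tr: "transpose X = X" "transpose K = - K"
  proof -
    have "X $ j $ i = X $ i $ j" "K $ j $ i = - K $ i $ j" for i j
      using herm[of j i] by (simp_all add: X_def K_def plane_part_def rot_part_def)
    then have "transpose X $ i $ j = X $ i $ j" "transpose K $ i $ j = (- K) $ i $ j" for i j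
      unfolding transpose_def vec_lambda_beta vector_uminus_component by blast+
    then show "transpose X = X" "transpose K = - K" unfolding vec_eq_iff by blast+
  qed
  have "P ** P = P"
    unfolding matrix_eq matrix_vector_mul_assoc[symmetric] using d(1) P by (simp add: is_proj_def)
  then have 1: "X = (1/2) *\<^sub>R (X ** X - K ** K)" "K = (1/2) *\<^sub>R (X ** K + K ** X)"
    unfolding PXK to_proj_mult to_proj_inject by simp_all
  have "P ** cnj_mat P = 0"
    unfolding matrix_eq
  proof
    fix x
    have "cnj_mat P *v x = cnj_vec (P *v cnj_vec x)"
      by (simp add: cnj_mat_def cnj_vec_def vec_eq_iff matrix_vector_mult_def)
    moreover have "P *v cnj_vec y = 0" if "y \<in> E" for y
    proof -
      have "hermitian (cnj_vec y) w = cnj (\<Sum>j\<in>UNIV. y $ j * w $ j)" for w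
        by (simp add: hermitian_def cnj_vec_def)
      then have "\<forall>w\<in>E. hermitian (cnj_vec y) w = 0" using iso[OF that] by (metis complex_cnj_zero)
      then show ?thesis using P by (simp add: is_proj_def)
    qed
    ultimately show "(P ** cnj_mat P) *v x = 0 *v x"
      using d(1) by (simp add: matrix_vector_mul_assoc[symmetric])
  qed
  then have "to_proj ((1/2) *\<^sub>R (X ** X + K ** K)) ((1/2) *\<^sub>R (K ** X - X ** K)) = to_proj 0 0"
    unfolding PXK cnj_mat_to_proj to_proj_mult by (simp add: mat_distrib to_proj_linear(5))
  then have 2: "X ** X = - (K ** K)" "K ** X = X ** K"
    by (simp_all add: add_eq_0_iff2)
  have half: "(1/2) *\<^sub>R (Y + Y) = Y" for Y :: "real^'n^'n" by simp
  have XK: "X ** K = K" using 1(2) half[of "X ** K"] unfolding 2(2) by metis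
  have "- (K ** K) = X" using 1(1) half[of "- (K ** K)"] unfolding 2(1) by simp
  then have KK: "K ** K = - X" by (metis minus_minus)
  have "X ** X = X" using 2(1) KK by simp
  then show ?thesis using tr 2 XK KK unfolding plane_structure_def X_def K_def P_def by simp
qed

section \<open>The orthogonal group acting on isotropic subspaces\<close>

text \<open>Real orthogonal matrices preserve the Hermitian as well as the complex bilinear product.\<close>

lemma orth_act_in_Z1:
  fixes Q :: "real^'n^'n"
  assumes Q: "orthogonal_matrix Q" and P: "P \<in> proj ` Z1 m"
  shows "orth_act Q P \<in> proj ` Z1 m"
proof -
  obtain E where E: "E \<in> Z1 m" "P = proj E" using P by blast
  have sub: "vec.subspace E" and dim: "vec.dim E = m"
    and iso: "\<And>x y. x \<in> E \<Longrightarrow> y \<in> E \<Longrightarrow> (\<Sum>j\<in>UNIV. x $ j * y $ j) = 0"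
    using E by (auto simp: Z1_def)
  define R :: "complex^'n^'n" where "R = (\<chi> i j. complex_of_real (Q $ i $ j))"
  have "(\<Sum>k\<in>UNIV. Q $ k $ i * Q $ k $ j) = (if i = j then 1 else 0)" for i j
    using Q unfolding orthogonal_matrix
    by (simp add: matrix_matrix_mult_def transpose_def mat_def vec_eq_iff)
  then have "complex_of_real (\<Sum>k\<in>UNIV. Q $ k $ i * Q $ k $ j) = (if i = j then 1 else 0)" for i j
    by simp
  then have RR: "transpose R ** R = mat 1"
    by (simp add: R_def matrix_matrix_mult_def transpose_def mat_def vec_eq_iff)
  have act: "orth_act Q P = R ** P ** transpose R" by (simp add: orth_act_def R_def Let_def)
  have RRv: "transpose R *v (R *v x) = x" for x
    by (simp only: matrix_vector_mul_assoc RR matrix_vector_mul_lid)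
  have adj: "(\<Sum>j\<in>UNIV. (R *v x) $ j * y $ j) = (\<Sum>j\<in>UNIV. x $ j * (transpose R *v y) $ j)" for x y
    unfolding matrix_vector_mult_def transpose_def vec_lambda_beta sum_distrib_left sum_distrib_right
    by (subst sum.swap) (simp add: mult_ac)
  have cR: "cnj_vec (R *v y) = R *v cnj_vec y" "cnj_vec (transpose R *v y) = transpose R *v cnj_vec y" for y
    by (simp_all only: cnj_vec_def matrix_vector_mult_def vec_eq_iff R_def transpose_def) simp_all
  have herm: "hermitian (transpose R *v x) y = hermitian x (R *v y)" for x y
  proof -
    have *: "hermitian x y = (\<Sum>j\<in>UNIV. x $ j * cnj_vec y $ j)" for x y :: "complex^'n"
      by (simp add: hermitian_def cnj_vec_def)
    show ?thesis unfolding * cR using adj[of "cnj_vec y" x] by (simp add: mult.commute)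
  qed
  define E' where "E' = (*v) R ` E"
  have inj: "inj ((*v) R)" by (rule inj_on_inverseI[of _ "(*v) (transpose R)"]) (simp only: RRv)
  have lin: "Vector_Spaces.linear (*s) (*s) ((*v) R)" by (rule matrix_vector_mul_linear_gen)
  have sub': "vec.subspace E'"
    unfolding E'_def by (rule vec.subspace_image[OF sub])
  have "vec.dim E' = m"
    unfolding E'_def using vec.dim_image_eq[OF lin, of E] inj dim by (simp add: inj_on_subset)
  moreover have "(\<Sum>j\<in>UNIV. x $ j * y $ j) = 0" if "x \<in> E'" "y \<in> E'" for x y
    using that iso unfolding E'_def by (auto simp only: adj RRv)
  ultimately have Z: "E' \<in> Z1 m" using sub' by (simp add: Z1_def)
  have isp: "is_proj E P" using is_proj_proj[OF sub] E by simp
  have "is_proj E' (orth_act Q P)"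
    unfolding is_proj_def act matrix_vector_mul_assoc[symmetric]
  proof safe
    fix x assume "x \<in> E'" 
    then show "R *v (P *v (transpose R *v x)) = x"
      using isp unfolding E'_def is_proj_def by (auto simp only: RRv)
  next
    fix x assume "\<forall>y\<in>E'. hermitian x y = 0" 
    then have "\<forall>y\<in>E. hermitian (transpose R *v x) y = 0" unfolding herm E'_def by blast
    then show "R *v (P *v (transpose R *v x)) = 0"
      using isp unfolding is_proj_def by (metis matrix_vector_mult_0_right)
  qed
  then have "proj E' = orth_act Q P" by (rule proj_eq[OF sub'])
  then show ?thesis using Z by (metis imageI)
qed

text \<open>A curve of rotations with given initial velocity, in place of the matrix exponential: the
  Cayley transform \<open>(1 + t a) / (1 - t a)\<close> of \<open>a = A/2\<close>, written as
  \<open>(1 + t a)\<^sup>2 / (1 - t\<^sup>2 a\<^sup>2)\<close>.  In this form the denominator is symmetric and positive definite,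
  which makes its inverse smooth in \<open>t\<close> by \<open>smooth_riesz\<close>.\<close>

lemma rotation_curve:
  fixes A :: "real^'n^'n"
  assumes "skew A"
  shows "\<exists>Q. smooth_on UNIV Q \<and> (\<forall>t::real. orthogonal_matrix (Q t)) \<and> Q 0 = mat 1 \<and>
    (Q has_vector_derivative A) (at 0)"
proof -
  define a where "a = (1/2) *\<^sub>R A"
  have tra: "transpose a = - a" using assms by (simp add: a_def skew_def transpose_scalar)
  define C where "C t = mat 1 - t\<^sup>2 *\<^sub>R (a ** a)" for t :: real
  define G where "G t u v = u \<bullet> v + t\<^sup>2 * ((a *v u) \<bullet> (a *v v))" for t :: real and u v :: "real^'n"
  have G: "G t u v = (C t *v u) \<bullet> v" for t u v
  proof -
    have "(a *v u) \<bullet> (a *v v) = - ((a ** a) *v u) \<bullet> v"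
      using transpose_vector_inner[of a "a *v u" v]
      by (simp add: tra mv.minus_left inner_minus_right matrix_vector_mul_assoc)
    then show ?thesis
      by (simp add: G_def C_def mv.diff_left mv.scaleR_left inner_diff_left)
  qed
  have "\<exists>R. smooth_on (UNIV::real set) R \<and> (\<forall>t\<in>UNIV. R t \<in> span Basis \<and> (\<forall>b\<in>Basis. G t (R t) b = axis k 1 \<bullet> b))" for k
  proof (rule smooth_riesz[where G = G and l = "\<lambda>_ b. axis k 1 \<bullet> b"])
    fix t :: real
    show "bilinear (G t)" unfolding bilinear_def
      by (auto intro!: linearI simp: G_def algebra_simps inner_add_left inner_add_right mv.add_right mv.scaleR_right)
    show "G t u v = G t v u" for u v by (simp add: G_def inner_commute)
    show "G t u u > 0" if "u \<noteq> 0" for u using that by (simp add: G_def add_pos_nonneg)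
  next
    show "smooth_on UNIV (\<lambda>t. G t u v)" for u v
      unfolding G_def power2_eq_square
      by (intro smooth_on_add smooth_on_mult smooth_on_const smooth_on_id open_UNIV)
  qed (auto simp: independent_Basis smooth_on_const)
  then have "\<forall>k. \<exists>R. smooth_on (UNIV::real set) R \<and> (\<forall>t\<in>UNIV. R t \<in> span Basis \<and> (\<forall>b\<in>Basis. G t (R t) b = axis k 1 \<bullet> b))"
    by blast
  then obtain R where R: "\<And>k. smooth_on (UNIV::real set) (R k)" "\<And>k t b. b \<in> Basis \<Longrightarrow> G t (R k t) b = axis k 1 \<bullet> b"
    unfolding choice_iff by blast
  define M where "M t = (\<chi> i k. R k t $ i)" for t
  have smM: "smooth_on UNIV M"
    unfolding M_def by (intro smooth_on_vec open_UNIV smooth_on_linear[OF bounded_linear_vec_nth] R)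
  have CR: "C t *v R k t = axis k 1" for t k
    by (rule euclidean_eqI) (use R(2) in \<open>simp add: G\<close>)
  have CM: "C t ** M t = mat 1" for t
  proof -
    have "M t *v axis k 1 = R k t" for k
      by (simp add: matrix_vector_mult_basis column_def M_def)
    then have "(C t ** M t) *v axis k 1 = axis k 1" for k
      by (simp add: matrix_vector_mul_assoc[symmetric] CR)
    then have "column k (C t ** M t) = column k (mat 1)" for k
      by (metis matrix_vector_mult_basis matrix_vector_mul_lid)
    then show ?thesis by (simp add: column_def vec_eq_iff)
  qed
  then have MC: "M t ** C t = mat 1" for t by (simp add: matrix_left_right_inverse)
  define B where "B t = mat 1 + t *\<^sub>R a" for t
  define Q where "Q t = B t ** B t ** M t" for t
  have smB: "smooth_on UNIV B" unfolding B_def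
    by (intro smooth_on_add smooth_on_scaleR smooth_on_const smooth_on_id open_UNIV)
  have smQ: "smooth_on UNIV Q" unfolding Q_def
    by (intro smooth_on_bilinear[OF bounded_bilinear_matrix_mult] smB smM open_UNIV)
  have trC: "transpose (C t) = C t" for t
    by (simp add: C_def transpose_simps tra mat_distrib)
  have oQ: "orthogonal_matrix (Q t)" for t
  proof -
    have trB: "transpose (B t) = mat 1 - t *\<^sub>R a" by (simp add: B_def transpose_simps tra)
    have 1: "transpose (B t) ** B t = C t" "B t ** transpose (B t) = C t"
      unfolding trB unfolding B_def C_def by (simp_all add: mat_distrib power2_eq_square algebra_simps)
    have "transpose (B t) ** C t = C t ** transpose (B t)" by (metis 1 matrix_mul_assoc)
    have "transpose (Q t) ** Q t = transpose (M t) ** (transpose (B t) ** (transpose (B t) ** B t) ** B t) ** M t"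
      by (simp add: Q_def matrix_transpose_mul matrix_mul_assoc)
    also have "\<dots> = transpose (M t) ** (C t ** transpose (B t) ** B t) ** M t"
      by (simp add: 1 \<open>transpose (B t) ** C t = C t ** transpose (B t)\<close>)
    also have "\<dots> = (transpose (M t) ** transpose (C t)) ** (C t ** M t)"
      by (simp add: matrix_mul_assoc[symmetric] 1 trC)
    also have "\<dots> = mat 1" by (simp add: matrix_transpose_mul[symmetric] CM)
    finally show ?thesis by (simp add: orthogonal_matrix)
  qed
  have Qt: "Q t = mat 1 + t *\<^sub>R A + t *\<^sub>R (t *\<^sub>R (a ** a + Q t ** (a ** a)))" for t
  proof -
    have "Q t ** C t = B t ** B t" by (simp add: Q_def matrix_mul_assoc[symmetric] MC)
    moreover have "Q t ** C t = Q t - t *\<^sub>R (t *\<^sub>R (Q t ** (a ** a)))"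
      by (simp add: C_def mat_distrib power2_eq_square)
    moreover have "B t ** B t = mat 1 + t *\<^sub>R A + t *\<^sub>R (t *\<^sub>R (a ** a))"
    proof -
      have "A = a + a" by (simp add: a_def flip: scaleR_add_left)
      then show ?thesis by (simp add: B_def mat_distrib scaleR_add_right)
    qed
    ultimately show ?thesis by (simp add: algebra_simps)
  qed
  have "((\<lambda>t. mat 1 + t *\<^sub>R A + t *\<^sub>R (t *\<^sub>R (a ** a + Q t ** (a ** a)))) has_vector_derivative A) (at 0)"
  proof -
    have "Q differentiable (at 0)" using smooth_on_differentiable[OF smQ] by simp
    then obtain q where q: "(Q has_vector_derivative q) (at 0)" by (auto simp: vector_derivative_works)
    define N where "N t = a ** a + Q t ** (a ** a)" for t
    have N: "(N has_vector_derivative q ** (a ** a)) (at 0)"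
      unfolding N_def
      by (rule has_vector_derivative_eq_rhs[OF has_vector_derivative_add[OF has_vector_derivative_const
         bounded_linear.has_vector_derivative[OF mm.bounded_linear_left q]]]) simp
    have id: "((\<lambda>t::real. t) has_field_derivative 1) (at 0)" by (rule DERIV_ident)
    have tN: "((\<lambda>t. t *\<^sub>R N t) has_vector_derivative N 0) (at 0)"
      using has_vector_derivative_scaleR[OF id N] by simp
    have ttN: "((\<lambda>t. t *\<^sub>R (t *\<^sub>R N t)) has_vector_derivative 0) (at 0)"
      using has_vector_derivative_scaleR[OF id tN] by simp
    have tA: "((\<lambda>t. t *\<^sub>R A) has_vector_derivative A) (at 0)"
      using has_vector_derivative_scaleR[OF id has_vector_derivative_const[of A]] by simp
    show ?thesis unfolding N_def[symmetric]
      using has_vector_derivative_add[OF has_vector_derivative_add[OF has_vector_derivative_const tA] ttN, of "mat 1"]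
      by simp
  qed
  then have "(Q has_vector_derivative A) (at 0)"
    by (rule has_vector_derivative_transform[OF UNIV_I Qt, rotated])
  moreover have "Q 0 = mat 1" using Qt[of 0] by simp
  ultimately show ?thesis using smQ oQ by blast
qed

lemma plane_structure_of_Z:
  assumes "P \<in> proj ` Z1 m"
  shows "plane_structure (plane_part P) (rot_part P)"
  using assms plane_structure_of_isotropic by blast

lemma has_vector_derivative_conv_FD:
  "(\<gamma> has_vector_derivative W) (at (0::real)) \<Longrightarrow> FD \<gamma> 0 1 = W"
  by (simp add: has_vector_derivative_def FD_eq)

text \<open>Differentiating the equations \<open>X = - K\<^sup>2\<close>, \<open>K\<^sup>3 = - K\<close> and \<open>K\<^sup>T = - K\<close> along a family of plane
  structures gives the linearized equations.\<close>

lemma infinitesimal_rotation_of_family: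
  fixes P :: "'u::real_normed_vector \<Rightarrow> complex^'n^'n"
  assumes S: "open S" "x \<in> S" and P: "\<And>y. y \<in> S \<Longrightarrow> plane_structure (plane_part (P y)) (rot_part (P y))"
    and dP: "P differentiable (at x)"
  shows "\<exists>A. skew A \<and> FD P x u = inf_act A (P x)"
proof -
  define X where "X y = plane_part (P y)" for y
  define K where "K y = rot_part (P y)" for y
  have dX: "X differentiable (at x)" and dK: "K differentiable (at x)"
    unfolding X_def K_def using bounded_linear.has_derivative[OF bounded_linear_plane_part FD_works[OF dP]]
      bounded_linear.has_derivative[OF bounded_linear_rot_part FD_works[OF dP]]
    by (auto simp: differentiable_def)
  have FX: "FD X x u = plane_part (FD P x u)" "FD K x u = rot_part (FD P x u)"
    unfolding X_def K_def by (simp_all add: FD_linear[OF bounded_linear_plane_part dP] FD_linear[OF bounded_linear_rot_part dP])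
  have ps: "plane_structure (X y) (K y)" if "y \<in> S" for y using P[OF that] by (simp add: X_def K_def)
  have KK: "(\<lambda>y. K y ** K y) differentiable (at x)"
    by (rule differentiable_bilinear[OF bounded_bilinear_matrix_mult dK dK])
  have FKK: "FD (\<lambda>y. K y ** K y) x u = K x ** FD K x u + FD K x u ** K x"
    by (rule FD_bilinear[OF bounded_bilinear_matrix_mult dK dK])
  have "FD X x u = FD (\<lambda>y. - (K y ** K y)) x u"
    by (rule fun_cong[OF FD_cong[OF S]]) (use plane_structureD(4)[OF ps] in simp)
  also have "\<dots> = - (FD K x u ** K x + K x ** FD K x u)"
    using FD_linear[OF bounded_linear_minus[OF bounded_linear_ident] KK] FKK by simp
  finally have X': "FD X x u = - (FD K x u ** K x + K x ** FD K x u)" .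
  have "FD (\<lambda>y. - K y) x u = FD (\<lambda>y. (K y ** K y) ** K y) x u"
    by (rule fun_cong[OF FD_cong[OF S]])
       (use plane_structureD[OF ps] in \<open>simp add: mat_distrib\<close>)
  then have K': "FD K x u ** K x ** K x + K x ** FD K x u ** K x + K x ** K x ** FD K x u = - FD K x u"
    using FD_linear[OF bounded_linear_minus[OF bounded_linear_ident] dK]
      FD_bilinear[OF bounded_bilinear_matrix_mult KK dK] FKK by (simp add: mat_distrib algebra_simps)
  have "FD (\<lambda>y. transpose (K y)) x u = FD (\<lambda>y. - K y) x u"
    by (rule fun_cong[OF FD_cong[OF S]]) (use plane_structureD(2)[OF ps] in simp)
  then have sk: "transpose (FD K x u) = - FD K x u"
    using FD_linear[OF bounded_linear_transpose dK] FD_linear[OF bounded_linear_minus[OF bounded_linear_ident] dK]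
    by simp
  obtain A where "skew A" "FD X x u = bracket A (X x)" "FD K x u = bracket A (K x)"
    using infinitesimal_rotation[OF ps[OF S(2)] sk X' K'] by blast
  then show ?thesis
    unfolding inf_act_def FX X_def K_def by (metis to_proj_parts(1))
qed

lemma orth_act_curve:
  fixes Q :: "real \<Rightarrow> real^'n^'n"
  assumes smQ: "smooth_on UNIV Q" and Q0: "Q 0 = mat 1" and Q': "(Q has_vector_derivative A) (at 0)"
    and A: "skew A"
  shows "smooth_on UNIV (\<lambda>t. orth_act (Q t) W)" "orth_act (Q 0) W = W"
    "((\<lambda>t. orth_act (Q t) W) has_vector_derivative inf_act A W) (at 0)"
proof -
  have e: "orth_act (Q t) W = to_proj (Q t ** plane_part W ** transpose (Q t)) 0 + to_proj 0 (Q t ** rot_part W ** transpose (Q t))" for t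
    unfolding orth_act_parts by (rule to_proj_split)
  have sm: "smooth_on UNIV (\<lambda>t. Q t ** M ** transpose (Q t))" for M
    by (intro smooth_on_bilinear[OF bounded_bilinear_matrix_mult] smooth_on_linear[OF bounded_linear_transpose]
        smQ smooth_on_const open_UNIV)
  show "smooth_on UNIV (\<lambda>t. orth_act (Q t) W)"
    unfolding e by (intro smooth_on_add open_UNIV smooth_on_linear[OF bounded_linear_to_proj1]
        smooth_on_linear[OF bounded_linear_to_proj2] sm)
  show "orth_act (Q 0) W = W" by (simp add: Q0 orth_act_parts)
  have d: "((\<lambda>t. Q t ** M ** transpose (Q t)) has_vector_derivative bracket A M) (at 0)" for M
    by (rule has_vector_derivative_eq_rhs[OF mm.has_vector_derivative[OF mm.has_vector_derivative[OF Q' has_vector_derivative_const]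
       bounded_linear.has_vector_derivative[OF bounded_linear_transpose Q']]])
       (use A in \<open>simp add: Q0 bracket_def skew_def mat_distrib\<close>)
  have "((\<lambda>t. orth_act (Q t) W) has_vector_derivative to_proj (bracket A (plane_part W)) 0 + to_proj 0 (bracket A (rot_part W))) (at 0)"
    unfolding e by (intro has_vector_derivative_add bounded_linear.has_vector_derivative[OF bounded_linear_to_proj1]
       bounded_linear.has_vector_derivative[OF bounded_linear_to_proj2] d)
  then show "((\<lambda>t. orth_act (Q t) W) has_vector_derivative inf_act A W) (at 0)"
    unfolding inf_act_def to_proj_split[symmetric] .
qed

text \<open>Every curve in \<open>Z\<^sub>1\<close> satisfies the equations of a plane structure, so it moves by infinitesimal
  rotations; conversely every infinitesimal rotation integrates to a curve of rotations.\<close>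

lemma tangent_at_Z:
  fixes P :: "complex^'n^'n"
  assumes P: "P \<in> proj ` Z1 m"
  shows "tangent_at (proj ` Z1 m) P = {inf_act A P | A. skew A}"
proof (rule set_eqI)
  fix W 
  show "W \<in> tangent_at (proj ` Z1 m) P \<longleftrightarrow> W \<in> {inf_act A P | A. skew A}"
  proof
    assume "W \<in> tangent_at (proj ` Z1 m) P"
    then obtain \<gamma> and \<epsilon> :: real where \<gamma>: "\<epsilon> > 0" "smooth_on {-\<epsilon><..<\<epsilon>} \<gamma>" "\<gamma> ` {-\<epsilon><..<\<epsilon>} \<subseteq> proj ` Z1 m"
      "\<gamma> 0 = P" "(\<gamma> has_vector_derivative W) (at 0)"
      unfolding tangent_at_def by blast
    have 0: "0 \<in> {-\<epsilon><..<\<epsilon>}" using \<gamma>(1) by simp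
    have "\<exists>A. skew A \<and> FD \<gamma> 0 1 = inf_act A (\<gamma> 0)"
    proof (rule infinitesimal_rotation_of_family[OF _ 0])
      fix t assume "t \<in> {-\<epsilon><..<\<epsilon>}"
      then have "\<gamma> t \<in> proj ` Z1 m" using \<gamma>(3) by blast
      then show "plane_structure (plane_part (\<gamma> t)) (rot_part (\<gamma> t))" by (rule plane_structure_of_Z)
    qed (use smooth_on_differentiable[OF \<gamma>(2) 0] in auto)
    then show "W \<in> {inf_act A P | A. skew A}"
      using has_vector_derivative_conv_FD[OF \<gamma>(5)] \<gamma>(4) by auto
  next
    assume "W \<in> {inf_act A P | A. skew A}"
    then obtain A where A: "skew A" "W = inf_act A P" by blast
    obtain Q where Q: "smooth_on UNIV Q" "\<And>t::real. orthogonal_matrix (Q t)" "Q 0 = mat 1"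
      "(Q has_vector_derivative A) (at 0)" using rotation_curve[OF A(1)] by blast
    note c = orth_act_curve[OF Q(1,3,4) A(1), of P]
    have "(\<lambda>t. orth_act (Q t) P) ` {-1<..<1} \<subseteq> proj ` Z1 m"
      using orth_act_in_Z1[OF Q(2) P] by blast
    then show "W \<in> tangent_at (proj ` Z1 m) P"
      unfolding tangent_at_def A(2) using smooth_on_subset[OF c(1)] c(2,3)
      by (intro CollectI exI[of _ "\<lambda>t. orth_act (Q t) P"] exI[of _ 1]) simp
  qed
qed

lemma subspace_tangent_at_Z:
  assumes "P \<in> proj ` Z1 m"
  shows "subspace (tangent_at (proj ` Z1 m) P)"
  unfolding tangent_at_Z[OF assms]
proof (rule subspaceI)
  show "0 \<in> {inf_act A P |A. skew A}"
    by (auto intro!: exI[of _ 0] simp: inf_act_def bracket_def mat_distrib to_proj_linear skew_def transpose_def vec_eq_iff)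
next
  fix V W assume "V \<in> {inf_act A P |A. skew A}" "W \<in> {inf_act A P |A. skew A}"
  then obtain A B where "skew A" "skew B" "V = inf_act A P" "W = inf_act B P" by blast
  then show "V + W \<in> {inf_act A P |A. skew A}"
    by (auto intro!: exI[of _ "A + B"] simp: inf_act_linear_left skew_def transpose_simps)
next
  fix r V assume "V \<in> {inf_act A P |A. skew A}" 
  then obtain A where "skew A" "V = inf_act A P" by blast
  then show "r *\<^sub>R V \<in> {inf_act A P |A. skew A}"
    by (auto intro!: exI[of _ "r *\<^sub>R A"] simp: inf_act_linear_left skew_def transpose_simps)
qed

section \<open>Invariant metrics on the space of isotropic subspaces\<close>

lemma metric_along_map:
  fixes h :: "'v::euclidean_space \<Rightarrow> 'v \<Rightarrow> 'v \<Rightarrow> real" and \<Phi> a b :: "'u::real_normed_vector \<Rightarrow> 'v"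
  assumes h: "riem_metric_on UNIV h" and d: "\<Phi> differentiable (at x)" "a differentiable (at x)" "b differentiable (at x)"
  shows "FD (\<lambda>y. h (\<Phi> y) (a y) (b y)) x u =
    FD (\<lambda>Q. h Q (a x) (b x)) (\<Phi> x) (FD \<Phi> x u) + h (\<Phi> x) (FD a x u) (b x) + h (\<Phi> x) (a x) (FD b x u)"
proof -
  have lin1: "linear (\<lambda>v. h Q v z)" and lin2: "linear (h Q v)" for Q v z
    using h by (auto simp: riem_metric_on_def bilinear_def)
  have dh: "(\<lambda>Q. h Q v w) differentiable (at Q)" for v w Q
    using h smooth_on_differentiable by (fastforce simp: riem_metric_on_def)
  have d1: "(\<lambda>y. h (\<Phi> y) v w) differentiable (at x)" for v w
    using differentiable_chain_at[OF d(1) dh] by (simp add: o_def)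
  have 1: "FD (\<lambda>y. h (\<Phi> y) v w) x u = FD (\<lambda>Q. h Q v w) (\<Phi> x) (FD \<Phi> x u)" for v w
    using FD_chain[OF d(1) dh] by (simp add: o_def)
  have 3: "((\<lambda>y. h (\<Phi> y) (a y) w) has_derivative (\<lambda>u. FD (\<lambda>y. h (\<Phi> y) (a x) w) x u + h (\<Phi> x) (FD a x u) w)) (at x)" for w
    by (rule has_derivative_linear_family[where L="\<lambda>y z. h (\<Phi> y) z w", OF open_UNIV _ lin1 d1 d(2)]) simp
  have d2: "(\<lambda>y. h (\<Phi> y) (a y) w) differentiable (at x)" 
    and 2: "FD (\<lambda>y. h (\<Phi> y) (a y) w) x u = FD (\<lambda>y. h (\<Phi> y) (a x) w) x u + h (\<Phi> x) (FD a x u) w" for w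
    using 3[of w] by (auto simp: differentiable_def FD_eq[OF 3])
  show ?thesis
    using FD_linear_family[where L="\<lambda>y z. h (\<Phi> y) (a y) z", OF open_UNIV _ lin2 d2 d(3)] by (simp add: 1 2)
qed

text \<open>The vector field \<open>Q \<mapsto> [A, Q]\<close> is a Killing field of every invariant metric: its Lie
  derivative of the metric vanishes, as its flow consists of isometries.\<close>

lemma inf_act_Killing:
  fixes h :: "complex^'n^'n \<Rightarrow> complex^'n^'n \<Rightarrow> complex^'n^'n \<Rightarrow> real"
  assumes h: "riem_metric_on UNIV h" "orth_invariant (proj ` Z1 m) h" and P: "P \<in> proj ` Z1 m" and A: "skew A"
    and V: "V \<in> tangent_at (proj ` Z1 m) P" and W: "W \<in> tangent_at (proj ` Z1 m) P"
  shows "FD (\<lambda>Q. h Q V W) P (inf_act A P) + h P (inf_act A V) W + h P V (inf_act A W) = 0"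
proof -
  obtain Q where Q: "smooth_on UNIV Q" "\<And>t::real. orthogonal_matrix (Q t)" "Q 0 = mat 1"
      "(Q has_vector_derivative A) (at 0)" using rotation_curve[OF A] by blast
  note c = orth_act_curve[OF Q(1,3,4) A]
  have df: "(\<lambda>t. orth_act (Q t) W) differentiable (at 0)" for W
    using smooth_on_differentiable[OF c(1)] by blast
  have "FD (\<lambda>t. h (orth_act (Q t) P) (orth_act (Q t) V) (orth_act (Q t) W)) 0 1 = FD (\<lambda>t. h P V W) (0::real) 1"
  proof -
    have "h (orth_act (Q t) P) (orth_act (Q t) V) (orth_act (Q t) W) = h P V W" for t
      using h(2) P V W Q(2) unfolding orth_invariant_def by metis
    then show ?thesis by simp
  qed
  then show ?thesis
    unfolding metric_along_map[OF h(1) df df df] by (simp add: c(2) has_vector_derivative_conv_FD[OF c(3)])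
qed

text \<open>The rotation by \<open>-1\<close> on the plane of \<open>E\<close> fixes \<open>E\<close>; it acts as \<open>-1\<close> on horizontal and as
  \<open>1\<close> on vertical tangent vectors, which are therefore orthogonal for every invariant metric.  So
  the inner product of a horizontal vector with any tangent vector can be computed in the
  Grassmannian.\<close>

definition reflection :: "complex^'n^'n \<Rightarrow> real^'n^'n" where
  "reflection P = mat 1 - 2 *\<^sub>R plane_part P"

lemma metric_horizontal:
  fixes h :: "complex^'n^'n \<Rightarrow> complex^'n^'n \<Rightarrow> complex^'n^'n \<Rightarrow> real"
  assumes h: "riem_metric_on UNIV h" "orth_invariant (proj ` Z1 m) h"
    "riem_submersion_upto_scale (proj ` Z1 m) h B pi_proj"
  shows "\<exists>k>0. \<forall>P\<in>proj ` Z1 m. \<forall>V\<in>tangent_at (proj ` Z1 m) P. \<forall>W\<in>tangent_at (proj ` Z1 m) P.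
    orth_act (reflection P) V = - V \<longrightarrow> h P V W = k * (plane_part V \<bullet> plane_part W)"
proof -
  obtain k where k: "k > 0" and sub: "\<And>P X Y. P\<in>proj ` Z1 m \<Longrightarrow> X\<in>tangent_at (proj ` Z1 m) P \<Longrightarrow> Y\<in>tangent_at (proj ` Z1 m) P
     \<Longrightarrow> (\<And>V. V\<in>tangent_at (proj ` Z1 m) P \<Longrightarrow> pi_proj V = 0 \<Longrightarrow> h P X V = 0 \<and> h P Y V = 0) \<Longrightarrow>
        h P X Y = k * (pi_proj X \<bullet> pi_proj Y)"
    using h(3) unfolding riem_submersion_upto_scale_def by metis
  have "h P V W = k * (plane_part V \<bullet> plane_part W)" 
    if P: "P \<in> proj ` Z1 m" and V: "V \<in> tangent_at (proj ` Z1 m) P" and W: "W \<in> tangent_at (proj ` Z1 m) P"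
      and hor: "orth_act (reflection P) V = - V" for P V W
  proof -
    define X where "X = plane_part P"
    define K where "K = rot_part P"
    define Q where "Q = reflection P"
    note ps = plane_structureD[OF plane_structure_of_Z[OF P], folded X_def K_def]
    have bilP: "bilinear (h P)" using h(1) by (simp add: riem_metric_on_def)
    have Q: "Q = mat 1 - 2 *\<^sub>R X" by (simp add: Q_def reflection_def X_def)
    have trQ: "transpose Q = Q" by (simp add: Q transpose_simps ps)
    have QQ: "Q ** Q = mat 1" by (simp add: Q mat_distrib ps algebra_simps)
    have QX: "Q ** X = - X" "X ** Q = - X" "Q ** K = - K" "K ** Q = - K"
      by (simp_all add: Q mat_distrib ps algebra_simps scaleR_2[symmetric])
    have oQ: "orthogonal_matrix Q" by (simp add: orthogonal_matrix trQ QQ)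
    have QP: "orth_act Q P = P"
    proof -
      have "Q ** X ** Q = X" "Q ** K ** Q = K" by (simp_all add: QX mat_distrib)
      then show ?thesis unfolding orth_act_parts trQ X_def[symmetric] K_def[symmetric] 
        by (simp add: X_def K_def)
    qed
    have QM: "Q ** (Q ** M) = M" for M :: "real^'n^'n" by (simp add: matrix_mul_assoc QQ)
    have QXM: "Q ** (X ** M) = - (X ** M)" "X ** (Q ** M) = - (X ** M)" "Q ** (K ** M) = - (K ** M)" "K ** (Q ** M) = - (K ** M)" for M :: "real^'n^'n"
      by (simp_all add: matrix_mul_assoc QX) (simp_all add: mm.minus_left)
    have act: "orth_act Q (inf_act A P) = inf_act (Q ** A ** Q) P" for A
      unfolding orth_act_parts inf_act_def X_def[symmetric] K_def[symmetric] to_proj_parts trQ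
      by (simp add: bracket_def mat_distrib mult_assocL QXM QX)
    have orth0: "h P Y Z = 0" if Y: "Y \<in> tangent_at (proj ` Z1 m) P" "orth_act Q Y = - Y"
       and Z: "Z \<in> tangent_at (proj ` Z1 m) P" "orth_act Q Z = Z" for Y Z
    proof -
      have "h P Y Z = h (orth_act Q P) (orth_act Q Y) (orth_act Q Z)"
        using h(2) oQ P Y Z unfolding orth_invariant_def by metis
      also have "\<dots> = h P (- Y) Z" by (simp only: QP Y Z)
      also have "\<dots> = - h P Y Z"
        by (rule bilinear_lneg[OF bilP])
      finally show ?thesis by simp
    qed
    have vert: "orth_act Q Z = Z" if Z: "Z \<in> tangent_at (proj ` Z1 m) P" "pi_proj Z = 0" for Z
    proof -
      obtain A where A: "skew A" "Z = inf_act A P" using Z tangent_at_Z[OF P] by blast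
      have "bracket A X = 0" using Z(2) unfolding pi_proj_eq_0 A(2) inf_act_def X_def by simp
      then have "Q ** A ** Q = A"
        by (simp add: Q bracket_def mat_distrib mult_assocL ps algebra_simps)
      then show ?thesis using act A by simp
    qed
    obtain A where A: "skew A" "W = inf_act A P" using W tangent_at_Z[OF P] by blast
    \<comment> \<open>the horizontal and the vertical part of \<open>W\<close>\<close>
    define W1 where "W1 = (1/2) *\<^sub>R (W - orth_act Q W)"
    define W2 where "W2 = (1/2) *\<^sub>R (W + orth_act Q W)"
    have skQ: "skew (Q ** A ** Q)" using A(1) by (simp add: skew_def transpose_simps trQ mat_distrib matrix_mul_assoc)
    have QW: "orth_act Q W \<in> tangent_at (proj ` Z1 m) P" unfolding A(2) act tangent_at_Z[OF P] using skQ by blast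
    note st = subspace_tangent_at_Z[OF P]
    have T12: "W1 \<in> tangent_at (proj ` Z1 m) P" "W2 \<in> tangent_at (proj ` Z1 m) P"
      unfolding W1_def W2_def using W QW st by (auto intro!: subspace_scale subspace_add subspace_diff)
    have "orth_act Q (orth_act Q W) = W"
      unfolding A(2) act by (simp add: mult_assocL QM QQ)
    moreover have lin: "orth_act Q (r *\<^sub>R (Y + s *\<^sub>R Z)) = r *\<^sub>R (orth_act Q Y + s *\<^sub>R orth_act Q Z)" for Y Z r s
      unfolding orth_act_parts
      by (simp add: linear_add[OF bounded_linear.linear[OF bounded_linear_plane_part]] linear_scale[OF bounded_linear.linear[OF bounded_linear_plane_part]]
           linear_add[OF bounded_linear.linear[OF bounded_linear_rot_part]] linear_scale[OF bounded_linear.linear[OF bounded_linear_rot_part]]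
            mat_distrib to_proj_linear)
    ultimately have Q12: "orth_act Q W1 = - W1" "orth_act Q W2 = W2"
      unfolding W1_def W2_def using lin[of "1/2" W "-1" "orth_act Q W"] lin[of "1/2" W "1" "orth_act Q W"]
      by (simp_all add: algebra_simps)
    have p2: "plane_part W2 = 0"
    proof -
      define D where "D = bracket A X"
      have XDX: "X ** (D ** X) = 0" by (simp add: D_def bracket_def mat_distrib mult_assocL ps)
      have XD: "X ** D + D ** X = D" by (simp add: D_def bracket_def mat_distrib mult_assocL ps)
      have "Q ** D ** Q = D - 2 *\<^sub>R (X ** D + D ** X)"
        by (simp add: Q mat_distrib mult_assocL XDX algebra_simps)
      then have "Q ** D ** Q = - D" unfolding XD by (simp add: scaleR_2)
      then show ?thesis
        unfolding W2_def orth_act_parts trQ A(2) inf_act_def 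
        by (simp add: to_proj_linear(1)[symmetric] to_proj_linear(2)[symmetric] D_def X_def)
    qed
    have W12: "W = W1 + W2" by (simp add: W1_def W2_def scaleR_add_right[symmetric] scaleR_2[symmetric])
    have "h P V W = h P V W1 + h P V W2"
      unfolding W12 by (rule bilinear_radd[OF bilP])
    also have "h P V W2 = 0" using orth0 V hor T12 Q12 Q_def by blast
    also have "h P V W1 = k * (pi_proj V \<bullet> pi_proj W1)"
      by (rule sub[OF P V T12(1)]) (use orth0 vert V hor T12 Q12 Q_def in blast)
    also have "pi_proj V \<bullet> pi_proj W1 = plane_part V \<bullet> plane_part W"
      unfolding pi_proj_inner W12 using p2
      by (simp add: linear_add[OF bounded_linear.linear[OF bounded_linear_plane_part]])
    finally show ?thesis by simp
  qed
  then show ?thesis using k by blast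
qed

section \<open>A Kaehler immersion in a chart\<close>

lemma normal_part_eq:
  assumes "linear (FD F x)" "y - z = FD F x u" "\<And>u. z \<bullet> FD F x u = 0"
  shows "normal_part F x y = z"
  unfolding normal_part_def
proof (rule the_equality)
  fix z' assume z': "(\<exists>u. y - z' = FD F x u) \<and> (\<forall>u. z' \<bullet> FD F x u = 0)"
  then obtain u' where "y - z' = FD F x u'" by blast
  then have e: "z' - z = FD F x (u - u')" 
    by (simp add: linear_diff[OF assms(1)] assms(2)[symmetric] flip: \<open>y - z' = FD F x u'\<close>)
  have "(z' - z) \<bullet> (z' - z) = z' \<bullet> FD F x (u - u') - z \<bullet> FD F x (u - u')"
    by (simp add: inner_diff_left e[symmetric])
  then show "z' = z" using z' assms(3) by simp
qed (use assms in blast)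

text \<open>The derivative of the invariance of the inner product under rotations.\<close>

lemma inner_bracket_antisym:
  assumes "skew A"
  shows "M \<bullet> bracket A N + N \<bullet> bracket A M = 0"
proof -
  have tr: "transpose A = - A" using assms by (simp add: skew_def)
  have "(A ** N) \<bullet> M = - (N \<bullet> (A ** M))" "(N ** A) \<bullet> M = - (N \<bullet> (M ** A))"
    by (simp_all add: inner_matrix_mult_left[of A N M] inner_matrix_mult_right[of N A M] tr mat_distrib)
  then show ?thesis by (simp add: bracket_def inner_diff_right inner_commute)
qed

text \<open>The bracket with a symmetric matrix \<open>X\<close> is selfadjoint, \<open>B \<bullet> [A, X] = A \<bullet> [B, X]\<close>, and \<open>[B, X]\<close>
  is itself skew-symmetric when \<open>B\<close> is symmetric.\<close>

lemma commutes_iff_inner_bracket: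
  assumes "transpose B = B" "transpose X = X"
  shows "(\<forall>A. skew A \<longrightarrow> B \<bullet> bracket A X = 0) \<longleftrightarrow> B ** X = X ** B"
proof -
  have e: "B \<bullet> bracket A X = A \<bullet> (B ** X - X ** B)" for A
    using inner_matrix_mult_left[of X A B] inner_matrix_mult_right[of A X B]
    by (simp add: bracket_def inner_diff_right assms inner_commute)
  have "skew (B ** X - X ** B)" by (simp add: skew_def transpose_simps assms)
  then show ?thesis unfolding e by (metis eq_iff_diff_eq_0 inner_eq_zero_iff inner_zero_right)
qed

text \<open>The hypothesis on \<open>M\<close> says that it exchanges the image and the kernel of \<open>X\<close>, which holds for
  the derivative of a family of projections.\<close>

lemma reflection_off_diagonal:
  fixes X M :: "real^'n^'n"
  assumes "X ** X = X" "M ** X + X ** M = M"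
  shows "(mat 1 - 2 *\<^sub>R X) ** M ** (mat 1 - 2 *\<^sub>R X) = - M"
    and "X ** M ** X = 0"
proof -
  have "X ** M = X ** (M ** X + X ** M)" by (simp only: assms(2))
  also have "\<dots> = X ** M ** X + X ** M" by (simp add: mm.add_right matrix_mul_assoc assms(1))
  finally show *: "X ** M ** X = 0" by simp
  have "(mat 1 - 2 *\<^sub>R X) ** M ** (mat 1 - 2 *\<^sub>R X) = M - 2 *\<^sub>R (M ** X + X ** M)"
    using * by (simp add: mat_distrib mult_assocL algebra_simps)
  then show "(mat 1 - 2 *\<^sub>R X) ** M ** (mat 1 - 2 *\<^sub>R X) = - M" by (simp add: assms scaleR_2)
qed

text \<open>The coordinate expressions of an isometric immersion and of the metric and complex structure
  of a Kaehler manifold.\<close>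

locale kaehler_chart =
  fixes S :: "'e::euclidean_space set" and F :: "'e \<Rightarrow> real^'n" and G :: "'e \<Rightarrow> 'e \<Rightarrow> 'e \<Rightarrow> real"
    and j :: "'e \<Rightarrow> 'e \<Rightarrow> 'e"
  assumes S: "open S" and F: "smooth_on S F" and G: "riem_metric_on S G"
    and GF: "\<And>x u v. x \<in> S \<Longrightarrow> G x u v = FD F x u \<bullet> FD F x v"
    and jlin: "\<And>x. x \<in> S \<Longrightarrow> linear (j x)" and jsm: "\<And>u. smooth_on S (\<lambda>x. j x u)"
    and jj: "\<And>x u. x \<in> S \<Longrightarrow> j x (j x u) = - u"
    and jG: "\<And>x u v. x \<in> S \<Longrightarrow> G x (j x u) (j x v) = G x u v"
    and jpar: "\<And>x u v. x \<in> S \<Longrightarrow> FD (\<lambda>y. j y v) x u + christoffel G x u (j x v) - j x (christoffel G x u v) = 0"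
begin

lemma Fdiff: "x \<in> S \<Longrightarrow> F differentiable (at x)"
  using smooth_on_differentiable[OF F] .

lemma Dlin: "x \<in> S \<Longrightarrow> linear (FD F x)"
  using linear_FD[OF Fdiff] .

lemma Dsm: "smooth_on S (\<lambda>x. FD F x u)"
  by (rule smooth_on_FD[OF F])

lemma Gbil: "x \<in> S \<Longrightarrow> bilinear (G x)" and Gsym: "x \<in> S \<Longrightarrow> G x u v = G x v u"
  and Gpos: "x \<in> S \<Longrightarrow> u \<noteq> 0 \<Longrightarrow> G x u u > 0" and Gsm: "smooth_on S (\<lambda>x. G x u v)"
  using G unfolding riem_metric_on_def by blast+

text \<open>The coordinate vector of the tangential component.\<close>

definition coord :: "'e \<Rightarrow> real^'n \<Rightarrow> 'e" where
  "coord x y = (THE u. \<forall>v. G x u v = y \<bullet> FD F x v)"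

lemma coord_ex1: "x \<in> S \<Longrightarrow> \<exists>!u. \<forall>v. G x u v = y \<bullet> FD F x v"
proof -
  assume x: "x \<in> S"
  have "linear (\<lambda>v. y \<bullet> FD F x v)"
    using linear_compose[OF Dlin[OF x] bounded_linear.linear[OF bounded_linear_inner_right]] by (simp add: o_def)
  from riesz_on_subspace[OF Gbil[OF x] Gsym[OF x] Gpos[OF x] subspace_UNIV this]
  show ?thesis by simp
qed

lemma coord: "x \<in> S \<Longrightarrow> G x (coord x y) v = y \<bullet> FD F x v"
  using theI'[OF coord_ex1] unfolding coord_def by blast

lemma coord_eq: "x \<in> S \<Longrightarrow> (\<And>v. u \<bullet> FD F x v = FD F x w \<bullet> FD F x v) \<Longrightarrow> coord x u = w"
  unfolding coord_def using coord_ex1[of x u] GF by (intro the1_equality) auto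

lemma inner_D_coord: "x \<in> S \<Longrightarrow> FD F x (coord x y) \<bullet> FD F x v = y \<bullet> FD F x v"
  using coord GF by metis

lemma coord_D: "x \<in> S \<Longrightarrow> coord x (FD F x u) = u"
  by (rule coord_eq) auto

lemma coord_normal: "x \<in> S \<Longrightarrow> (\<And>v. y \<bullet> FD F x v = 0) \<Longrightarrow> coord x y = 0"
  by (rule coord_eq) (auto simp: linear_0[OF Dlin])

lemma coord_linear: "x \<in> S \<Longrightarrow> linear (coord x)"
  by (rule linearI; rule coord_eq)
     (auto simp: linear_add[OF Dlin] linear_scale[OF Dlin] inner_add_left inner_D_coord)

lemma coord_smooth: "smooth_on S (\<lambda>x. coord x y)"
proof -
  have "\<exists>R. smooth_on S R \<and> (\<forall>x\<in>S. R x \<in> span Basis \<and> (\<forall>b\<in>Basis. G x (R x) b = y \<bullet> FD F x b))"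
    by (rule smooth_riesz[where l = "\<lambda>x b. y \<bullet> FD F x b", OF S Gbil Gsym Gpos Gsm])
       (auto simp: independent_Basis intro!: smooth_on_inner S smooth_on_const Dsm)
  then obtain R where R: "smooth_on S R" "\<And>x b. x \<in> S \<Longrightarrow> b \<in> Basis \<Longrightarrow> G x (R x) b = y \<bullet> FD F x b"
    by blast
  have "R x = coord x y" if x: "x \<in> S" for x
  proof -
    have "linear (G x (R x))" using Gbil[OF x] by (simp add: bilinear_def)
    moreover have "linear (\<lambda>v. y \<bullet> FD F x v)"
      using linear_compose[OF Dlin[OF x] bounded_linear.linear[OF bounded_linear_inner_right]] by (simp add: o_def)
    ultimately have "G x (R x) v = y \<bullet> FD F x v" for v
      using linear_eq_stdbasis[of "G x (R x)" "\<lambda>v. y \<bullet> FD F x v"] R(2)[OF x] by metis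
    then show ?thesis using coord_ex1[OF x, of y] coord[OF x] by blast
  qed
  then show ?thesis using smooth_on_cong[OF S _ R(1)] by simp
qed

text \<open>The Levi-Civita connection of the induced metric is the tangential part of the derivative in
  Euclidean space.\<close>

lemma christoffel_eq: "x \<in> S \<Longrightarrow> christoffel G x u v = coord x (FD2 F x u v)"
proof -
  assume x: "x \<in> S"
  have 1: "FD (\<lambda>y. G y v z) x u = FD F x v \<bullet> FD2 F x u z + FD2 F x u v \<bullet> FD F x z" for u v z
  proof -
    have "FD (\<lambda>y. G y v z) x u = FD (\<lambda>y. FD F y v \<bullet> FD F y z) x u"
      by (rule fun_cong[OF FD_cong[OF S x GF]])
    then show ?thesis
      using FD_bilinear[OF bounded_bilinear_inner smooth_on_differentiable[OF Dsm x] smooth_on_differentiable[OF Dsm x]]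
      by (simp add: FD2_def)
  qed
  have "koszul G x u v z = FD2 F x u v \<bullet> FD F x z" for z
    unfolding koszul_def 1
    using FD2_commute[OF S x F, of u v] FD2_commute[OF S x F, of u z] FD2_commute[OF S x F, of v z]
    by (simp add: inner_commute)
  then show ?thesis unfolding christoffel_def coord_def by simp
qed

text \<open>The tangential projection, and the complex structure of the tangent space extended by 0.\<close>

definition X :: "'e \<Rightarrow> real^'n^'n" where "X x = matrix (\<lambda>y. FD F x (coord x y))"

definition K :: "'e \<Rightarrow> real^'n^'n" where "K x = matrix (\<lambda>y. FD F x (j x (coord x y)))"

lemma X_apply: "x \<in> S \<Longrightarrow> X x *v y = FD F x (coord x y)"
  unfolding X_def using matrix_vector_mul(2)[OF linear_compose[OF coord_linear Dlin]] by (simp add: o_def fun_eq_iff)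

lemma K_apply: "x \<in> S \<Longrightarrow> K x *v y = FD F x (j x (coord x y))"
  unfolding K_def using matrix_vector_mul(2)[OF linear_compose[OF linear_compose[OF coord_linear jlin] Dlin]]
  by (simp add: o_def fun_eq_iff)

lemma X_D: "x \<in> S \<Longrightarrow> X x *v FD F x v = FD F x v"
  by (simp add: X_apply coord_D)

lemma K_D: "x \<in> S \<Longrightarrow> K x *v FD F x v = FD F x (j x v)"
  by (simp add: K_apply coord_D)

lemma X_normal: "x \<in> S \<Longrightarrow> (\<And>v. y \<bullet> FD F x v = 0) \<Longrightarrow> X x *v y = 0"
  by (simp add: X_apply coord_normal linear_0[OF Dlin])

lemma XK_structure: 
  assumes x: "x \<in> S"
  shows "plane_structure (X x) (K x)"
  unfolding plane_structure_def
proof (intro conjI)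
  have "(X x *v y) \<bullet> z = G x (coord x z) (coord x y)" for y z
    using coord[OF x] X_apply[OF x] by (metis inner_commute)
  then have "(X x *v y) \<bullet> z = (transpose (X x) *v y) \<bullet> z" for y z
    using Gsym[OF x] transpose_vector_inner[of "X x" z y] by (metis inner_commute)
  then show "transpose (X x) = X x" by (metis matrix_eq_inner)
  have K1: "(K x *v y) \<bullet> z = G x (coord x z) (j x (coord x y))" for y z
    using coord[OF x] K_apply[OF x] by (metis inner_commute)
  have K2: "(K x *v y) \<bullet> z = - ((K x *v z) \<bullet> y)" for y z
  proof -
    have "G x (coord x z) (j x (coord x y)) = G x (j x (coord x z)) (j x (j x (coord x y)))"
      using jG[OF x] by simp
    also have "\<dots> = - G x (coord x y) (j x (coord x z))"
      unfolding jj[OF x] using bilinear_rneg[OF Gbil[OF x]] Gsym[OF x] by metis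
    finally show ?thesis unfolding K1 .
  qed
  have "(transpose (K x) *v y) \<bullet> z = ((- K x) *v y) \<bullet> z" for y z
  proof -
    have "(transpose (K x) *v y) \<bullet> z = (K x *v z) \<bullet> y"
      unfolding transpose_vector_inner[of "K x" z y] by (rule inner_commute)
    then show ?thesis using K2[of z y] by (simp only: mv.minus_left inner_minus_left)
  qed
  then show "transpose (K x) = - K x" by (rule matrix_eq_inner)
  show "X x ** X x = X x" "K x ** K x = - X x" "X x ** K x = K x" "K x ** X x = K x"
    unfolding matrix_eq matrix_vector_mul_assoc[symmetric]
    by (auto simp: X_apply[OF x] K_apply[OF x] coord_D[OF x] jj[OF x] mv.minus_left linear_neg[OF Dlin[OF x]])
qed

lemma smooth_matrix:
  assumes "\<And>x. x \<in> S \<Longrightarrow> linear (L x)" "\<And>y. smooth_on S (\<lambda>x. L x y)"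
  shows "smooth_on S (\<lambda>x. matrix (L x) :: real^'n^'n)"
  unfolding matrix_def
  by (intro smooth_on_vec S smooth_on_linear[OF bounded_linear_vec_nth] assms)

lemma smooth_X: "smooth_on S X" and smooth_K: "smooth_on S K"
proof -
  have 1: "smooth_on S (\<lambda>x. FD F x (w x))" if "smooth_on S w" for w
    by (rule smooth_on_linear_family[OF S Dlin Dsm that])
  have 2: "smooth_on S (\<lambda>x. j x (w x))" if "smooth_on S w" for w
    by (rule smooth_on_linear_family[OF S jlin jsm that])
  have "linear (\<lambda>y. FD F x (coord x y))" "linear (\<lambda>y. FD F x (j x (coord x y)))" if "x \<in> S" for x
    using linear_compose[OF coord_linear Dlin] linear_compose[OF linear_compose[OF coord_linear jlin] Dlin] that
    by (simp_all add: o_def)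
  then show "smooth_on S X" "smooth_on S K"
    unfolding X_def[abs_def] K_def[abs_def] by (intro smooth_matrix 1 2 coord_smooth; simp)+
qed

lemma Xdiff: "x \<in> S \<Longrightarrow> X differentiable (at x)" and Kdiff: "x \<in> S \<Longrightarrow> K differentiable (at x)"
  using smooth_on_differentiable[OF smooth_X] smooth_on_differentiable[OF smooth_K] by auto

lemma normal_part_X: "x \<in> S \<Longrightarrow> normal_part F x y = y - X x *v y"
  by (rule normal_part_eq[OF Dlin, of _ _ _ "coord x y"]) (auto simp: X_apply inner_diff_left inner_D_coord)

text \<open>The second fundamental form, as the derivative of the tangential projection.  This expression
  shows at once that it depends smoothly on the point, and its derivative involves the second
  derivative of \<open>X\<close>.\<close>

definition \<alpha> :: "'e \<Rightarrow> 'e \<Rightarrow> 'e \<Rightarrow> real^'n" where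
  "\<alpha> x u v = FD X x u *v FD F x v"

lemma \<alpha>_eq: "x \<in> S \<Longrightarrow> \<alpha> x u v = FD2 F x u v - X x *v FD2 F x u v"
proof -
  assume x: "x \<in> S"
  have "FD (\<lambda>y. X y *v FD F y v) x u = FD (\<lambda>y. FD F y v) x u"
    by (rule fun_cong[OF FD_cong[OF S x X_D]])
  then show ?thesis
    using FD_bilinear[OF bounded_bilinear_matrix_vector_mult Xdiff[OF x] smooth_on_differentiable[OF Dsm x]]
    by (simp add: \<alpha>_def FD2_def algebra_simps)
qed

lemma FD2_split: "x \<in> S \<Longrightarrow> FD2 F x u v = \<alpha> x u v + FD F x (christoffel G x u v)"
  by (simp add: \<alpha>_eq christoffel_eq X_apply)

lemma \<alpha>_sym: "x \<in> S \<Longrightarrow> \<alpha> x u v = \<alpha> x v u"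
  using \<alpha>_eq FD2_commute[OF S _ F] by metis

lemma christoffel_sym: "x \<in> S \<Longrightarrow> christoffel G x u v = christoffel G x v u"
  using christoffel_eq FD2_commute[OF S _ F] by metis

lemma \<alpha>_linear: "x \<in> S \<Longrightarrow> linear (\<alpha> x u)" "x \<in> S \<Longrightarrow> linear (\<lambda>u. \<alpha> x u v)"
proof -
  assume x: "x \<in> S"
  show *: "linear (\<alpha> x u)" for u
    unfolding \<alpha>_def by (rule linearI) (auto simp: linear_add[OF Dlin[OF x]] linear_scale[OF Dlin[OF x]] mv.add_right mv.scaleR_right)
  have "(\<lambda>u. \<alpha> x u v) = \<alpha> x v" by (rule ext, rule \<alpha>_sym[OF x])
  then show "linear (\<lambda>u. \<alpha> x u v)" using * by simp
qed

lemma \<alpha>_smooth: "smooth_on S (\<lambda>x. \<alpha> x u v)"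
  unfolding \<alpha>_def by (intro smooth_on_bilinear[OF bounded_bilinear_matrix_vector_mult] S smooth_on_FD smooth_X Dsm)

lemma X_\<alpha>: "x \<in> S \<Longrightarrow> X x *v \<alpha> x u v = 0"
  by (simp add: \<alpha>_eq matrix_vector_mul_assoc XK_structure[THEN plane_structureD(3)] mv.diff_right)

lemma christoffel_linear: "x \<in> S \<Longrightarrow> linear (\<lambda>u. christoffel G x u v)"
  using linear_compose[OF linear_FD2[OF S _ F] coord_linear] by (simp add: christoffel_eq o_def)

lemma FD_X: 
  assumes x: "x \<in> S"
  shows "FD X x u ** X x + X x ** FD X x u = FD X x u" "transpose (FD X x u) = FD X x u"
proof -
  have "FD (\<lambda>y. X y ** X y) x u = FD X x u"
    by (rule fun_cong[OF FD_cong[OF S x]]) (use XK_structure plane_structureD(3) in blast)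
  then show "FD X x u ** X x + X x ** FD X x u = FD X x u"
    using FD_bilinear[OF bounded_bilinear_matrix_mult Xdiff[OF x] Xdiff[OF x]] by (simp add: add.commute)
  have "FD (\<lambda>y. transpose (X y)) x u = FD X x u"
    by (rule fun_cong[OF FD_cong[OF S x]]) (use XK_structure plane_structureD(1) in blast)
  then show "transpose (FD X x u) = FD X x u"
    using FD_linear[OF bounded_linear_transpose Xdiff[OF x]] by simp
qed

text \<open>Here the Kaehler condition enters: \<open>j\<close> is parallel, so the tangential terms cancel and the
  derivative of \<open>K\<close> maps tangent vectors to normal ones.\<close>

lemma FD_K_D:
  assumes x: "x \<in> S"
  shows "FD K x u *v FD F x v = \<alpha> x u (j x v)"
proof -
  have jd: "(\<lambda>y. j y v) differentiable (at x)" by (rule smooth_on_differentiable[OF jsm x])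
  have dj: "FD (\<lambda>y. j y v) x u = j x (christoffel G x u v) - christoffel G x u (j x v)"
    using jpar[OF x, of v u] by (simp add: algebra_simps)
  have "FD (\<lambda>y. K y *v FD F y v) x u = FD (\<lambda>y. FD F y (j y v)) x u"
    by (rule fun_cong[OF FD_cong[OF S x K_D]])
  also have "\<dots> = FD2 F x u (j x v) + FD F x (FD (\<lambda>y. j y v) x u)"
    unfolding FD2_def by (rule FD_linear_family[OF S x Dlin smooth_on_differentiable[OF Dsm x] jd])
  also have "\<dots> = \<alpha> x u (j x v) + FD F x (j x (christoffel G x u v))"
    unfolding dj FD2_split[OF x] linear_diff[OF Dlin[OF x]] by simp
  also have "FD F x (j x (christoffel G x u v)) = K x *v FD2 F x u v"
    by (simp add: K_apply[OF x] christoffel_eq[OF x])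
  finally show ?thesis
    using FD_bilinear[OF bounded_bilinear_matrix_vector_mult Kdiff[OF x] smooth_on_differentiable[OF Dsm x]]
    by (simp add: FD2_def)
qed

text \<open>So \<open>\<partial>\<^sub>u K\<close>, like \<open>\<partial>\<^sub>u X\<close>, exchanges the tangent and the normal space.\<close>

lemma FD_K:
  assumes x: "x \<in> S"
  shows "FD K x u ** X x + X x ** FD K x u = FD K x u"
proof -
  note ps = plane_structureD[OF XK_structure[OF x]]
  have d: "FD K x u = FD (\<lambda>y. K y ** X y) x u" "FD K x u = FD (\<lambda>y. X y ** K y) x u"
    by (rule fun_cong[OF FD_cong[OF S x]]; use XK_structure plane_structureD(5,6) in metis)+
  have 1: "FD K x u = K x ** FD X x u + FD K x u ** X x"
    using FD_bilinear[OF bounded_bilinear_matrix_mult Kdiff[OF x] Xdiff[OF x]] d(1) by simp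
  have 2: "FD K x u = X x ** FD K x u + FD X x u ** K x"
    using FD_bilinear[OF bounded_bilinear_matrix_mult Xdiff[OF x] Kdiff[OF x]] d(2) by simp
  have "FD X x u ** K x = FD K x u ** X x"
    unfolding matrix_eq matrix_vector_mul_assoc[symmetric] K_apply[OF x] X_apply[OF x] FD_K_D[OF x] \<alpha>_def by simp
  then show ?thesis using 2 by (simp add: add.commute)
qed

text \<open>The projection onto the image of the complex Gauss map, see \<open>proj_gauss\<close> below.\<close>

definition \<Phi> :: "'e \<Rightarrow> complex^'n^'n" where "\<Phi> x = to_proj (X x) (K x)"

lemma smooth_\<Phi>: "smooth_on S \<Phi>"
proof -
  have "\<Phi> = (\<lambda>x. to_proj (X x) 0 + to_proj 0 (K x))" by (simp add: fun_eq_iff \<Phi>_def to_proj_linear(1)[symmetric])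
  then show ?thesis
    by (auto intro!: smooth_on_add S smooth_on_linear[OF bounded_linear_to_proj1] smooth_on_linear[OF bounded_linear_to_proj2]
      smooth_X smooth_K)
qed

lemma \<Phi>diff: "x \<in> S \<Longrightarrow> \<Phi> differentiable (at x)"
  using smooth_on_differentiable[OF smooth_\<Phi>] .

lemma \<Phi>_parts: "plane_part (\<Phi> x) = X x" "rot_part (\<Phi> x) = K x"
  by (simp_all add: \<Phi>_def)

lemma FD_\<Phi>_parts:
  assumes x: "x \<in> S"
  shows "plane_part (FD \<Phi> x u) = FD X x u" "rot_part (FD \<Phi> x u) = FD K x u"
  using FD_linear[OF bounded_linear_plane_part \<Phi>diff[OF x]] FD_linear[OF bounded_linear_rot_part \<Phi>diff[OF x]]
  by (simp_all add: \<Phi>_parts)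

lemma FD_\<Phi>_tangent: 
  assumes x: "x \<in> S"
  shows "\<exists>A. skew A \<and> FD \<Phi> x u = inf_act A (\<Phi> x)"
  by (rule infinitesimal_rotation_of_family[OF S x _ \<Phi>diff[OF x]]) (simp add: \<Phi>_parts XK_structure)

text \<open>In this form horizontality meets the hypothesis of \<open>metric_horizontal\<close>.\<close>

lemma FD_\<Phi>_reflection:
  assumes x: "x \<in> S"
  shows "orth_act (reflection (\<Phi> x)) (FD \<Phi> x u) = - FD \<Phi> x u"
proof -
  note ps = plane_structureD[OF XK_structure[OF x]]
  have "transpose (reflection (\<Phi> x)) = reflection (\<Phi> x)"
    by (simp add: reflection_def \<Phi>_parts transpose_simps ps)
  then show ?thesis
    unfolding orth_act_parts FD_\<Phi>_parts[OF x]
    using reflection_off_diagonal(1)[OF ps(3) FD_X(1)[OF x]] reflection_off_diagonal(1)[OF ps(3) FD_K[OF x]]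
    by (simp add: reflection_def \<Phi>_parts to_proj_linear(3)) (metis FD_\<Phi>_parts[OF x] to_proj_parts(1))
qed

text \<open>The second covariant derivative of \<open>X\<close> as a matrix valued function on the manifold.  Its part
  tangent to the Grassmannian is the Hessian of the real Gauss map.\<close>

definition hess_X :: "'e \<Rightarrow> 'e \<Rightarrow> 'e \<Rightarrow> real^'n^'n" where
  "hess_X x u v = FD2 X x u v - FD X x (christoffel G x u v)"

lemma hess_X_sym: "x \<in> S \<Longrightarrow> hess_X x u v = hess_X x v u"
  unfolding hess_X_def using FD2_commute[OF S _ smooth_X] christoffel_sym by metis

lemma hess_X_linear: "x \<in> S \<Longrightarrow> linear (\<lambda>u. hess_X x u v)"
  unfolding hess_X_def
  using linear_FD2[OF S _ smooth_X] linear_compose[OF christoffel_linear linear_FD[OF Xdiff]]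
  by (auto simp: o_def intro!: linear_compose_sub)

lemma hess_X_transpose: 
  assumes x: "x \<in> S"
  shows "transpose (hess_X x u v) = hess_X x u v"
proof -
  have "FD (\<lambda>y. transpose (FD X y v)) x u = FD (\<lambda>y. FD X y v) x u"
    by (rule fun_cong[OF FD_cong[OF S x FD_X(2)]])
  then show ?thesis
    using FD_linear[OF bounded_linear_transpose smooth_on_differentiable[OF smooth_on_FD[OF smooth_X] x]]
    by (simp add: hess_X_def FD2_def transpose_diff FD_X(2)[OF x])
qed

text \<open>The normal part of the preceding matrix on tangent vectors is the covariant derivative
  \<open>(\<nabla>\<^sub>u \<alpha>)(v, w)\<close> of the second fundamental form.\<close>

definition nabla_\<alpha> :: "'e \<Rightarrow> 'e \<Rightarrow> 'e \<Rightarrow> 'e \<Rightarrow> real^'n" where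
  "nabla_\<alpha> x u v w = hess_X x u v *v FD F x w - X x *v (hess_X x u v *v FD F x w)"

lemma nabla_\<alpha>_eq:
  assumes x: "x \<in> S"
  shows "nabla_\<alpha> x u v w = FD (\<lambda>y. \<alpha> y v w) x u - X x *v FD (\<lambda>y. \<alpha> y v w) x u
    - \<alpha> x v (christoffel G x u w) - \<alpha> x (christoffel G x u v) w"
proof -
  note ps = plane_structureD[OF XK_structure[OF x]]
  define n where "n y = y - X x *v y" for y
  have n_add: "n (y + z) = n y + n z" "n (y - z) = n y - n z" for y z by (simp_all add: n_def algebra_simps mv.add_right mv.diff_right)
  have n_\<alpha>: "n (\<alpha> x u v) = \<alpha> x u v" for u v by (simp add: n_def X_\<alpha>[OF x])
  have "FD X x v *v \<alpha> x u w = X x *v (FD X x v *v \<alpha> x u w)"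
    using arg_cong[OF FD_X(1)[OF x, of v], of "\<lambda>M. M *v \<alpha> x u w"]
    by (simp add: mv.add_left matrix_vector_mul_assoc[symmetric] X_\<alpha>[OF x])
  then have n1: "n (FD X x v *v \<alpha> x u w) = 0" by (simp add: n_def)
  have "FD (\<lambda>y. \<alpha> y v w) x u = FD X x v *v FD2 F x u w + FD2 X x u v *v FD F x w"
    unfolding \<alpha>_def FD2_def
    by (rule FD_bilinear[OF bounded_bilinear_matrix_vector_mult smooth_on_differentiable[OF smooth_on_FD[OF smooth_X] x] smooth_on_differentiable[OF Dsm x]])
  then have "FD2 X x u v *v FD F x w = FD (\<lambda>y. \<alpha> y v w) x u - (FD X x v *v \<alpha> x u w + \<alpha> x v (christoffel G x u w))"
    by (simp add: FD2_split[OF x] mv.add_right \<alpha>_def)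
  then have "hess_X x u v *v FD F x w = FD (\<lambda>y. \<alpha> y v w) x u - (FD X x v *v \<alpha> x u w + \<alpha> x v (christoffel G x u w)) - \<alpha> x (christoffel G x u v) w"
    by (simp add: hess_X_def mv.diff_left \<alpha>_def)
  then have "n (hess_X x u v *v FD F x w) = n (FD (\<lambda>y. \<alpha> y v w) x u) - \<alpha> x v (christoffel G x u w) - \<alpha> x (christoffel G x u v) w"
    by (simp add: n_add n_\<alpha> n1)
  then show ?thesis unfolding nabla_\<alpha>_def n_def .
qed

text \<open>The first symmetry is that of second derivatives of \<open>X\<close>, the other one that of \<open>\<alpha>\<close>.\<close>

lemma codazzi: "x \<in> S \<Longrightarrow> nabla_\<alpha> x u v w = nabla_\<alpha> x v u w" "x \<in> S \<Longrightarrow> nabla_\<alpha> x u v w = nabla_\<alpha> x u w v"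
proof -
  assume x: "x \<in> S"
  show "nabla_\<alpha> x u v w = nabla_\<alpha> x v u w" unfolding nabla_\<alpha>_def hess_X_sym[OF x, of u v] ..
  have "FD (\<lambda>y. \<alpha> y v w) x u = FD (\<lambda>y. \<alpha> y w v) x u"
    by (rule fun_cong[OF FD_cong[OF S x \<alpha>_sym]])
  then show "nabla_\<alpha> x u v w = nabla_\<alpha> x u w v"
    unfolding nabla_\<alpha>_eq[OF x] using \<alpha>_sym[OF x] by simp
qed

definition pmc :: "'e \<Rightarrow> 'e \<Rightarrow> 'e \<Rightarrow> real^'n" where
  "pmc x u v = (1/2) *\<^sub>R (\<alpha> x u v + \<alpha> x (j x u) (j x v))"

text \<open>As \<open>j\<close> is parallel, the covariant derivative passes through both entries \<open>j v\<close>, \<open>j w\<close>.\<close>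

lemma nabla_pmc:
  assumes x: "x \<in> S"
  shows "normal_part F x (FD (\<lambda>y. pmc y v w) x u) - pmc x (christoffel G x u v) w - pmc x v (christoffel G x u w)
    = (1/2) *\<^sub>R (nabla_\<alpha> x u v w + nabla_\<alpha> x u (j x v) (j x w))"
proof -
  define n where "n y = y - X x *v y" for y
  have n_add: "n (y + z) = n y + n z" "n (y - z) = n y - n z" "n (r *\<^sub>R y) = r *\<^sub>R n y" for y z r
    by (simp_all add: n_def algebra_simps mv.add_right mv.diff_right mv.scaleR_right)
  have n_\<alpha>: "n (\<alpha> x u v) = \<alpha> x u v" for u v by (simp add: n_def X_\<alpha>[OF x])
  have jd: "(\<lambda>y. j y v) differentiable (at x)" for v by (rule smooth_on_differentiable[OF jsm x])
  have dj: "FD (\<lambda>y. j y v) x u = j x (christoffel G x u v) - christoffel G x u (j x v)" for v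
    using jpar[OF x, of v u] by (simp add: algebra_simps)
  have ad: "(\<lambda>y. \<alpha> y v w) differentiable (at x)" for v w by (rule smooth_on_differentiable[OF \<alpha>_smooth x])
  have sm1: "smooth_on S (\<lambda>y. \<alpha> y (j y v) w)" for v w
    by (rule smooth_on_linear_family[OF S \<alpha>_linear(2) \<alpha>_smooth jsm])
  have 1: "FD (\<lambda>y. \<alpha> y (j y v) c) x u = FD (\<lambda>y. \<alpha> y (j x v) c) x u + \<alpha> x (FD (\<lambda>y. j y v) x u) c" for c
    by (rule FD_linear_family[where L = "\<lambda>y z. \<alpha> y z c", OF S x \<alpha>_linear(2) ad jd])
  have 2: "FD (\<lambda>y. \<alpha> y (j y v) (j y w)) x u = FD (\<lambda>y. \<alpha> y (j y v) (j x w)) x u + \<alpha> x (j x v) (FD (\<lambda>y. j y w) x u)"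
    by (rule FD_linear_family[where L = "\<lambda>y z. \<alpha> y (j y v) z", OF S x \<alpha>_linear(1) smooth_on_differentiable[OF sm1 x] jd])
  have sm2: "smooth_on S (\<lambda>y. \<alpha> y (j y v) (j y w))"
    by (rule smooth_on_linear_family[OF S \<alpha>_linear(1) sm1 jsm])
  have "FD (\<lambda>y. pmc y v w) x u = (1/2) *\<^sub>R (FD (\<lambda>y. \<alpha> y v w) x u + FD (\<lambda>y. \<alpha> y (j y v) (j y w)) x u)"
    unfolding pmc_def
    using FD_linear[OF bounded_linear_scaleR_right smooth_on_differentiable[OF smooth_on_add[OF S \<alpha>_smooth sm2] x]]
      FD_add[OF ad smooth_on_differentiable[OF sm2 x]] by simp
  then show ?thesis
    unfolding normal_part_X[OF x] n_def[symmetric] nabla_\<alpha>_eq[OF x] pmc_def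
    by (simp add: 1 2 dj n_add n_\<alpha> linear_diff[OF \<alpha>_linear(1)[OF x]] linear_diff[OF \<alpha>_linear(2)[OF x]])
       (simp add: algebra_simps)
qed

text \<open>By the Codazzi equations the (1,1)-part of \<open>\<nabla>\<alpha>\<close> in its first two arguments is the derivative of
  the (1,1)-part of \<open>\<alpha>\<close>.\<close>

lemma parallel_pmc_iff:
  assumes x: "x \<in> S"
  shows "(\<forall>u v w. normal_part F x (FD (\<lambda>y. pmc y v w) x u) - pmc x (christoffel G x u v) w - pmc x v (christoffel G x u w) = 0)
    \<longleftrightarrow> (\<forall>u v A. skew A \<longrightarrow> (hess_X x u v + hess_X x (j x u) (j x v)) \<bullet> bracket A (X x) = 0)"
proof -
  note ps = plane_structureD[OF XK_structure[OF x]]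
  have 1: "(\<forall>A. skew A \<longrightarrow> M \<bullet> bracket A (X x) = 0) \<longleftrightarrow> (\<forall>w. M *v FD F x w = X x *v (M *v FD F x w))"
    if M: "transpose M = M" for M
  proof -
    have "M ** X x = X x ** M" if *: "\<And>w. M *v FD F x w = X x *v (M *v FD F x w)"
    proof -
      have XM: "M ** X x = X x ** (M ** X x)"
        unfolding matrix_eq matrix_vector_mul_assoc[symmetric] X_apply[OF x, of _] using *[unfolded X_apply[OF x]] by (simp add: X_apply[OF x] coord_D[OF x])
      have "X x ** M = X x ** (M ** X x)"
        using arg_cong[OF XM, of transpose] by (simp only: matrix_transpose_mul M ps mult_assocL)
      with XM show ?thesis by simp
    qed
    moreover have "M *v FD F x w = X x *v (M *v FD F x w)" if "M ** X x = X x ** M" for w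
      using arg_cong[OF that, of "\<lambda>A. A *v FD F x w"] by (simp add: matrix_vector_mul_assoc[symmetric] X_D[OF x])
    ultimately show ?thesis unfolding commutes_iff_inner_bracket[OF M ps(1)] by blast
  qed
  have NN: "(hess_X x u v + hess_X x (j x u) (j x v)) *v FD F x w - X x *v ((hess_X x u v + hess_X x (j x u) (j x v)) *v FD F x w)
     = nabla_\<alpha> x w u v + nabla_\<alpha> x w (j x u) (j x v)" for u v w
  proof -
    have "nabla_\<alpha> x w u v = nabla_\<alpha> x u v w" for u v
      using codazzi(1)[OF x, of w u v] codazzi(2)[OF x, of u w v] by simp
    then show ?thesis by (simp add: nabla_\<alpha>_def mv.add_left mv.add_right)
  qed
  have "(\<forall>A. skew A \<longrightarrow> (hess_X x u v + hess_X x (j x u) (j x v)) \<bullet> bracket A (X x) = 0) \<longleftrightarrow>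
     (\<forall>w. nabla_\<alpha> x w u v + nabla_\<alpha> x w (j x u) (j x v) = 0)" for u v
    unfolding NN[symmetric] by (subst 1) (simp_all add: transpose_add hess_X_transpose[OF x])
  then show ?thesis unfolding nabla_pmc[OF x] by auto
qed

end

section \<open>The Hessian of the Gauss map\<close>

lemma bounded_linear_inf_act: "bounded_linear (inf_act A)"
  using linear_inf_act linear_conv_bounded_linear by blast

lemma bounded_linear_bracket: "bounded_linear (bracket A)"
  unfolding linear_conv_bounded_linear[symmetric] by (rule linearI) (simp_all add: bracket_linear_right)

lemma linear_koszul:
  fixes h :: "'v::euclidean_space \<Rightarrow> 'v \<Rightarrow> 'v \<Rightarrow> real"
  assumes h: "riem_metric_on UNIV h"
  shows "linear (koszul h P a b)"
proof -
  have bil: "bilinear (h Q)" for Q using h by (simp add: riem_metric_on_def)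
  have dh: "(\<lambda>Q. h Q v w) differentiable (at Q)" for v w Q
    using h smooth_on_differentiable by (fastforce simp: riem_metric_on_def)
  have "linear (\<lambda>Y. FD (\<lambda>Q. h Q b Y) P a)" for a b
  proof (rule linearI)
    fix Y Z show "FD (\<lambda>Q. h Q b (Y + Z)) P a = FD (\<lambda>Q. h Q b Y) P a + FD (\<lambda>Q. h Q b Z) P a"
      unfolding bilinear_radd[OF bil] by (rule FD_add[OF dh dh])
  next
    fix r Y show "FD (\<lambda>Q. h Q b (r *\<^sub>R Y)) P a = r *\<^sub>R FD (\<lambda>Q. h Q b Y) P a"
      unfolding bilinear_rmul[OF bil] by (rule FD_linear[OF bounded_linear_scaleR_right dh])
  qed
  note 1 = linear_add[OF this] linear_scale[OF this]
  note 2 = linear_add[OF linear_FD[OF dh]] linear_scale[OF linear_FD[OF dh]]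
  show ?thesis
    by (rule linearI) (simp_all add: koszul_def 1 2 algebra_simps add_divide_distrib diff_divide_distrib)
qed

context kaehler_chart
begin

text \<open>Paired with the Killing field of \<open>A\<close>, the Hessian is the symmetrized derivative of the
  one-form \<open>v \<mapsto> h (d\<Phi> v) [A, \<Phi>]\<close>.  As \<open>\<Phi>\<close> is horizontal, this one-form can be computed in the
  Grassmannian.  The terms of the Koszul formula combine with the derivatives of the factors
  \<open>d\<Phi> v\<close> and \<open>[A, \<Phi>]\<close> to the Lie derivative of \<open>h\<close>, which is 0.\<close>

lemma hessian_pairing:
  assumes h: "riem_metric_on UNIV h" "orth_invariant (proj ` Z1 m) h"
    and k: "\<And>P V W. P \<in> proj ` Z1 m \<Longrightarrow> V \<in> tangent_at (proj ` Z1 m) P \<Longrightarrow> W \<in> tangent_at (proj ` Z1 m) P \<Longrightarrow>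
      orth_act (reflection P) V = - V \<Longrightarrow> h P V W = k * (plane_part V \<bullet> plane_part W)"
    and Z: "\<And>y. y \<in> S \<Longrightarrow> \<Phi> y \<in> proj ` Z1 m"
    and x: "x \<in> S" and A: "skew A"
  shows "h (\<Phi> x) (FD2 \<Phi> x u v - FD \<Phi> x (christoffel G x u v)) (inf_act A (\<Phi> x))
      + koszul h (\<Phi> x) (FD \<Phi> x u) (FD \<Phi> x v) (inf_act A (\<Phi> x)) = k * (hess_X x u v \<bullet> bracket A (X x))"
proof -
  have bil: "bilinear (h Q)" and hsym: "h Q V W = h Q W V" for Q V W using h(1) by (auto simp: riem_metric_on_def)
  have tan: "FD \<Phi> y v \<in> tangent_at (proj ` Z1 m) (\<Phi> y)" if "y \<in> S" for y v
    unfolding tangent_at_Z[OF Z[OF that]] using FD_\<Phi>_tangent[OF that] by blast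
  \<comment> \<open>the one-form, computed in the Grassmannian\<close>
  have form: "h (\<Phi> y) (FD \<Phi> y v) (inf_act A (\<Phi> y)) = k * (FD X y v \<bullet> bracket A (X y))" if y: "y \<in> S" for y v
  proof -
    have "inf_act A (\<Phi> y) \<in> tangent_at (proj ` Z1 m) (\<Phi> y)"
      unfolding tangent_at_Z[OF Z[OF y]] using A by blast
    from k[OF Z[OF y] tan[OF y] this FD_\<Phi>_reflection[OF y]]
    show ?thesis by (simp add: FD_\<Phi>_parts[OF y] inf_act_def \<Phi>_parts)
  qed
  define Y where "Y = inf_act A (\<Phi> x)"
  have d1: "(\<lambda>y. FD \<Phi> y v) differentiable (at x)" for v
    using smooth_on_differentiable[OF smooth_on_FD[OF smooth_\<Phi>] x] .
  have d2: "(\<lambda>y. inf_act A (\<Phi> y)) differentiable (at x)"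
    using bounded_linear.has_derivative[OF bounded_linear_inf_act FD_works[OF \<Phi>diff[OF x]]] by (auto simp: differentiable_def)
  have d3: "(\<lambda>y. bracket A (X y)) differentiable (at x)"
    using bounded_linear.has_derivative[OF bounded_linear_bracket FD_works[OF Xdiff[OF x]]] by (auto simp: differentiable_def)
  have d4: "(\<lambda>y. FD X y v) differentiable (at x)" for v
    using smooth_on_differentiable[OF smooth_on_FD[OF smooth_X] x] .
  have deriv: "FD (\<lambda>Q. h Q (FD \<Phi> x v) Y) (\<Phi> x) (FD \<Phi> x u) + h (\<Phi> x) (FD2 \<Phi> x u v) Y + h (\<Phi> x) (FD \<Phi> x v) (inf_act A (FD \<Phi> x u))
     = k * (FD X x v \<bullet> bracket A (FD X x u) + FD2 X x u v \<bullet> bracket A (X x))" for u v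
  proof -
    have "FD (\<lambda>y. h (\<Phi> y) (FD \<Phi> y v) (inf_act A (\<Phi> y))) x u = FD (\<lambda>y. k * (FD X y v \<bullet> bracket A (X y))) x u"
      by (rule fun_cong[OF FD_cong[OF S x form]])
    moreover have "FD (\<lambda>y. k * (FD X y v \<bullet> bracket A (X y))) x u = k * (FD X x v \<bullet> bracket A (FD X x u) + FD2 X x u v \<bullet> bracket A (X x))"
      using FD_linear[OF bounded_linear_mult_right differentiable_bilinear[OF bounded_bilinear_inner d4 d3]]
        FD_bilinear[OF bounded_bilinear_inner d4 d3] FD_linear[OF bounded_linear_bracket Xdiff[OF x]]
      by (simp add: FD2_def)
    ultimately show ?thesis
      using metric_along_map[OF h(1) \<Phi>diff[OF x] d1 d2] FD_linear[OF bounded_linear_inf_act \<Phi>diff[OF x]]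
      by (simp add: FD2_def Y_def)
  qed
  have kill: "FD (\<lambda>Q. h Q (FD \<Phi> x u) (FD \<Phi> x v)) (\<Phi> x) Y + h (\<Phi> x) (FD \<Phi> x v) (inf_act A (FD \<Phi> x u))
     + h (\<Phi> x) (FD \<Phi> x u) (inf_act A (FD \<Phi> x v)) = 0"
    using inf_act_Killing[OF h Z[OF x] A tan[OF x] tan[OF x], of u v]
    unfolding Y_def hsym[of "\<Phi> x" "inf_act A (FD \<Phi> x u)"] .
  \<comment> \<open>the symmetrization also removes the term in which \<open>[A, X]\<close> is differentiated\<close>
  have anti: "FD X x v \<bullet> bracket A (FD X x u) + FD X x u \<bullet> bracket A (FD X x v) = 0"
    by (rule inner_bracket_antisym[OF A])
  have sym: "FD2 \<Phi> x v u = FD2 \<Phi> x u v" "FD2 X x v u = FD2 X x u v"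
    using FD2_commute[OF S x smooth_\<Phi>] FD2_commute[OF S x smooth_X] by auto
  have "2 * (h (\<Phi> x) (FD2 \<Phi> x u v) Y + koszul h (\<Phi> x) (FD \<Phi> x u) (FD \<Phi> x v) Y)
     = k * (FD X x v \<bullet> bracket A (FD X x u) + FD X x u \<bullet> bracket A (FD X x v)) + 2 * (k * (FD2 X x u v \<bullet> bracket A (X x)))"
    unfolding koszul_def using deriv[of v u] deriv[of u v] kill unfolding sym
    by (simp add: field_simps)
  then have "h (\<Phi> x) (FD2 \<Phi> x u v) Y + koszul h (\<Phi> x) (FD \<Phi> x u) (FD \<Phi> x v) Y = k * (FD2 X x u v \<bullet> bracket A (X x))"
    unfolding anti by simp
  moreover have "h (\<Phi> x) (FD2 \<Phi> x u v - FD \<Phi> x (christoffel G x u v)) Y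
     = h (\<Phi> x) (FD2 \<Phi> x u v) Y - k * (FD X x (christoffel G x u v) \<bullet> bracket A (X x))"
    unfolding bilinear_lsub[OF bil] using form[OF x] by (simp add: Y_def)
  ultimately show ?thesis
    unfolding Y_def[symmetric] by (simp add: hess_X_def inner_diff_left algebra_simps)
qed

text \<open>Vectors of type (1,0) and (0,1) have the form \<open>u - i j u\<close> and \<open>v + i j v\<close>; on such a pair the
  real part of the complexified Hessian is \<open>H u v + H (j u) (j v)\<close>, and the imaginary part is the
  same expression for \<open>u\<close> and \<open>j v\<close>.\<close>

lemma pluriharmonic_at_iff:
  assumes h: "riem_metric_on UNIV h" "orth_invariant (proj ` Z1 m) h"
    and k: "\<And>P V W. P \<in> proj ` Z1 m \<Longrightarrow> V \<in> tangent_at (proj ` Z1 m) P \<Longrightarrow> W \<in> tangent_at (proj ` Z1 m) P \<Longrightarrow>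
      orth_act (reflection P) V = - V \<Longrightarrow> h P V W = k * (plane_part V \<bullet> plane_part W)" and k0: "k > 0"
    and Z: "\<And>y. y \<in> S \<Longrightarrow> \<Phi> y \<in> proj ` Z1 m"
    and x: "x \<in> S"
    and H: "\<And>u v. H u v = (THE W. W \<in> tangent_at (proj ` Z1 m) (\<Phi> x) \<and> (\<forall>Y\<in>tangent_at (proj ` Z1 m) (\<Phi> x). h (\<Phi> x) W Y =
       h (\<Phi> x) (FD2 \<Phi> x u v - FD \<Phi> x (christoffel G x u v)) Y + koszul h (\<Phi> x) (FD \<Phi> x u) (FD \<Phi> x v) Y))"
  shows "(\<forall>V\<in>T10 (j x). \<forall>W\<in>T01 (j x). complexified H V W = 0) \<longleftrightarrow>
    (\<forall>u v A. skew A \<longrightarrow> (hess_X x u v + hess_X x (j x u) (j x v)) \<bullet> bracket A (X x) = 0)"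
proof -
  define T where "T = tangent_at (proj ` Z1 m) (\<Phi> x)"
  have T: "T = {inf_act A (\<Phi> x) |A. skew A}" unfolding T_def by (rule tangent_at_Z[OF Z[OF x]])
  have subT: "subspace T" unfolding T_def by (rule subspace_tangent_at_Z[OF Z[OF x]])
  have bil: "bilinear (h (\<Phi> x))" and hsym: "\<And>V W. h (\<Phi> x) V W = h (\<Phi> x) W V" 
    and hpos: "\<And>V. V \<noteq> 0 \<Longrightarrow> h (\<Phi> x) V V > 0" using h(1) by (auto simp: riem_metric_on_def)
  have H1: "H u v \<in> T \<and> (\<forall>Y\<in>T. h (\<Phi> x) (H u v) Y =
       h (\<Phi> x) (FD2 \<Phi> x u v - FD \<Phi> x (christoffel G x u v)) Y + koszul h (\<Phi> x) (FD \<Phi> x u) (FD \<Phi> x v) Y)" for u v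
    unfolding H T_def
  proof (rule theI', rule riesz_on_subspace[OF bil hsym hpos])
    show "subspace (tangent_at (proj ` Z1 m) (\<Phi> x))" using subT unfolding T_def .
    have "linear (h (\<Phi> x) W)" for W using bil by (simp add: bilinear_def)
    then show "linear (\<lambda>Y. h (\<Phi> x) (FD2 \<Phi> x u v - FD \<Phi> x (christoffel G x u v)) Y + koszul h (\<Phi> x) (FD \<Phi> x u) (FD \<Phi> x v) Y)"
      using linear_koszul[OF h(1)] by (intro linear_compose_add) auto
  qed
  have HT: "H u v \<in> T" for u v using H1 by blast
  have HA: "h (\<Phi> x) (H u v) (inf_act A (\<Phi> x)) = k * (hess_X x u v \<bullet> bracket A (X x))" if "skew A" for u v A
  proof -
    have "inf_act A (\<Phi> x) \<in> T" using that unfolding T by blast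
    then have "h (\<Phi> x) (H u v) (inf_act A (\<Phi> x)) = h (\<Phi> x) (FD2 \<Phi> x u v - FD \<Phi> x (christoffel G x u v)) (inf_act A (\<Phi> x))
       + koszul h (\<Phi> x) (FD \<Phi> x u) (FD \<Phi> x v) (inf_act A (\<Phi> x))" using H1[of u v] by blast
    also have "\<dots> = k * (hess_X x u v \<bullet> bracket A (X x))"
      by (rule hessian_pairing[where m = m, OF h], rule k, assumption+, rule Z, assumption, rule x, rule that)
    finally show ?thesis .
  qed
  have zero: "W = 0 \<longleftrightarrow> (\<forall>A. skew A \<longrightarrow> h (\<Phi> x) W (inf_act A (\<Phi> x)) = 0)" if "W \<in> T" for W
  proof
    assume *: "\<forall>A. skew A \<longrightarrow> h (\<Phi> x) W (inf_act A (\<Phi> x)) = 0"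
    have "h (\<Phi> x) W W = 0" using * that unfolding T by blast
    then show "W = 0" using hpos[of W] by force
  qed (simp add: bilinear_lzero[OF bil])
  have plus: "H u v + H u' v' = 0 \<longleftrightarrow> (\<forall>A. skew A \<longrightarrow> (hess_X x u v + hess_X x u' v') \<bullet> bracket A (X x) = 0)" for u v u' v'
    using k0 by (subst zero) (auto simp: subspace_add[OF subT] HT bilinear_ladd[OF bil] HA inner_add_left distrib_left[symmetric])
  have minus: "H u v - H u' v' = 0 \<longleftrightarrow> (\<forall>A. skew A \<longrightarrow> (hess_X x u v - hess_X x u' v') \<bullet> bracket A (X x) = 0)" for u v u' v'
    using k0 by (subst zero) (auto simp: subspace_diff[OF subT] HT bilinear_lsub[OF bil] HA inner_diff_left right_diff_distrib[symmetric])
  have neg: "hess_X x (- u) v = - hess_X x u v" "hess_X x u (- v) = - hess_X x u v" for u v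
    using linear_neg[OF hess_X_linear[OF x]] hess_X_sym[OF x] by metis+
  note jlx = linear_neg[OF jlin[OF x]]
  show ?thesis
  proof
    assume L: "\<forall>V\<in>T10 (j x). \<forall>W\<in>T01 (j x). complexified H V W = 0"
    show "\<forall>u v A. skew A \<longrightarrow> (hess_X x u v + hess_X x (j x u) (j x v)) \<bullet> bracket A (X x) = 0"
    proof (intro allI impI)
      fix u v and A :: "real^'n^'n" assume A: "skew A"
      have "(u, - j x u) \<in> T10 (j x)" "(v, j x v) \<in> T01 (j x)"
        by (simp_all add: T10_def T01_def jj[OF x] jlx)
      then have "complexified H (u, - j x u) (v, j x v) = 0" using L by blast
      then have "H u v - H (- j x u) (j x v) = 0" by (simp add: complexified_def zero_prod_def)
      then have "(hess_X x u v - hess_X x (- j x u) (j x v)) \<bullet> bracket A (X x) = 0" using minus A by blast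
      then show "(hess_X x u v + hess_X x (j x u) (j x v)) \<bullet> bracket A (X x) = 0" by (simp add: neg)
    qed
  next
    assume R: "\<forall>u v A. skew A \<longrightarrow> (hess_X x u v + hess_X x (j x u) (j x v)) \<bullet> bracket A (X x) = 0"
    show "\<forall>V\<in>T10 (j x). \<forall>W\<in>T01 (j x). complexified H V W = 0"
    proof (intro ballI)
      fix V W assume "V \<in> T10 (j x)" "W \<in> T01 (j x)"
      then obtain u u' v v' where "V = (u, u')" "j x u = - u'" "W = (v, v')" "j x v = v'"
        unfolding T10_def T01_def by blast
      then have V: "V = (u, - j x u)" and W: "W = (v, j x v)" by simp_all
      have "H u v - H (- j x u) (j x v) = 0"
        unfolding minus using R by (simp add: neg)
      moreover have "H u (j x v) + H (- j x u) v = 0"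
        unfolding plus
      proof (intro allI impI)
        fix A :: "real^'n^'n" assume "skew A"
        then have "(hess_X x u (j x v) + hess_X x (j x u) (j x (j x v))) \<bullet> bracket A (X x) = 0" using R by blast
        then show "(hess_X x u (j x v) + hess_X x (- j x u) v) \<bullet> bracket A (X x) = 0" by (simp add: jj[OF x] neg)
      qed
      ultimately show "complexified H V W = 0" by (simp add: complexified_def V W zero_prod_def)
    qed
  qed
qed

end

section \<open>The complex Gauss map in a chart\<close>

text \<open>Adjoining a vector \<open>b\<close> to a complex subspace adjoins the two real directions \<open>b\<close> and \<open>i b\<close>.\<close>

lemma real_dim_complex_span:
  fixes E :: "(complex^'n) set"
  assumes "finite E" "vec.independent E"
  shows "dim (vec.span E) = 2 * card E"
  using assms
proof (induction E rule: finite_induct)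
  case empty
  then show ?case by simp
next
  case (insert b E)
  have iE: "vec.independent E" "b \<notin> vec.span E"
    using insert by (auto simp: vec.independent_insert split: if_splits)
  define V where "V = vec.span E"
  have V: "vec.subspace V" by (simp add: V_def)
  have sV: "span V = V" using complex_subspace_real[OF V] by (simp add: span_eq_iff)
  have "\<i> *s b \<notin> span (insert b V)"
  proof
    assume "\<i> *s b \<in> span (insert b V)"
    then obtain r where "\<i> *s b - r *\<^sub>R b \<in> V" unfolding span_insert sV by blast
    then have *: "(\<i> - of_real r) *s b \<in> V"
      by (simp add: scaleR_vector_complex vector_sub_rdistrib)
    have "inverse (\<i> - of_real r) *s ((\<i> - of_real r) *s b) \<in> V"
      using V * by (simp only: vec.subspace_def)
    moreover have "\<i> - complex_of_real r \<noteq> 0" by (simp add: complex_eq_iff)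
    then have "inverse (\<i> - of_real r) *s ((\<i> - of_real r) *s b) = b"
      by (metis vector_smult_assoc left_inverse vector_smult_lid)
    ultimately show False using iE(2) by (simp add: V_def)
  qed
  then have "dim (insert (\<i> *s b) (insert b V)) = dim V + 2"
    using iE(2) by (simp add: dim_insert sV V_def[symmetric])
  moreover have "vec.span (insert b E) = span (insert (\<i> *s b) (insert b V))"
  proof (rule set_eqI)
    fix z
    have "z \<in> vec.span (insert b E) \<longleftrightarrow> (\<exists>c. z - c *s b \<in> V)"
      by (simp add: vec.span_insert V_def)
    also have "\<dots> \<longleftrightarrow> (\<exists>s r. z - s *\<^sub>R (\<i> *s b) - r *\<^sub>R b \<in> V)"
    proof
      assume "\<exists>c. z - c *s b \<in> V"
      then obtain c where "z - c *s b \<in> V" ..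
      moreover have "z - Im c *\<^sub>R (\<i> *s b) - Re c *\<^sub>R b = z - c *s b"
        by (simp add: vec_eq_iff complex_eq_iff algebra_simps)
      ultimately show "\<exists>s r. z - s *\<^sub>R (\<i> *s b) - r *\<^sub>R b \<in> V" by metis
    next
      assume "\<exists>s r. z - s *\<^sub>R (\<i> *s b) - r *\<^sub>R b \<in> V"
      then obtain s r where "z - s *\<^sub>R (\<i> *s b) - r *\<^sub>R b \<in> V" by blast
      moreover have "z - s *\<^sub>R (\<i> *s b) - r *\<^sub>R b = z - Complex r s *s b"
        by (simp add: vec_eq_iff complex_eq_iff algebra_simps)
      ultimately show "\<exists>c. z - c *s b \<in> V" by metis
    qed
    also have "\<dots> \<longleftrightarrow> z \<in> span (insert (\<i> *s b) (insert b V))"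
      by (simp add: span_insert sV)
    finally show "z \<in> vec.span (insert b E) \<longleftrightarrow> z \<in> span (insert (\<i> *s b) (insert b V))" .
  qed
  ultimately show ?case
    using insert iE by (simp add: dim_span V_def)
qed

lemma real_dim_complex:
  fixes E :: "(complex^'n) set"
  assumes "vec.subspace E"
  shows "dim E = 2 * vec.dim E"
proof -
  obtain C where C: "C \<subseteq> E" "vec.independent C" "vec.span C = E" "card C = vec.dim E"
    using vec.basis_exists[of E] assms by (metis vec.span_subspace)
  then show ?thesis using real_dim_complex_span[OF vec.finiteI_independent[OF C(2)] C(2)] by simp
qed

definition cvec :: "real^'n \<Rightarrow> real^'n \<Rightarrow> complex^'n" where
  "cvec a b = (\<chi> i. Complex (a $ i) (b $ i))"

lemma cvec_ex: "\<exists>a b. z = cvec a b"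
  by (intro exI[of _ "\<chi> i. Re (z $ i)"] exI[of _ "\<chi> i. Im (z $ i)"]) (simp add: cvec_def vec_eq_iff)

lemma cvec_eq_0: "cvec a b = 0 \<longleftrightarrow> a = 0 \<and> b = 0"
  by (auto simp: cvec_def vec_eq_iff complex_eq_iff)

lemma to_proj_cvec:
  "to_proj X K *v cvec a b = cvec ((1/2) *\<^sub>R (X *v a + K *v b)) ((1/2) *\<^sub>R (X *v b - K *v a))"
  by (simp add: to_proj_def cvec_def matrix_vector_mult_def vec_eq_iff complex_eq_iff Re_sum Im_sum
     sum_divide_distrib sum.distrib[symmetric] sum_subtractf[symmetric])
    (auto intro!: sum.cong simp: field_simps)

lemma hermitian_cvec: "hermitian (cvec a b) (cvec c d) = Complex (a \<bullet> c + b \<bullet> d) (b \<bullet> c - a \<bullet> d)"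
  by (simp add: hermitian_def cvec_def complex_eq_iff inner_vec_def Re_sum Im_sum sum.distrib sum_subtractf)

text \<open>On \<open>E + cnj E\<close> the projection onto this space, with real part \<open>X\<close>, is the identity and can be
  inserted on both sides of \<open>W\<close> in the Hermitian product of \<open>W e\<close> with a vector of the space.\<close>

lemma horizontal_at_off_diagonal:
  assumes E: "E \<in> Z1 m" and off: "X ** plane_part W ** X = 0" "X ** rot_part W ** X = 0" 
    and X: "X = plane_part (proj E)"
  shows "horizontal_at E W"
  unfolding horizontal_at_def normal_space_def
proof (intro ballI CollectI)
  fix e y assume e: "e \<in> E" and y: "y \<in> plus_conj E"
  have sub: "vec.subspace E" using E by (simp add: Z1_def)
  have cc: "cnj_vec (cnj_vec y) = y" "cnj_vec (c *s y) = cnj c *s cnj_vec y" "cnj_vec (y + z) = cnj_vec y + cnj_vec z" "cnj_vec 0 = 0" for c and y z :: "complex^'n"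
    by (simp_all add: cnj_vec_def vec_eq_iff)
  have subp: "vec.subspace (plus_conj E)"
    unfolding vec.subspace_def
  proof (intro conjI ballI allI)
    show "0 \<in> plus_conj E" unfolding plus_conj_def using vec.subspace_0[OF sub] cc(4) by force
  next
    fix z w assume "z \<in> plus_conj E" "w \<in> plus_conj E"
    then obtain z1 z2 w1 w2 where "z = z1 + cnj_vec z2" "w = w1 + cnj_vec w2" "z1 \<in> E" "z2 \<in> E" "w1 \<in> E" "w2 \<in> E"
      unfolding plus_conj_def by blast
    then show "z + w \<in> plus_conj E" unfolding plus_conj_def
      using vec.subspace_add[OF sub] by (intro CollectI exI[of _ "z1 + w1"] exI[of _ "z2 + w2"]) (simp add: cc)
  next
    fix c z assume "z \<in> plus_conj E"
    then obtain z1 z2 where "z = z1 + cnj_vec z2" "z1 \<in> E" "z2 \<in> E" unfolding plus_conj_def by blast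
    then show "c *s z \<in> plus_conj E" unfolding plus_conj_def
      using vec.subspace_scale[OF sub] by (intro CollectI exI[of _ "c *s z1"] exI[of _ "cnj c *s z2"]) (simp add: cc vector_add_ldistrib)
  qed
  define R where "R = pi_proj (proj E)"
  have R: "is_proj (plus_conj E) R" unfolding R_def by (rule is_proj_plus_conj[OF E is_proj_proj[OF sub]])
  have RX: "R = to_proj (2 *\<^sub>R X) 0"
    by (simp add: R_def X pi_proj_def cnj_mat_def to_proj_def plane_part_def vec_eq_iff complex_eq_iff)
  have "R ** to_proj (plane_part W) (rot_part W) ** R = to_proj 0 0"
    unfolding RX to_proj_mult using off by (simp add: mat_distrib mm.scaleR_left mm.scaleR_right)
  then have RWR: "R ** W ** R = 0" by (simp add: to_proj_linear)
  have "e \<in> plus_conj E" unfolding plus_conj_def using e vec.subspace_0[OF sub] cc(4) by force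
  then have Re: "R *v e = e" and Ry: "R *v y = y" using R y by (auto simp: is_proj_def)
  have "hermitian (W *v e) y = hermitian (W *v (R *v e)) (R *v y)" by (simp only: Re Ry)
  also have "\<dots> = hermitian (R *v (W *v (R *v e))) y" by (rule is_proj_adjoint[OF subp R, symmetric])
  also have "\<dots> = 0" by (simp add: matrix_vector_mul_assoc matrix_mul_assoc RWR hermitian_simps)
  finally show "hermitian (W *v e) y = 0" .
qed

context kaehler_chart
begin

definition gauss :: "'e \<Rightarrow> (complex^'n) set" where
  "gauss x = range (\<lambda>u. \<chi> i. Complex (FD F x u $ i) (- FD F x (j x u) $ i))"

lemma gauss_cvec: "gauss x = range (\<lambda>u. cvec (FD F x u) (- FD F x (j x u)))"
  by (simp add: gauss_def cvec_def)

lemma gauss_subspace: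
  assumes x: "x \<in> S"
  shows "vec.subspace (gauss x)"
proof -
  note l = linear_add[OF Dlin[OF x]] linear_scale[OF Dlin[OF x]] linear_add[OF jlin[OF x]] linear_scale[OF jlin[OF x]]
    linear_0[OF Dlin[OF x]] linear_0[OF jlin[OF x]] linear_neg[OF Dlin[OF x]]
    linear_diff[OF Dlin[OF x]]
  define e where "e u = cvec (FD F x u) (- FD F x (j x u))" for u
  have "0 = e 0" by (simp add: e_def l cvec_eq_0)
  moreover have "e u + e v = e (u + v)" for u v by (simp add: e_def l cvec_def vec_eq_iff complex_eq_iff)
  moreover have "c *s e u = e (Re c *\<^sub>R u + Im c *\<^sub>R j x u)" for c u
    by (simp add: e_def l jj[OF x] cvec_def vec_eq_iff complex_eq_iff)
  ultimately show ?thesis unfolding vec.subspace_def gauss_cvec e_def[symmetric] by auto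
qed

lemma G_j: "x \<in> S \<Longrightarrow> FD F x (j x u) \<bullet> FD F x v = - (FD F x u \<bullet> FD F x (j x v))"
  using jG[of x "j x u" v] jj[of x u] by (simp add: GF linear_neg[OF Dlin])

text \<open>The image is isotropic because \<open>j\<close> is orthogonal, and its real dimension is that of the manifold
  because \<open>F\<close> is an immersion.\<close>

lemma gauss_Z1:
  assumes x: "x \<in> S" and dim: "DIM('e) = 2 * m"
  shows "gauss x \<in> Z1 m"
proof -
  define e where "e u = cvec (FD F x u) (- FD F x (j x u))" for u
  have gx: "gauss x = range e" by (simp add: gauss_cvec e_def[abs_def])
  have "linear e"
    by (rule linearI) (simp_all add: e_def linear_add[OF Dlin[OF x]] linear_scale[OF Dlin[OF x]]
       linear_add[OF jlin[OF x]] linear_scale[OF jlin[OF x]] cvec_def vec_eq_iff complex_eq_iff)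
  moreover have "inj e"
    unfolding linear_injective_0[OF \<open>linear e\<close>]
    using Gpos[OF x] GF[OF x] by (force simp: e_def cvec_eq_0)
  ultimately have "dim (gauss x) = 2 * m"
    unfolding gx using dim_image_eq[of e UNIV] dim by simp
  then have "vec.dim (gauss x) = m" using real_dim_complex[OF gauss_subspace[OF x]] by simp
  moreover have "(\<Sum>i\<in>UNIV. e u $ i * e v $ i) = 0" for u v
  proof -
    have "FD F x (j x u) \<bullet> FD F x (j x v) = FD F x u \<bullet> FD F x v" using jG[OF x] GF[OF x] by simp
    then show ?thesis using G_j[OF x, of u v]
      by (simp add: e_def cvec_def complex_eq_iff Re_sum Im_sum inner_vec_def sum.distrib sum_subtractf sum_negf)
  qed
  ultimately show ?thesis using gauss_subspace[OF x] unfolding Z1_def gx by auto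
qed

text \<open>\<open>D u - i D (j u)\<close> is an eigenvector of \<open>K\<close> for the eigenvalue \<open>i\<close>, where \<open>(X - i K) / 2\<close> is the
  identity.\<close>

lemma proj_gauss:
  assumes x: "x \<in> S"
  shows "proj (gauss x) = \<Phi> x"
proof (rule proj_eq[OF gauss_subspace[OF x]])
  have 1: "\<Phi> x *v cvec (FD F x u) (- FD F x (j x u)) = cvec (FD F x u) (- FD F x (j x u))" for u
    by (simp add: \<Phi>_def to_proj_cvec mv.minus_right X_D[OF x] K_D[OF x] jj[OF x] linear_neg[OF Dlin[OF x]])
  have 2: "\<Phi> x *v z = 0" if z: "\<forall>w\<in>gauss x. hermitian z w = 0" for z
  proof -
    obtain a b where ab: "z = cvec a b" using cvec_ex by blast
    have o: "a \<bullet> FD F x v - b \<bullet> FD F x (j x v) = 0" "b \<bullet> FD F x v + a \<bullet> FD F x (j x v) = 0" for v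
    proof -
      have "hermitian (cvec a b) (cvec (FD F x v) (- FD F x (j x v))) = 0"
        using z unfolding gauss_cvec ab by blast
      then show "a \<bullet> FD F x v - b \<bullet> FD F x (j x v) = 0" "b \<bullet> FD F x v + a \<bullet> FD F x (j x v) = 0"
        by (simp_all add: hermitian_cvec complex_eq_iff)
    qed
    note ps = plane_structureD[OF XK_structure[OF x]]
    have XD: "(X x *v y) \<bullet> FD F x v = y \<bullet> FD F x v" "(K x *v y) \<bullet> FD F x v = - (y \<bullet> FD F x (j x v))" for y v
      unfolding transpose_vector_inner ps(1,2) by (simp_all add: X_D[OF x] K_D[OF x] mv.minus_left)
    have "X x *v (X x *v a + K x *v b) = 0" "X x *v (X x *v b - K x *v a) = 0"
      by (rule X_normal[OF x]; use o in \<open>simp add: inner_add_left inner_diff_left XD\<close>)+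
    then show ?thesis
      by (simp add: ab \<Phi>_def to_proj_cvec cvec_eq_0 mv.add_right mv.diff_right matrix_vector_mul_assoc ps)
  qed
  show "is_proj (gauss x) (\<Phi> x)"
    unfolding is_proj_def using 1 2 by (auto simp: gauss_cvec)
qed

lemma horizontal_gauss:
  assumes x: "x \<in> S" and dim: "DIM('e) = 2 * m"
  shows "horizontal_at (gauss x) (FD \<Phi> x u)"
proof (rule horizontal_at_off_diagonal[OF gauss_Z1[OF assms]])
  note ps = plane_structureD[OF XK_structure[OF x]]
  show "X x = plane_part (proj (gauss x))" by (simp add: proj_gauss[OF x] \<Phi>_parts)
  show "X x ** plane_part (FD \<Phi> x u) ** X x = 0" "X x ** rot_part (FD \<Phi> x u) ** X x = 0"
    unfolding FD_\<Phi>_parts[OF x] 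
    using reflection_off_diagonal(2)[OF ps(3) FD_X(1)[OF x]] reflection_off_diagonal(2)[OF ps(3) FD_K[OF x]] by auto
qed

end

section \<open>Charts and tangent vectors\<close>

lemma is_chartD:
  assumes "is_chart c"
  shows "open (fst c)" "open (chart_image c)"
    "p \<in> fst c \<Longrightarrow> chart_inv c (snd c p) = p" "x \<in> chart_image c \<Longrightarrow> snd c (chart_inv c x) = x"
    "x \<in> chart_image c \<Longrightarrow> chart_inv c x \<in> fst c" "p \<in> fst c \<Longrightarrow> snd c p \<in> chart_image c"
proof -
  show "open (fst c)" "open (chart_image c)" using assms by (simp_all add: is_chart_def)
  have h: "homeomorphism (fst c) (chart_image c) (snd c) (chart_inv c)" using assms by (simp add: is_chart_def)
  show "p \<in> fst c \<Longrightarrow> chart_inv c (snd c p) = p" "x \<in> chart_image c \<Longrightarrow> snd c (chart_inv c x) = x"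
    using homeomorphism_apply1[OF h] homeomorphism_apply2[OF h] by simp_all
  show "x \<in> chart_image c \<Longrightarrow> chart_inv c x \<in> fst c" using homeomorphism_image2[OF h] by blast
  show "p \<in> fst c \<Longrightarrow> snd c p \<in> chart_image c" by (simp add: chart_image_def)
qed

lemma open_overlap:
  assumes "is_chart c" "is_chart d"
  shows "open (snd c ` (fst c \<inter> fst d))"
proof -
  have h: "homeomorphism (fst c) (chart_image c) (snd c) (chart_inv c)" using assms by (simp add: is_chart_def)
  have "openin (top_of_set (fst c)) (fst c \<inter> fst d)"
    using is_chartD(1)[OF assms(2)] by (simp add: openin_open_Int)
  from homeomorphism_imp_open_map[OF h this] is_chartD(2)[OF assms(1)]
  show ?thesis by (metis openin_open_trans)
qed

locale atlas =
  fixes A :: "('a::topological_space, 'e::euclidean_space) chart set"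
  assumes A: "smooth_atlas A"
begin

lemma chart: "c \<in> A \<Longrightarrow> is_chart c"
  using A by (auto simp: smooth_atlas_def)

lemmas chart_simps = is_chartD[OF chart]

lemma ex_chart: "\<exists>c\<in>A. p \<in> fst c"
  using A unfolding smooth_atlas_def by blast

lemma transition_differentiable:
  assumes "c \<in> A" "d \<in> A" "p \<in> fst c" "p \<in> fst d"
  shows "(snd d \<circ> chart_inv c) differentiable (at (snd c p))"
  using A assms unfolding smooth_atlas_def by (intro smooth_on_differentiable[of "snd c ` (fst c \<inter> fst d)"]) auto

lemma FD_change_chart:
  fixes F :: "'a \<Rightarrow> 'v::real_normed_vector"
  assumes c: "c \<in> A" and d: "d \<in> A" and p: "p \<in> fst c" "p \<in> fst d"
    and F: "(F \<circ> chart_inv d) differentiable (at (snd d p))"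
  shows "FD (F \<circ> chart_inv c) (snd c p) u = FD (F \<circ> chart_inv d) (snd d p) (FD (snd d \<circ> chart_inv c) (snd c p) u)"
proof -
  have "FD (F \<circ> chart_inv c) (snd c p) u = FD ((F \<circ> chart_inv d) \<circ> (snd d \<circ> chart_inv c)) (snd c p) u"
    by (rule fun_cong[OF FD_cong[OF open_overlap[OF chart[OF c] chart[OF d]]]])
       (use p in \<open>auto simp: chart_simps[OF c] chart_simps[OF d]\<close>)
  also have "\<dots> = FD (F \<circ> chart_inv d) ((snd d \<circ> chart_inv c) (snd c p)) (FD (snd d \<circ> chart_inv c) (snd c p) u)"
    by (rule FD_chain[OF transition_differentiable[OF c d p]]) (use F p in \<open>simp add: chart_simps[OF c]\<close>)
  finally show ?thesis using p by (simp add: chart_simps[OF c])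
qed

lemma coord_vec_self:
  assumes "c \<in> A" "p \<in> fst c"
  shows "coord_vec A c p u c = u"
proof -
  have "FD (snd c \<circ> chart_inv c) (snd c p) = FD (\<lambda>x. x) (snd c p)"
    by (rule FD_cong[OF chart_simps(2)[OF assms(1)]]) (use assms in \<open>auto simp: chart_simps\<close>)
  then show ?thesis using assms by (simp add: coord_vec_def)
qed

lemma coord_vec_tangent:
  assumes c: "c \<in> A" "p \<in> fst c"
  shows "coord_vec A c p u \<in> tangent_space A p"
  unfolding tangent_space_def
proof (intro CollectI conjI allI ballI impI)
  fix d e assume de: "d \<in> A" "e \<in> A" "p \<in> fst d \<inter> fst e"
  have "FD (snd e \<circ> chart_inv c) (snd c p) u = FD (snd e \<circ> chart_inv d) (snd d p) (FD (snd d \<circ> chart_inv c) (snd c p) u)"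
    by (rule FD_change_chart) (use c de transition_differentiable in auto)
  then show "coord_vec A c p u e = FD (snd e \<circ> chart_inv d) (snd d p) (coord_vec A c p u d)"
    using de by (simp add: coord_vec_def)
qed (auto simp: coord_vec_def)

lemma tangent_transform:
  assumes "V \<in> tangent_space A p" "c \<in> A" "d \<in> A" "p \<in> fst c" "p \<in> fst d"
  shows "V d = FD (snd d \<circ> chart_inv c) (snd c p) (V c)"
  using assms unfolding tangent_space_def by blast

lemma tangent_eq_coord_vec:
  assumes c: "c \<in> A" "p \<in> fst c" and V: "V \<in> tangent_space A p"
  shows "V = coord_vec A c p (V c)"
proof
  fix d show "V d = coord_vec A c p (V c) d"
  proof (cases "d \<in> A \<and> p \<in> fst d")
    case True
    then show ?thesis using tangent_transform[OF V c(1) _ c(2)] by (simp add: coord_vec_def)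
  next
    case False
    then have "V d = 0" using V unfolding tangent_space_def by blast
    then show ?thesis using False by (auto simp: coord_vec_def)
  qed
qed

text \<open>The differential is defined in one chosen chart; the chain rule allows any chart.\<close>

lemma differential_eq:
  fixes F :: "'a \<Rightarrow> 'v::real_normed_vector"
  assumes F: "smooth_map A F" and c: "c \<in> A" "p \<in> fst c" and V: "V \<in> tangent_space A p"
  shows "differential A F p V = FD (F \<circ> chart_inv c) (snd c p) (V c)"
proof -
  define d where "d = (SOME c. c \<in> A \<and> p \<in> fst c)"
  have "\<exists>c. c \<in> A \<and> p \<in> fst c" using ex_chart by blast
  from someI_ex[OF this] have d: "d \<in> A" "p \<in> fst d" by (simp_all add: d_def)
  have "V d = FD (snd d \<circ> chart_inv c) (snd c p) (V c)"
    by (rule tangent_transform[OF V c(1) d(1) c(2) d(2)])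
  moreover have "(F \<circ> chart_inv d) differentiable (at (snd d p))"
    using F d chart_simps(6)[OF d] unfolding smooth_map_def by (blast intro: smooth_on_differentiable)
  ultimately show ?thesis
    unfolding differential_def Let_def d_def[symmetric] by (simp add: FD_change_chart[OF c(1) d(1) c(2) d(2)])
qed

end

section \<open>Parallel pluri-mean curvature and pluriharmonic Gauss maps\<close>

locale kaehler_immersion =
  fixes A :: "('a::topological_space, 'e::euclidean_space) chart set"
    and g :: "'a \<Rightarrow> ('a, 'e) tvec \<Rightarrow> ('a, 'e) tvec \<Rightarrow> real"
    and J :: "'a \<Rightarrow> ('a, 'e) tvec \<Rightarrow> ('a, 'e) tvec"
    and f :: "'a \<Rightarrow> real^'n"
  assumes kaehler: "kaehler_manifold A g J" and isometric: "isometric_immersion A g f"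
begin

sublocale atlas A
  using kaehler by unfold_locales (simp add: kaehler_manifold_def riemannian_manifold_def)

lemma smooth_f: "smooth_map A f"
  using isometric by (simp add: isometric_immersion_def)

lemma J_tangent: "V \<in> tangent_space A p \<Longrightarrow> J p V \<in> tangent_space A p"
  and J_J: "V \<in> tangent_space A p \<Longrightarrow> J p (J p V) = (\<lambda>c. - V c)"
  using kaehler by (auto simp: kaehler_manifold_def almost_complex_structure_def)

lemma coord_vec_endo_in:
  assumes c: "c \<in> A" and x: "x \<in> chart_image c"
  shows "J (chart_inv c x) (coord_vec A c (chart_inv c x) u) = coord_vec A c (chart_inv c x) (endo_in A J c x u)"
  unfolding endo_in_def
  using tangent_eq_coord_vec[OF c chart_simps(5)[OF c x]] J_tangent coord_vec_tangent[OF c chart_simps(5)[OF c x]] by blast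

lemma differential_coord_vec:
  assumes c: "c \<in> A" and x: "x \<in> chart_image c"
  shows "differential A f (chart_inv c x) (coord_vec A c (chart_inv c x) u) = FD (f \<circ> chart_inv c) x u"
  using differential_eq[OF smooth_f c chart_simps(5)[OF c x] coord_vec_tangent[OF c chart_simps(5)[OF c x]], of u]
  by (simp add: chart_simps(4)[OF c x] coord_vec_self[OF c chart_simps(5)[OF c x]])

lemma kaehler_chart:
  assumes c: "c \<in> A"
  shows "kaehler_chart (chart_image c) (f \<circ> chart_inv c) (metric_in A g c) (endo_in A J c)"
proof (rule kaehler_chart.intro)
  show "open (chart_image c)" by (rule chart_simps(2)[OF c])
  show "smooth_on (chart_image c) (f \<circ> chart_inv c)" using smooth_f c by (simp add: smooth_map_def)
  show "riem_metric_on (chart_image c) (metric_in A g c)"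
    using kaehler c by (simp add: kaehler_manifold_def riemannian_manifold_def)
  fix x assume x: "x \<in> chart_image c"
  note tan = coord_vec_tangent[OF c chart_simps(5)[OF c x]]
  show "metric_in A g c x u v = FD (f \<circ> chart_inv c) x u \<bullet> FD (f \<circ> chart_inv c) x v" for u v
    using isometric tan unfolding metric_in_def isometric_immersion_def differential_coord_vec[OF c x, symmetric] by metis
  show "linear (endo_in A J c x)"
    using kaehler c x by (simp add: kaehler_manifold_def almost_complex_structure_def)
  show "endo_in A J c x (endo_in A J c x u) = - u" for u
  proof -
    have "endo_in A J c x (endo_in A J c x u) = J (chart_inv c x) (J (chart_inv c x) (coord_vec A c (chart_inv c x) u)) c"
      by (simp add: coord_vec_endo_in[OF c x] coord_vec_self[OF c chart_simps(5)[OF c x]])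
    then show ?thesis using J_J[OF tan] coord_vec_self[OF c chart_simps(5)[OF c x]] by simp
  qed
  show "metric_in A g c x (endo_in A J c x u) (endo_in A J c x v) = metric_in A g c x u v" for u v
    using kaehler tan unfolding metric_in_def coord_vec_endo_in[OF c x, symmetric] kaehler_manifold_def by blast
  show "FD (\<lambda>y. endo_in A J c y v) x u + christoffel (metric_in A g c) x u (endo_in A J c x v) -
       endo_in A J c x (christoffel (metric_in A g c) x u v) = 0" for u v
    using kaehler c x unfolding kaehler_manifold_def parallel_endo_def by blast
next
  show "smooth_on (chart_image c) (\<lambda>x. endo_in A J c x u)" for u
    using kaehler c by (simp add: kaehler_manifold_def almost_complex_structure_def)
qed

text \<open>Tangent vectors at a point correspond to their coordinate vectors, so the Gauss map is known
  from its expression in any chart.\<close>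

lemma gauss_map_in_chart:
  assumes c: "c \<in> A" and x: "x \<in> chart_image c"
  shows "complex_gauss_map A J f (chart_inv c x) = kaehler_chart.gauss (f \<circ> chart_inv c) (endo_in A J c) x"
proof -
  interpret kc: kaehler_chart "chart_image c" "f \<circ> chart_inv c" "metric_in A g c" "endo_in A J c"
    by (rule kaehler_chart[OF c])
  define p where "p = chart_inv c x"
  have p: "p \<in> fst c" unfolding p_def by (rule chart_simps(5)[OF c x])
  define e where "e V = (\<chi> j. Complex (differential A f p V $ j) (- differential A f p (J p V) $ j))" for V
  have "tangent_space A p = range (coord_vec A c p)"
    using tangent_eq_coord_vec[OF c p] coord_vec_tangent[OF c p] by blast
  then have "complex_gauss_map A J f p = range (\<lambda>u. e (coord_vec A c p u))"
    unfolding complex_gauss_map_def e_def[symmetric] by auto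
  also have "\<dots> = kc.gauss x"
    unfolding kc.gauss_def e_def p_def differential_coord_vec[OF c x] coord_vec_endo_in[OF c x] ..
  finally show ?thesis unfolding p_def .
qed

end

theorem theorem5:
  fixes A :: "('a::{t2_space, second_countable_topology}, 'e::euclidean_space) chart set"
    and g :: "'a \<Rightarrow> ('a, 'e) tvec \<Rightarrow> ('a, 'e) tvec \<Rightarrow> real"
    and J :: "'a \<Rightarrow> ('a, 'e) tvec \<Rightarrow> ('a, 'e) tvec"
    and f :: "'a \<Rightarrow> real^'n"
    and h :: "complex^'n^'n \<Rightarrow> complex^'n^'n \<Rightarrow> complex^'n^'n \<Rightarrow> real"
    and m :: nat
  assumes "DIM('e) = 2 * m"
    and "kaehler_manifold A g J"
    and "isometric_immersion A g f"
    and "riem_metric_on UNIV h"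
    and "orth_invariant (proj ` Z1 m) h"
    and "riem_submersion_upto_scale (proj ` Z1 m) h (proj ` real_planes (2 * m)) pi_proj"
  shows "parallel_pluri_mean_curvature A g J f \<longleftrightarrow>
    (\<forall>p. complex_gauss_map A J f p \<in> Z1 m) \<and>
    superhorizontal A (complex_gauss_map A J f) \<and>
    pluriharmonic A g J (proj ` Z1 m) h (\<lambda>p. proj (complex_gauss_map A J f p))"
proof -
  interpret kaehler_immersion A g J f using assms(2,3) by unfold_locales
  define \<tau> where "\<tau> = complex_gauss_map A J f"
  define \<Psi> where "\<Psi> p = proj (\<tau> p)" for p
  obtain k where k0: "k > 0" and k: "\<And>P V W. P \<in> proj ` Z1 m \<Longrightarrow> V \<in> tangent_at (proj ` Z1 m) P \<Longrightarrow> W \<in> tangent_at (proj ` Z1 m) P \<Longrightarrow>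
      orth_act (reflection P) V = - V \<Longrightarrow> h P V W = k * (plane_part V \<bullet> plane_part W)"
    using metric_horizontal[OF assms(4-6)] by blast
  have inZ: "\<tau> p \<in> Z1 m" for p
  proof -
    obtain c where c: "c \<in> A" "p \<in> fst c" using ex_chart by blast
    interpret kc: kaehler_chart "chart_image c" "f \<circ> chart_inv c" "metric_in A g c" "endo_in A J c"
      by (rule kaehler_chart[OF c(1)])
    have "\<tau> (chart_inv c (snd c p)) \<in> Z1 m"
      unfolding \<tau>_def gauss_map_in_chart[OF c(1) chart_simps(6)[OF c]]
      by (rule kc.gauss_Z1[OF chart_simps(6)[OF c] assms(1)])
    then show ?thesis by (simp add: chart_simps(3)[OF c])
  qed
  have \<Psi>: "(\<Psi> \<circ> chart_inv c) x = kaehler_chart.\<Phi> (f \<circ> chart_inv c) (metric_in A g c) (endo_in A J c) x"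
    if c: "c \<in> A" and x: "x \<in> chart_image c" for c x
  proof -
    interpret kc: kaehler_chart "chart_image c" "f \<circ> chart_inv c" "metric_in A g c" "endo_in A J c"
      by (rule kaehler_chart[OF c])
    show ?thesis by (simp add: \<Psi>_def \<tau>_def gauss_map_in_chart[OF c x] kc.proj_gauss[OF x])
  qed
  have sm\<Psi>: "smooth_map A \<Psi>"
    unfolding smooth_map_def
  proof
    fix c assume c: "c \<in> A"
    interpret kc: kaehler_chart "chart_image c" "f \<circ> chart_inv c" "metric_in A g c" "endo_in A J c"
      by (rule kaehler_chart[OF c])
    show "smooth_on (chart_image c) (\<Psi> \<circ> chart_inv c)"
      by (rule smooth_on_cong[OF kc.S _ kc.smooth_\<Phi>]) (simp only: \<Psi>[OF c])
  qed
  have hor: "superhorizontal A \<tau>"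
    unfolding superhorizontal_def
  proof (intro allI ballI)
    fix p V assume V: "V \<in> tangent_space A p"
    obtain c where c: "c \<in> A" "p \<in> fst c" using ex_chart by blast
    interpret kc: kaehler_chart "chart_image c" "f \<circ> chart_inv c" "metric_in A g c" "endo_in A J c"
      by (rule kaehler_chart[OF c(1)])
    have x: "snd c p \<in> chart_image c" by (rule chart_simps(6)[OF c])
    have "differential A \<Psi> p V = FD kc.\<Phi> (snd c p) (V c)"
      unfolding differential_eq[OF sm\<Psi> c V] by (rule fun_cong[OF FD_cong[OF kc.S x]]) (rule \<Psi>[OF c(1)])
    moreover have "\<tau> p = kc.gauss (snd c p)"
      using gauss_map_in_chart[OF c(1) x] by (simp add: \<tau>_def chart_simps(3)[OF c])
    ultimately show "horizontal_at (\<tau> p) (differential A (\<lambda>q. proj (\<tau> q)) p V)"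
      using kc.horizontal_gauss[OF x assms(1)] by (simp add: \<Psi>_def[abs_def])
  qed
  have "parallel_pluri_mean_curvature A g J f \<longleftrightarrow> (\<forall>c\<in>A. \<forall>x\<in>chart_image c.
      \<forall>V\<in>T10 (endo_in A J c x). \<forall>W\<in>T01 (endo_in A J c x). complexified (hessian A g (proj ` Z1 m) h \<Psi> c x) V W = 0)"
    unfolding parallel_pluri_mean_curvature_def
  proof (intro ball_cong refl)
    fix c x assume c: "c \<in> A" and x: "x \<in> chart_image c"
    interpret kc: kaehler_chart "chart_image c" "f \<circ> chart_inv c" "metric_in A g c" "endo_in A J c"
      by (rule kaehler_chart[OF c])
    have pmc: "pluri_mean_curvature A J f c y v w = kc.pmc y v w" if "y \<in> chart_image c" for y v w
      by (simp add: pluri_mean_curvature_def kc.pmc_def second_ff_def kc.normal_part_X[OF that] kc.\<alpha>_eq[OF that])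
    have "FD (\<lambda>y. pluri_mean_curvature A J f c y v w) x u = FD (\<lambda>y. kc.pmc y v w) x u" for u v w
      by (rule fun_cong[OF FD_cong[OF kc.S x pmc]])
    then have L: "(\<forall>u v w. normal_part (f \<circ> chart_inv c) x (FD (\<lambda>y. pluri_mean_curvature A J f c y v w) x u)
       - pluri_mean_curvature A J f c x (Gam A g c x u v) w - pluri_mean_curvature A J f c x v (Gam A g c x u w) = 0)
      \<longleftrightarrow> (\<forall>u v B. skew B \<longrightarrow> (kc.hess_X x u v + kc.hess_X x (endo_in A J c x u) (endo_in A J c x v)) \<bullet> bracket B (kc.X x) = 0)"
      using kc.parallel_pmc_iff[OF x] by (simp add: pmc[OF x])
    have FD1: "FD (\<Psi> \<circ> chart_inv c) y = FD kc.\<Phi> y" if "y \<in> chart_image c" for y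
      by (rule FD_cong[OF kc.S that \<Psi>[OF c]])
    have FD2: "FD2 (\<Psi> \<circ> chart_inv c) x u v = FD2 kc.\<Phi> x u v" for u v
      unfolding FD2_def by (rule fun_cong[OF FD_cong[OF kc.S x]]) (simp only: FD1)
    have Z: "kc.\<Phi> y \<in> proj ` Z1 m" if "y \<in> chart_image c" for y
      using inZ \<Psi>[OF c that] by (metis \<Psi>_def comp_apply imageI)
    have "(\<forall>V\<in>T10 (endo_in A J c x). \<forall>W\<in>T01 (endo_in A J c x). complexified (hessian A g (proj ` Z1 m) h \<Psi> c x) V W = 0) \<longleftrightarrow>
      (\<forall>u v B. skew B \<longrightarrow> (kc.hess_X x u v + kc.hess_X x (endo_in A J c x u) (endo_in A J c x v)) \<bullet> bracket B (kc.X x) = 0)"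
    proof (rule kc.pluriharmonic_at_iff[OF assms(4,5) _ k0 _ x])
      show "hessian A g (proj ` Z1 m) h \<Psi> c x u v = (THE W. W \<in> tangent_at (proj ` Z1 m) (kc.\<Phi> x) \<and>
         (\<forall>Y\<in>tangent_at (proj ` Z1 m) (kc.\<Phi> x). h (kc.\<Phi> x) W Y =
           h (kc.\<Phi> x) (FD2 kc.\<Phi> x u v - FD kc.\<Phi> x (Gam A g c x u v)) Y + koszul h (kc.\<Phi> x) (FD kc.\<Phi> x u) (FD kc.\<Phi> x v) Y))" for u v
        unfolding hessian_def Let_def FD2 FD1[OF x] \<Psi>[OF c x] ..
    qed (fact k Z)+
    with L show "(\<forall>u v w. normal_part (f \<circ> chart_inv c) x (FD (\<lambda>y. pluri_mean_curvature A J f c y v w) x u)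
       - pluri_mean_curvature A J f c x (Gam A g c x u v) w - pluri_mean_curvature A J f c x v (Gam A g c x u w) = 0)
      \<longleftrightarrow> (\<forall>V\<in>T10 (endo_in A J c x). \<forall>W\<in>T01 (endo_in A J c x). complexified (hessian A g (proj ` Z1 m) h \<Psi> c x) V W = 0)"
      by blast
  qed
  moreover have "range \<Psi> \<subseteq> proj ` Z1 m" using inZ by (auto simp: \<Psi>_def)
  ultimately show ?thesis
    using inZ hor sm\<Psi> unfolding pluriharmonic_def \<Psi>_def[abs_def, symmetric] \<tau>_def[symmetric]
    by (simp add: \<Psi>_def[abs_def])
qed

end
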